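(* Let $\Phi$ be a locally square-integrable invariant random measure on $\mathbb R^d$, and let $K$ be an invariant probability kernel from $\Omega\times\mathbb R^d$ to $\mathbb R^d$. Let $K^*(\omega,x,B):=K(\omega,x,B+x)$, let $$\kappa(y):=\big\|\mathbb E^\Phi_{0,y}[K^*_y\otimes K^*_0]-\big(\mathbb E^\Phi_0[K^*_0]\big)^{\otimes2}\big\|,\quad y\in\mathbb R^d,$$ and assume that $\int\kappa(y)\,\alpha_\Phi(\mathrm dy)<\infty$. Let $L$ be the deterministic kernel $L(x,B):=\mathbb E^\Phi_0[K_0](B-x)$, $x\in\mathbb R^d$, $B\in\mathcal B^d$, and let $\eta:=\alpha_{K\Phi}-\alpha_{L\Phi}$. Then $$\hat\beta_{K\Phi}=\big|\mathbb E^\Phi_0[\hat K^*_0]\big|^2\cdot\hat\beta_\Phi+\hat\eta\cdot\lambda_d .$$ Further, $$\hat\eta(k)=\int e^{-i\langle k,y\rangle}\Big(\mathbb E^\Phi_{0,y}\Big[\hat K^*_y(k)\overline{\hat K^*_0(k)}\Big]-\big|\mathbb E^\Phi_0[\hat K^*_0(k)]\big|^2\Big)\,\alpha_\Phi(\mathrm dy),\quad k\in\mathbb R^d,$$ and $\hat\eta$ is continuous with $\hat\eta(0)=0$.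
   Context: $\lambda_d$ is Lebesgue measure and $\mathcal B^d$ the Borel $\sigma$-field on $\mathbb R^d$. $(\Omega,\mathcal A,\mathbb P)$ is a probability space, $(\Omega,\mathcal A)$ is a Borel space, and there is a measurable flow on $\Omega$: maps $\theta_x\colon\Omega\to\Omega$, $x\in\mathbb R^d$, with $(\omega,x)\mapsto\theta_x\omega$ measurable, $\theta_0=\mathrm{id}$, $\theta_x\circ\theta_y=\theta_{x+y}$, and $\mathbb P(\theta_xA)=\mathbb P(A)$ for all $x\in\mathbb R^d$, $A\in\mathcal A$. A random measure $\Phi$ on $\mathbb R^d$ is a random locally finite measure. It is invariant if $\Phi(\omega,B+x)=\Phi(\theta_x\omega,B)$ for all $\omega,x,B$, and locally square-integrable if $\mathbb E\Phi(B)^2<\infty$ for all bounded $B\in\mathcal B^d$. Its intensity $\gamma:=\mathbb E\Phi([0,1]^d)$ is assumed positive and finite. The Palm probability measure is $\mathbb P^\Phi_0(A):=\gamma^{-1}\mathbb E\int_{[0,1]^d}\mathbf 1_A(\theta_x)\,\Phi(\mathrm dx)$, with expectation $\mathbb E^\Phi_0$. The reduced second moment measure is $$\alpha_\Phi(B):=\mathbb E\int \mathbf 1\{x\in[0,1]^d,\,y-x\in B\}\,\Phi^2(\mathrm d(x,y)),\quad B\in\mathcal B^d .$$ The two-point Palm probability measures $\mathbb P^\Phi_{0,y}$, $y\in\mathbb R^d$, form a probability kernel from $\mathbb R^d$ to $\Omega$ satisfying $$\mathbb E\int f(x,y-x,\theta_x)\,\Phi^2(\mathrm d(x,y))=\iiint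 f(x,y,\omega)\,\mathbb P^\Phi_{0,y}(\mathrm d\omega)\,\alpha_\Phi(\mathrm dy)\,\mathrm dx$$ for all measurable $f\ge0$; $\mathbb E^\Phi_{0,y}$ is the corresponding expectation. A probability kernel $K$ from $\Omega\times\mathbb R^d$ to $\mathbb R^d$ is invariant if $K(\omega,x,B+x)=K(\theta_x\omega,0,B)$ for all $\omega,x,B$. Write $K_x=K(x)$ for the random probability measure $\omega\mapsto K(\omega,x,\cdot)$ (similarly $K^*_x$; note $K^*_0=K_0$) and $K\Phi(\omega,\cdot):=\int K(\omega,x,\cdot)\,\Phi(\omega,\mathrm dx)$ (an invariant random measure with the same intensity as $\Phi$). Expectations of random measures are taken setwise. For a finite signed measure $\nu$, $\|\nu\|:=\sup|\int f\,\mathrm d\nu|$ over measurable $f$ with values in $[-1,1]$. Under the hypotheses $K\Phi$ and $L\Phi$ are locally square-integrable and $\eta$ extends from bounded Borel sets to a signed measure of finite total variation. Fourier conventions: $\hat f(k)=\int f(x)e^{-i\langle k,x\rangle}\mathrm dx$; for a signed measure $\nu$ of finite total variation, $\hat\nu(k)=\int e^{-i\langle k,x\rangle}\nu(\mathrm dx)$; $\hat K^*_y(k):=\widehat{K^*_y}(k)$. The covariance measure of a stationary locally square-integrable random measure $\Psi$ with intensity $\gamma_\Psi$ is the signed measure (on bounded Borel sets) $\beta_\Psi:=\alpha_\Psi-\gamma_\Psi^2\lambda_d$; its Bartlett spectral measure $\hat\beta_\Psi$ is the unique locally finite measure on $\mathbb R^d$ with $\int (f\star g)(x)\,\beta_\Psi(\mathrm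 dx)=(2\pi)^{-d}\int\hat f(k)\overline{\hat g(k)}\,\hat\beta_\Psi(\mathrm dk)$ for all bounded measurable $f,g\colon\mathbb R^d\to\mathbb R$ with bounded support, where $(f\star g)(y)=\int f(x)g(x-y)\,\mathrm dx$. For a function $h$ and measure $\nu$, $h\cdot\nu$ is the measure with density $h$ w.r.t. $\nu$. *)

theory Defs
  imports "HOL-Probability.Probability"
begin

text \<open>A signed measure is a real-valued countably additive set function. Since infinite values
  are excluded, this is the notion of a \<^emph>\<open>finite\<close> signed measure.\<close>

definition signed_measure :: "'a measure \<Rightarrow> ('a set \<Rightarrow> real) \<Rightarrow> bool" where
  "signed_measure N \<nu> \<longleftrightarrow> \<nu> {} = 0 \<and>
     (\<forall>A. range A \<subseteq> sets N \<longrightarrow> disjoint_family A \<longrightarrow>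
        (\<lambda>i::nat. \<nu> (A i)) sums \<nu> (\<Union>i. A i))"

text \<open>The positive part of the Jordan decomposition; the coercion to \<^typ>\<open>ennreal\<close> truncates
  negative values to 0. The negative part is the positive part of the negated set function.\<close>

definition jordan_pos :: "'a measure \<Rightarrow> ('a set \<Rightarrow> real) \<Rightarrow> 'a measure" where
  "jordan_pos N \<nu> =
     measure_of (space N) (sets N) (\<lambda>B. SUP A\<in>{A \<in> sets N. A \<subseteq> B}. ennreal (\<nu> A))"

definition signed_integral ::
    "'a measure \<Rightarrow> ('a set \<Rightarrow> real) \<Rightarrow> ('a \<Rightarrow> 'b::{banach, second_countable_topology}) \<Rightarrow> 'b" where
  "signed_integral N \<nu> f =
     (\<integral>x. f x \<partial>jordan_pos N \<nu>) - (\<integral>x. f x \<partial>jordan_pos N (\<lambda>B. - \<nu> B))"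

definition tv_norm :: "'a measure \<Rightarrow> ('a set \<Rightarrow> real) \<Rightarrow> ennreal" where
  "tv_norm N \<nu> =
     (SUP f\<in>{f :: 'a \<Rightarrow> real. f \<in> borel_measurable N \<and> (\<forall>x\<in>space N. f x \<in> {-1..1})}.
        ennreal \<bar>signed_integral N \<nu> f\<bar>)"

definition fourier_fun :: "(real^'d \<Rightarrow> real) \<Rightarrow> real^'d \<Rightarrow> complex" where
  "fourier_fun f k = (\<integral>x. complex_of_real (f x) * exp (- (\<i> * complex_of_real (k \<bullet> x))) \<partial>lborel)"

definition fourier_measure :: "(real^'d) measure \<Rightarrow> real^'d \<Rightarrow> complex" where
  "fourier_measure \<mu> k = (\<integral>x. exp (- (\<i> * complex_of_real (k \<bullet> x))) \<partial>\<mu>)"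

definition fourier_signed :: "((real^'d) set \<Rightarrow> real) \<Rightarrow> real^'d \<Rightarrow> complex" where
  "fourier_signed \<nu> k =
     signed_integral borel \<nu> (\<lambda>x. exp (- (\<i> * complex_of_real (k \<bullet> x))))"

definition borel_space :: "'w measure \<Rightarrow> bool" where
  "borel_space M \<longleftrightarrow> (\<exists>S\<in>sets (borel :: real measure). \<exists>f g.
     f \<in> M \<rightarrow>\<^sub>M restrict_space borel S \<and> g \<in> restrict_space borel S \<rightarrow>\<^sub>M M \<and>
     (\<forall>\<omega>\<in>space M. g (f \<omega>) = \<omega>) \<and> (\<forall>t\<in>S. f (g t) = t))"

definition measurable_flow :: "'w measure \<Rightarrow> (real^'d \<Rightarrow> 'w \<Rightarrow> 'w) \<Rightarrow> bool" where
  "measurable_flow M \<theta> \<longleftrightarrow>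
     (\<lambda>(\<omega>, x). \<theta> x \<omega>) \<in> (M \<Otimes>\<^sub>M borel) \<rightarrow>\<^sub>M M \<and>
     (\<forall>\<omega>\<in>space M. \<theta> 0 \<omega> = \<omega>) \<and>
     (\<forall>\<omega>\<in>space M. \<forall>x y. \<theta> x (\<theta> y \<omega>) = \<theta> (x + y) \<omega>)"

definition flow_stationary :: "'w measure \<Rightarrow> (real^'d \<Rightarrow> 'w \<Rightarrow> 'w) \<Rightarrow> bool" where
  "flow_stationary M \<theta> \<longleftrightarrow> (\<forall>x. \<forall>A\<in>sets M. emeasure M (\<theta> x ` A) = emeasure M A)"

definition locally_finite :: "(real^'d) measure \<Rightarrow> bool" where
  "locally_finite \<mu> \<longleftrightarrow> sets \<mu> = sets borel \<and>
     (\<forall>B\<in>sets borel. bounded B \<longrightarrow> emeasure \<mu> B < \<infinity>)"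

definition random_measure :: "'w measure \<Rightarrow> ('w \<Rightarrow> (real^'d) measure) \<Rightarrow> bool" where
  "random_measure M \<Phi> \<longleftrightarrow>
     (\<forall>\<omega>\<in>space M. locally_finite (\<Phi> \<omega>)) \<and>
     (\<forall>B\<in>sets borel. (\<lambda>\<omega>. emeasure (\<Phi> \<omega>) B) \<in> borel_measurable M)"

definition invariant_measure ::
    "'w measure \<Rightarrow> (real^'d \<Rightarrow> 'w \<Rightarrow> 'w) \<Rightarrow> ('w \<Rightarrow> (real^'d) measure) \<Rightarrow> bool" where
  "invariant_measure M \<theta> \<Phi> \<longleftrightarrow> (\<forall>\<omega>\<in>space M. \<forall>x. \<forall>B\<in>sets borel.
     emeasure (\<Phi> \<omega>) ((\<lambda>y. y + x) ` B) = emeasure (\<Phi> (\<theta> x \<omega>)) B)"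

definition locally_square_integrable :: "'w measure \<Rightarrow> ('w \<Rightarrow> (real^'d) measure) \<Rightarrow> bool" where
  "locally_square_integrable M \<Phi> \<longleftrightarrow> (\<forall>B\<in>sets borel. bounded B \<longrightarrow>
     (\<integral>\<^sup>+\<omega>. (emeasure (\<Phi> \<omega>) B)\<^sup>2 \<partial>M) < \<infinity>)"

definition intensity :: "'w measure \<Rightarrow> ('w \<Rightarrow> (real^'d) measure) \<Rightarrow> ennreal" where
  "intensity M \<Phi> = (\<integral>\<^sup>+\<omega>. emeasure (\<Phi> \<omega>) (cbox 0 1) \<partial>M)"

definition palm ::
    "'w measure \<Rightarrow> (real^'d \<Rightarrow> 'w \<Rightarrow> 'w) \<Rightarrow> ('w \<Rightarrow> (real^'d) measure) \<Rightarrow> 'w measure" where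
  "palm M \<theta> \<Phi> = measure_of (space M) (sets M)
     (\<lambda>A. inverse (intensity M \<Phi>) *
            (\<integral>\<^sup>+\<omega>. (\<integral>\<^sup>+x\<in>cbox 0 1. indicator A (\<theta> x \<omega>) \<partial>\<Phi> \<omega>) \<partial>M))"

definition second_moment :: "'w measure \<Rightarrow> ('w \<Rightarrow> (real^'d) measure) \<Rightarrow> (real^'d) measure" where
  "second_moment M \<Phi> = measure_of UNIV (sets borel)
     (\<lambda>B. \<integral>\<^sup>+\<omega>. (\<integral>\<^sup>+(x, y). indicator (cbox 0 1) x * indicator B (y - x) \<partial>(\<Phi> \<omega> \<Otimes>\<^sub>M \<Phi> \<omega>)) \<partial>M)"

text \<open>The kernel below is determined by \<open>\<Phi>\<close> only up to a null set of the reduced second moment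
  measure, so it is described by its defining property.\<close>

definition two_point_palm ::
    "'w measure \<Rightarrow> (real^'d \<Rightarrow> 'w \<Rightarrow> 'w) \<Rightarrow> ('w \<Rightarrow> (real^'d) measure) \<Rightarrow>
     (real^'d \<Rightarrow> 'w measure) \<Rightarrow> bool" where
  "two_point_palm M \<theta> \<Phi> P2 \<longleftrightarrow>
     P2 \<in> borel \<rightarrow>\<^sub>M prob_algebra M \<and>
     (\<forall>f :: (real^'d) \<times> (real^'d) \<times> 'w \<Rightarrow> ennreal.
        f \<in> borel_measurable (borel \<Otimes>\<^sub>M borel \<Otimes>\<^sub>M M) \<longrightarrow>
        (\<integral>\<^sup>+\<omega>. (\<integral>\<^sup>+(x, y). f (x, y - x, \<theta> x \<omega>) \<partial>(\<Phi> \<omega> \<Otimes>\<^sub>M \<Phi> \<omega>)) \<partial>M) =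
        (\<integral>\<^sup>+x. (\<integral>\<^sup>+y. (\<integral>\<^sup>+\<omega>. f (x, y, \<omega>) \<partial>P2 y) \<partial>second_moment M \<Phi>) \<partial>lborel))"

definition invariant_prob_kernel ::
    "'w measure \<Rightarrow> (real^'d \<Rightarrow> 'w \<Rightarrow> 'w) \<Rightarrow> ('w \<Rightarrow> real^'d \<Rightarrow> (real^'d) measure) \<Rightarrow> bool" where
  "invariant_prob_kernel M \<theta> K \<longleftrightarrow>
     (\<lambda>(\<omega>, x). K \<omega> x) \<in> (M \<Otimes>\<^sub>M borel) \<rightarrow>\<^sub>M prob_algebra borel \<and>
     (\<forall>\<omega>\<in>space M. \<forall>x. \<forall>B\<in>sets borel.
        emeasure (K \<omega> x) ((\<lambda>y. y + x) ` B) = emeasure (K (\<theta> x \<omega>) 0) B)"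

text \<open>The preimage of \<open>B\<close> under \<open>\<lambda>y. y - x\<close> is the translate \<open>B + x\<close>, so this image measure
  is \<open>K\<^sup>*(\<omega>, x, B) = K(\<omega>, x, B + x)\<close>.\<close>

definition kernel_star ::
    "('w \<Rightarrow> real^'d \<Rightarrow> (real^'d) measure) \<Rightarrow> 'w \<Rightarrow> real^'d \<Rightarrow> (real^'d) measure" where
  "kernel_star K \<omega> x = distr (K \<omega> x) borel (\<lambda>y. y - x)"

text \<open>The measure \<open>K\<Phi>\<close>. Here \<^const>\<open>bind\<close> is applied to a possibly infinite measure; its value on
  \<open>B\<close> is still the integral of \<open>K(\<omega>, x, B)\<close> over \<open>\<Phi>(\<omega>, dx)\<close> (see \<open>emeasure_bind\<close>). Setwise
  expectations of random measures are written with \<^const>\<open>bind\<close> as well.\<close>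

definition transport ::
    "('w \<Rightarrow> real^'d \<Rightarrow> (real^'d) measure) \<Rightarrow> ('w \<Rightarrow> (real^'d) measure) \<Rightarrow> 'w \<Rightarrow> (real^'d) measure" where
  "transport K \<Phi> \<omega> = bind (\<Phi> \<omega>) (K \<omega>)"

text \<open>The deterministic kernel \<open>L(x, B) = E(B - x)\<close>, where \<open>E\<close> is the Palm expectation of \<open>K\<^sub>0\<close>.\<close>

definition mean_kernel ::
    "'w measure \<Rightarrow> (real^'d \<Rightarrow> 'w \<Rightarrow> 'w) \<Rightarrow> ('w \<Rightarrow> (real^'d) measure) \<Rightarrow>
     ('w \<Rightarrow> real^'d \<Rightarrow> (real^'d) measure) \<Rightarrow> real^'d \<Rightarrow> (real^'d) measure" where
  "mean_kernel M \<theta> \<Phi> K x = distr (bind (palm M \<theta> \<Phi>) (\<lambda>\<omega>. K \<omega> 0)) borel (\<lambda>y. y + x)"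

definition kappa ::
    "'w measure \<Rightarrow> (real^'d \<Rightarrow> 'w \<Rightarrow> 'w) \<Rightarrow> ('w \<Rightarrow> (real^'d) measure) \<Rightarrow>
     (real^'d \<Rightarrow> 'w measure) \<Rightarrow> ('w \<Rightarrow> real^'d \<Rightarrow> (real^'d) measure) \<Rightarrow> real^'d \<Rightarrow> ennreal" where
  "kappa M \<theta> \<Phi> P2 K y =
     (let \<mu> = bind (P2 y) (\<lambda>\<omega>. kernel_star K \<omega> y \<Otimes>\<^sub>M kernel_star K \<omega> 0);
          m = bind (palm M \<theta> \<Phi>) (\<lambda>\<omega>. kernel_star K \<omega> 0)
      in tv_norm (borel \<Otimes>\<^sub>M borel) (\<lambda>C. measure \<mu> C - measure (m \<Otimes>\<^sub>M m) C))"

definition bounded_test_fun :: "(real^'d \<Rightarrow> real) \<Rightarrow> bool" where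
  "bounded_test_fun f \<longleftrightarrow>
     f \<in> borel_measurable borel \<and> bounded (range f) \<and> bounded {x. f x \<noteq> 0}"

definition star_conv :: "(real^'d \<Rightarrow> real) \<Rightarrow> (real^'d \<Rightarrow> real) \<Rightarrow> real^'d \<Rightarrow> real" where
  "star_conv f g y = (\<integral>x. f x * g (x - y) \<partial>lborel)"

text \<open>Integration against the covariance measure \<open>\<beta> = \<alpha> - \<gamma>\<^sup>2 \<lambda>\<close>. This signed measure lives on
  bounded Borel sets only, and is only integrated against bounded functions of bounded support.\<close>

definition covariance_integral ::
    "'w measure \<Rightarrow> ('w \<Rightarrow> (real^'d) measure) \<Rightarrow> (real^'d \<Rightarrow> real) \<Rightarrow> real" where
  "covariance_integral M \<Psi> h =
     (\<integral>x. h x \<partial>second_moment M \<Psi>) - (enn2real (intensity M \<Psi>))\<^sup>2 * (\<integral>x. h x \<partial>lborel)"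

text \<open>The Bartlett spectral measure is the unique locally finite measure with the following
  property. \<^const>\<open>has_bochner_integral\<close> includes the integrability of the left-hand side.\<close>

definition bartlett_measure ::
    "'w measure \<Rightarrow> ('w \<Rightarrow> (real^'d) measure) \<Rightarrow> (real^'d) measure \<Rightarrow> bool" where
  "bartlett_measure M \<Psi> S \<longleftrightarrow> locally_finite S \<and>
     (\<forall>f g. bounded_test_fun f \<longrightarrow> bounded_test_fun g \<longrightarrow>
        has_bochner_integral S (\<lambda>k. fourier_fun f k * cnj (fourier_fun g k))
          ((2 * pi) ^ CARD('d) * covariance_integral M \<Psi> (star_conv f g)))"

end

theory Submission
  imports Defs
begin

text \<open>By invariance \<open>K\<^sup>*(\<omega>, x) = K(\<theta>\<^sub>x\<omega>, 0)\<close>, so the two-point Palm formula exhibits the reduced second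
  moment measure of \<open>K\<Phi>\<close> as the image under \<open>(y, v, u) \<mapsto> y + v - u\<close> of the measure
  \<open>A\<^sub>K(d(y, v, u)) = \<alpha>(dy) \<mu>\<^sub>y(d(v, u))\<close>, where \<open>\<mu>\<^sub>y\<close> is the expectation of \<open>K\<^sup>*\<^sub>y \<otimes> K\<^sup>*\<^sub>0\<close> under
  the two-point Palm measure; for \<open>L\<Phi>\<close> the kernel \<open>\<mu>\<^sub>y\<close> is replaced by \<open>m \<otimes> m\<close> with \<open>m\<close> the Palm mean
  of \<open>K\<^sub>0\<close>. Integrability of \<open>\<kappa>\<close> makes the difference of these two infinite measures a finite signed
  measure, and \<open>\<eta>\<close> is its image. Since \<open>\<alpha>\<close> is translation bounded, \<open>L\<Phi>\<close> and hence \<open>K\<Phi>\<close> have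
  locally finite second moment measures.

  For the spectral identity the Bartlett property is tested with translates of one tent function \<open>t\<close>.
  This determines the Fourier transforms of the finite measures with density \<open>w = |t'|\<^sup>2\<close> (\<open>t'\<close> being
  the Fourier transform of \<open>t\<close>) with respect to the Bartlett measures. Fourier inversion for the autocorrelation of \<open>t\<close> and injectivity of the
  Fourier transform give the identity on the ball where \<open>w > 0\<close>; this ball is arbitrarily large
  because the support of \<open>t\<close> can be chosen small.\<close>

section \<open>Sums and differences of measures\<close>

text \<open>Second moment measures are infinite and cannot be subtracted. Every difference is
  therefore stored as an equation between sums of positive measures, and becomes a subtraction of
  numbers or integrals only where finiteness or integrability is at hand. The Bartlett property, in
  turn, only evaluates products of a transform with a conjugate transform. Pairing a translate by x
  with the untranslated function contributes the phase exp(-i<x,k>), so varying x yields a Fourier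
  transform. A tent serves because its autocorrelation is continuous with bounded support and a
  nonnegative transform, which makes inversion accessible by Gaussian smoothing, and because its own
  transform has no zero in a prescribed ball. The factor |m^|^2 arises since the second moment
  measure of L\<Phi> is \<alpha> smeared by the random shift v - u under m \<otimes> m: averaging
  the Bartlett equation of \<Phi> over these shifts multiplies the spectrum by their characteristic
  function. The terms \<gamma>^2 \<lambda> cancel because transport by a probability kernel
  preserves the intensity. The density of the second summand is treated as complex until the
  comparison of measures shows it to be real.\<close>

definition add_measure :: "'a measure \<Rightarrow> 'a measure \<Rightarrow> 'a measure" where
  "add_measure \<mu> \<nu> = measure_of (space \<mu>) (sets \<mu>) (\<lambda>A. emeasure \<mu> A + emeasure \<nu> A)"

lemma sets_add_measure [simp, measurable_cong]: "sets (add_measure \<mu> \<nu>) = sets \<mu>"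
  by (simp add: add_measure_def)

lemma space_add_measure [simp]: "space (add_measure \<mu> \<nu>) = space \<mu>"
  by (simp add: add_measure_def)

lemma emeasure_add_measure:
  assumes "sets \<nu> = sets \<mu>" "A \<in> sets \<mu>"
  shows "emeasure (add_measure \<mu> \<nu>) A = emeasure \<mu> A + emeasure \<nu> A"
  unfolding add_measure_def
proof (rule emeasure_measure_of_sigma)
  show "sigma_algebra (space \<mu>) (sets \<mu>)" ..
  show "countably_additive (sets \<mu>) (\<lambda>A. emeasure \<mu> A + emeasure \<nu> A)"
  proof (rule countably_additiveI)
    fix A :: "nat \<Rightarrow> _" assume "range A \<subseteq> sets \<mu>" "disjoint_family A"
    then show "(\<Sum>i. emeasure \<mu> (A i) + emeasure \<nu> (A i)) =
        emeasure \<mu> (\<Union>i. A i) + emeasure \<nu> (\<Union>i. A i)"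
      using assms(1) by (simp add: suminf_add[symmetric] suminf_emeasure)
  qed
qed (use assms in \<open>auto simp: positive_def\<close>)

lemma nn_integral_add_measure:
  assumes s: "sets \<nu> = sets \<mu>" and f: "f \<in> borel_measurable \<mu>"
  shows "(\<integral>\<^sup>+x. f x \<partial>add_measure \<mu> \<nu>) = (\<integral>\<^sup>+x. f x \<partial>\<mu>) + (\<integral>\<^sup>+x. f x \<partial>\<nu>)"
  using f
proof (induction rule: borel_measurable_induct)
  case (cong f g)
  have "space \<nu> = space \<mu>" using s by (rule sets_eq_imp_space_eq)
  with cong show ?case
    by (metis (no_types, lifting) nn_integral_cong space_add_measure)
next
  case (set A)
  then show ?case using s by (simp add: emeasure_add_measure)
next
  case (mult u c)
  then have "u \<in> borel_measurable \<nu>" using s by (simp cong: measurable_cong_sets)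
  with mult show ?case by (simp add: nn_integral_cmult distrib_left)
next
  case (add u v)
  then have "u \<in> borel_measurable \<nu>" "v \<in> borel_measurable \<nu>"
    using s by (simp_all cong: measurable_cong_sets)
  with add show ?case by (simp add: nn_integral_add ac_simps)
next
  case (seq U)
  have m: "U i \<in> borel_measurable \<nu>" for i using seq s by (simp cong: measurable_cong_sets)
  have S: "(SUP i. U i) x = (SUP i. U i x)" for x by (simp add: image_comp)
  have "incseq (\<lambda>i. integral\<^sup>N \<mu> (U i))" "incseq (\<lambda>i. integral\<^sup>N \<nu> (U i))"
    using seq(3) by (auto simp: incseq_def le_fun_def intro!: nn_integral_mono)
  then show ?case
    unfolding S using seq m
    by (simp add: nn_integral_monotone_convergence_SUP ennreal_SUP_add)
qed

lemma integrable_add_measure: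
  fixes f :: "'a \<Rightarrow> 'b::{banach, second_countable_topology}"
  assumes s: "sets \<nu> = sets \<mu>"
  shows "integrable (add_measure \<mu> \<nu>) f \<longleftrightarrow> integrable \<mu> f \<and> integrable \<nu> f"
  using s by (auto simp: integrable_iff_bounded nn_integral_add_measure cong: measurable_cong_sets)

lemma integral_add_measure:
  fixes f :: "'a \<Rightarrow> 'b::{banach, second_countable_topology}"
  assumes s: "sets \<nu> = sets \<mu>" and f: "integrable \<mu> f" "integrable \<nu> f"
  shows "(\<integral>x. f x \<partial>add_measure \<mu> \<nu>) = (\<integral>x. f x \<partial>\<mu>) + (\<integral>x. f x \<partial>\<nu>)"
proof -
  have "integrable (add_measure \<mu> \<nu>) f" using f by (simp add: integrable_add_measure[OF s])
  then show ?thesis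
  proof (induction rule: integrable_induct)
    case (base A c)
    then have "emeasure \<mu> A < \<infinity>" "emeasure \<nu> A < \<infinity>" "A \<in> sets \<nu>"
      using s by (auto simp: emeasure_add_measure)
    with base s show ?case
      by (simp add: measure_def emeasure_add_measure enn2real_plus scaleR_add_left)
  next
    case (add f g)
    then show ?case by (simp add: integrable_add_measure[OF s])
  next
    case (lim f S)
    have sp: "space \<nu> = space \<mu>" using s by (rule sets_eq_imp_space_eq)
    have i: "integrable \<mu> f" "integrable \<nu> f" and iS: "integrable \<mu> (S i)" "integrable \<nu> (S i)" for i
      using lim by (auto simp: integrable_add_measure[OF s])
    have c: "(\<lambda>i. \<integral>x. S i x \<partial>N) \<longlonglongrightarrow> (\<integral>x. f x \<partial>N)"
      if "integrable N f" "\<And>i. integrable N (S i)" "space N = space \<mu>" for N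
      using that lim
      by (intro integral_dominated_convergence[where w="\<lambda>x. 2 * norm (f x)"])
         (auto dest: borel_measurable_integrable)
    have "(\<lambda>i. \<integral>x. S i x \<partial>add_measure \<mu> \<nu>) \<longlonglongrightarrow> (\<integral>x. f x \<partial>\<mu>) + (\<integral>x. f x \<partial>\<nu>)"
      unfolding lim(5) using iS i sp by (intro tendsto_add c) auto
    moreover have "(\<lambda>i. \<integral>x. S i x \<partial>add_measure \<mu> \<nu>) \<longlonglongrightarrow> (\<integral>x. f x \<partial>add_measure \<mu> \<nu>)"
      using lim by (intro c) auto
    ultimately show ?case by (rule LIMSEQ_unique[symmetric])
  qed
qed

text \<open>The integral against a signed measure does not depend on how it is written as a
  difference: with the subtracted parts moved across, both sides are one and the same sum of
  positive measures. Only integrability of \<open>f\<close> enters, so infinite measures are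
  covered.\<close>

lemma integral_diff_eq_of_add_eq:
  fixes f :: "'a \<Rightarrow> 'b::{banach, second_countable_topology}"
  assumes "sets \<mu>2 = sets \<mu>1" "sets \<nu>1 = sets \<mu>1" "sets \<nu>2 = sets \<mu>1"
    and eq: "\<And>A. A \<in> sets \<mu>1 \<Longrightarrow> emeasure \<mu>1 A + emeasure \<nu>2 A = emeasure \<mu>2 A + emeasure \<nu>1 A"
    and "integrable \<mu>1 f" "integrable \<mu>2 f" "integrable \<nu>1 f" "integrable \<nu>2 f"
  shows "(\<integral>x. f x \<partial>\<mu>1) - (\<integral>x. f x \<partial>\<mu>2) = (\<integral>x. f x \<partial>\<nu>1) - (\<integral>x. f x \<partial>\<nu>2)"
proof -
  have "add_measure \<mu>1 \<nu>2 = add_measure \<mu>2 \<nu>1"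
    by (rule measure_eqI) (use assms in \<open>auto simp: emeasure_add_measure\<close>)
  then have "(\<integral>x. f x \<partial>\<mu>1) + (\<integral>x. f x \<partial>\<nu>2) = (\<integral>x. f x \<partial>\<mu>2) + (\<integral>x. f x \<partial>\<nu>1)"
    using assms by (simp flip: integral_add_measure)
  then show ?thesis by (simp add: algebra_simps)
qed

section \<open>Jordan decomposition of a difference of two finite measures\<close>

lemma (in finite_measure) integrable_bounded:
  fixes f :: "'a \<Rightarrow> 'b::{banach, second_countable_topology}"
  assumes "f \<in> borel_measurable M" "\<And>x. x \<in> space M \<Longrightarrow> norm (f x) \<le> B"
  shows "integrable M f"
  by (rule integrable_const_bound[where B=B]) (use assms in auto)

text \<open>\<open>Y\<close> is a Hahn set for \<open>\<mu>1\<close> against \<open>\<mu>2\<close>.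
  The supremum over measurable subsets of B in \<open>jordan_pos\<close> is attained at B \<inter>
  Y, hence it is a measure. \<open>diff_measure\<close> is well behaved here because
  \<open>\<mu>2\<close> lies below \<open>\<mu>1\<close> on all subsets of \<open>Y\<close>.\<close>

lemma jordan_pos_diff_measure:
  assumes fin: "finite_measure \<mu>1" "finite_measure \<mu>2"
    and s: "sets \<mu>1 = sets N" "sets \<mu>2 = sets N"
    and \<nu>: "\<And>A. A \<in> sets N \<Longrightarrow> \<nu> A = measure \<mu>1 A - measure \<mu>2 A"
    and Y: "Y \<in> sets N"
      "\<And>X. X \<in> sets N \<Longrightarrow> X \<subseteq> Y \<Longrightarrow> emeasure \<mu>2 X \<le> emeasure \<mu>1 X"
      "\<And>X. X \<in> sets N \<Longrightarrow> X \<inter> Y = {} \<Longrightarrow> emeasure \<mu>1 X \<le> emeasure \<mu>2 X"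
  shows "jordan_pos N \<nu> = diff_measure (density \<mu>1 (indicator Y)) (density \<mu>2 (indicator Y))"
proof -
  interpret m1: finite_measure \<mu>1 by fact
  interpret m2: finite_measure \<mu>2 by fact
  let ?D = "diff_measure (density \<mu>1 (indicator Y)) (density \<mu>2 (indicator Y))"
  have restr: "emeasure (density \<mu> (indicator Y)) A = emeasure \<mu> (A \<inter> Y)"
    if "A \<in> sets N" "sets \<mu> = sets N" for \<mu> A
    using that Y(1) by (simp add: emeasure_restricted Int_commute)
  have fd: "finite_measure (density \<mu> (indicator Y))" if "finite_measure \<mu>" "sets \<mu> = sets N" for \<mu>
    using that
    by (intro finite_measureI)
       (simp add: restr[OF sets.top] sets_eq_imp_space_eq[OF that(2)] finite_measure.emeasure_finite)
  have eD: "emeasure ?D B = emeasure \<mu>1 (B \<inter> Y) - emeasure \<mu>2 (B \<inter> Y)" if "B \<in> sets N" for B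
    using that Y s fin by (subst emeasure_diff_measure) (auto simp: restr fd)
  have real: "ennreal (\<nu> (B \<inter> Y)) = emeasure \<mu>1 (B \<inter> Y) - emeasure \<mu>2 (B \<inter> Y)" if "B \<in> sets N" for B
  proof -
    have "B \<inter> Y \<in> sets N" using that Y by auto
    then show ?thesis
      by (simp add: \<nu> ennreal_minus m1.emeasure_eq_measure m2.emeasure_eq_measure)
  qed
  have sup: "(SUP A\<in>{A \<in> sets N. A \<subseteq> B}. ennreal (\<nu> A)) = emeasure ?D B" if B: "B \<in> sets N" for B
  proof (rule antisym)
    show "emeasure ?D B \<le> (SUP A\<in>{A \<in> sets N. A \<subseteq> B}. ennreal (\<nu> A))"
      unfolding eD[OF B] real[OF B, symmetric] by (rule SUP_upper) (use B Y in auto)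
    show "(SUP A\<in>{A \<in> sets N. A \<subseteq> B}. ennreal (\<nu> A)) \<le> emeasure ?D B"
      unfolding eD[OF B] real[OF B, symmetric]
    proof (rule SUP_least)
      \<comment> \<open>Passing from A to B \<inter> Y drops A - Y, where the difference is
        nonpositive, and adds the part of B - A inside Y, where it is nonnegative.\<close>
      fix A assume A: "A \<in> {A \<in> sets N. A \<subseteq> B}"
      have "A = (A \<inter> Y) \<union> (A - Y)" by auto
      then have d: "measure \<mu> A = measure \<mu> (A \<inter> Y) + measure \<mu> (A - Y)" if "finite_measure \<mu>" "sets \<mu> = sets N" for \<mu>
        using that A Y by (subst finite_measure.finite_measure_Union[OF that(1), symmetric]) auto
      have "B \<inter> Y = (A \<inter> Y) \<union> ((B - A) \<inter> Y)" using A by auto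
      then have e: "measure \<mu> (B \<inter> Y) = measure \<mu> (A \<inter> Y) + measure \<mu> ((B - A) \<inter> Y)" if "finite_measure \<mu>" "sets \<mu> = sets N" for \<mu>
        using that A B Y by (subst finite_measure.finite_measure_Union[OF that(1), symmetric]) auto
      have "A - Y \<in> sets N" "(A - Y) \<inter> Y = {}" using A Y(1) by auto
      from Y(3)[OF this] have "measure \<mu>1 (A - Y) \<le> measure \<mu>2 (A - Y)"
        by (simp add: m1.emeasure_eq_measure m2.emeasure_eq_measure)
      moreover have "measure \<mu>2 ((B - A) \<inter> Y) \<le> measure \<mu>1 ((B - A) \<inter> Y)"
        using Y(2)[of "(B - A) \<inter> Y"] A B Y(1) by (simp add: m1.emeasure_eq_measure m2.emeasure_eq_measure sets.Int sets.Diff)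
      moreover have "A \<in> sets N" "B \<inter> Y \<in> sets N" using A B Y(1) by auto
      ultimately have "\<nu> A \<le> \<nu> (B \<inter> Y)"
        using d[OF fin(1) s(1)] d[OF fin(2) s(2)] e[OF fin(1) s(1)] e[OF fin(2) s(2)] by (simp add: \<nu>)
      then show "ennreal (\<nu> A) \<le> ennreal (\<nu> (B \<inter> Y))" by (rule ennreal_leI)
    qed
  qed
  show ?thesis
  proof (rule measure_eqI)
    show "sets (jordan_pos N \<nu>) = sets ?D" by (simp add: jordan_pos_def s)
    fix B assume "B \<in> sets (jordan_pos N \<nu>)"
    then have B: "B \<in> sets N" by (simp add: jordan_pos_def)
    have "emeasure (jordan_pos N \<nu>) B = (SUP A\<in>{A \<in> sets N. A \<subseteq> B}. ennreal (\<nu> A))"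
      unfolding jordan_pos_def
    proof (rule emeasure_measure_of_sigma)
      show "sigma_algebra (space N) (sets N)" ..
      show "positive (sets N) (\<lambda>B. SUP A\<in>{A \<in> sets N. A \<subseteq> B}. ennreal (\<nu> A))"
        using sup[of "{}"] by (simp add: positive_def)
      \<comment> \<open>Countable additivity of the supremum is inherited from \<open>?D\<close>,
        with which it agrees on measurable sets.\<close>
      show "countably_additive (sets N) (\<lambda>B. SUP A\<in>{A \<in> sets N. A \<subseteq> B}. ennreal (\<nu> A))"
      proof (rule countably_additiveI)
        fix A :: "nat \<Rightarrow> _" assume A: "range A \<subseteq> sets N" "disjoint_family A" "\<Union>(range A) \<in> sets N"
        then show "(\<Sum>i. SUP C\<in>{C \<in> sets N. C \<subseteq> A i}. ennreal (\<nu> C)) = (SUP C\<in>{C \<in> sets N. C \<subseteq> \<Union>(range A)}. ennreal (\<nu> C))"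
          using suminf_emeasure[of A ?D] by (simp add: sup s range_subsetD)
      qed
    qed fact
    with sup[OF B] show "emeasure (jordan_pos N \<nu>) B = emeasure ?D B" by simp
  qed
qed

text \<open>Evaluates \<open>signed_integral\<close> through any representation by finite measures.
  The Jordan parts are \<open>\<mu>1\<close> - \<open>\<mu>2\<close> on a Hahn set Y and
  \<open>\<mu>2\<close> - \<open>\<mu>1\<close> on its complement; added back crosswise they give
  the same measure on both sides, so the representation may be exchanged.\<close>

lemma signed_integral_diff:
  fixes f :: "'a \<Rightarrow> 'b::{banach, second_countable_topology}"
  assumes fin: "finite_measure \<mu>1" "finite_measure \<mu>2"
    and s: "sets \<mu>1 = sets N" "sets \<mu>2 = sets N"
    and \<nu>: "\<And>A. A \<in> sets N \<Longrightarrow> \<nu> A = measure \<mu>1 A - measure \<mu>2 A"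
    and f: "f \<in> borel_measurable N" "\<And>x. x \<in> space N \<Longrightarrow> norm (f x) \<le> C"
  shows "signed_integral N \<nu> f = (\<integral>x. f x \<partial>\<mu>1) - (\<integral>x. f x \<partial>\<mu>2)"
proof -
  interpret m1: finite_measure \<mu>1 by fact
  interpret m2: finite_measure \<mu>2 by fact
  have "\<exists>Y\<in>sets \<mu>1. Y \<subseteq> space \<mu>1 \<and> (\<forall>X\<in>sets \<mu>1. X \<subseteq> Y \<longrightarrow> emeasure \<mu>2 X \<le> emeasure \<mu>1 X) \<and>
      (\<forall>X\<in>sets \<mu>1. X \<subseteq> space \<mu>1 \<longrightarrow> X \<inter> Y = {} \<longrightarrow> emeasure \<mu>1 X \<le> emeasure \<mu>2 X)"
    using s by (intro unsigned_Hahn_decomposition) auto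
  then obtain Y where "Y \<in> sets \<mu>1"
    and Y1: "\<forall>X\<in>sets \<mu>1. X \<subseteq> Y \<longrightarrow> emeasure \<mu>2 X \<le> emeasure \<mu>1 X"
    and "\<forall>X\<in>sets \<mu>1. X \<subseteq> space \<mu>1 \<longrightarrow> X \<inter> Y = {} \<longrightarrow> emeasure \<mu>1 X \<le> emeasure \<mu>2 X"
    by (elim bexE conjE)
  then have Y2: "\<forall>X\<in>sets \<mu>1. X \<inter> Y = {} \<longrightarrow> emeasure \<mu>1 X \<le> emeasure \<mu>2 X"
    by (simp add: sets.sets_into_space)
  from \<open>Y \<in> sets \<mu>1\<close> s have Y: "Y \<in> sets N" by simp
  note YY = Y1[unfolded s] Y2[unfolded s]
  define Z where "Z = space N - Y"
  have Z: "Z \<in> sets N" using Y by (auto simp: Z_def)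
  have X1: "X \<inter> Y = {}" if "X \<subseteq> Z" for X using that by (auto simp: Z_def)
  have X2: "X \<subseteq> Y" if "X \<in> sets N" "X \<inter> Z = {}" for X
    using that sets.sets_into_space[of X N] by (auto simp: Z_def)
  let ?d = "\<lambda>\<mu> Y. density \<mu> (indicator Y)"
  have Jp: "jordan_pos N \<nu> = diff_measure (?d \<mu>1 Y) (?d \<mu>2 Y)"
    by (rule jordan_pos_diff_measure) (use assms Y YY in auto)
  \<comment> \<open>Negating the set function exchanges the two measures, and the complement Z takes
    over the role of the Hahn set.\<close>
  have Jn: "jordan_pos N (\<lambda>B. - \<nu> B) = diff_measure (?d \<mu>2 Z) (?d \<mu>1 Z)"
    by (rule jordan_pos_diff_measure) (use assms Z YY X1 X2 in auto)
  have restr: "emeasure (?d \<mu> V) A = emeasure \<mu> (A \<inter> V)"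
    if "A \<in> sets N" "V \<in> sets N" "sets \<mu> = sets N" for \<mu> A V
    using that by (simp add: emeasure_restricted Int_commute)
  have fd: "finite_measure (?d \<mu> V)" if "finite_measure \<mu>" "sets \<mu> = sets N" "V \<in> sets N" for \<mu> V
    using that finite_measure.finite_emeasure_space[OF that(1)]
    by (intro finite_measureI)
       (simp add: restr[OF sets.top] sets_eq_imp_space_eq[OF that(2)] finite_measure.emeasure_finite)
  have ep: "emeasure (jordan_pos N \<nu>) B = emeasure \<mu>1 (B \<inter> Y) - emeasure \<mu>2 (B \<inter> Y)" if "B \<in> sets N" for B
    unfolding Jp using that Y s YY fin
    by (subst emeasure_diff_measure) (auto simp: restr fd)
  have en: "emeasure (jordan_pos N (\<lambda>B. - \<nu> B)) B = emeasure \<mu>2 (B \<inter> Z) - emeasure \<mu>1 (B \<inter> Z)" if "B \<in> sets N" for B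
    unfolding Jn using that Z s YY X1 fin
    by (subst emeasure_diff_measure) (auto simp: restr fd)
  have fin': "finite_measure (jordan_pos N \<nu>)" "finite_measure (jordan_pos N (\<lambda>B. - \<nu> B))"
    using ep[OF sets.top] en[OF sets.top]
    by (auto intro!: finite_measureI simp: jordan_pos_def ennreal_minus_eq_top)
  have eq: "emeasure \<mu>1 A + emeasure (jordan_pos N (\<lambda>B. - \<nu> B)) A = emeasure \<mu>2 A + emeasure (jordan_pos N \<nu>) A"
    if A: "A \<in> sets N" for A
  proof -
    have AZ: "A = (A \<inter> Y) \<union> (A \<inter> Z)" "(A \<inter> Y) \<inter> (A \<inter> Z) = {}"
      using sets.sets_into_space[OF A] by (auto simp: Z_def)
    have d: "emeasure \<mu> A = emeasure \<mu> (A \<inter> Y) + emeasure \<mu> (A \<inter> Z)" if "sets \<mu> = sets N" for \<mu>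
      using that A Y Z by (subst AZ(1), subst plus_emeasure[symmetric]) (auto simp: Z_def)
    have le: "emeasure \<mu>2 (A \<inter> Y) \<le> emeasure \<mu>1 (A \<inter> Y)" "emeasure \<mu>1 (A \<inter> Z) \<le> emeasure \<mu>2 (A \<inter> Z)"
      using YY A Y Z X1 by auto
    have "emeasure \<mu>2 (A \<inter> Y) + (emeasure \<mu>1 (A \<inter> Y) - emeasure \<mu>2 (A \<inter> Y)) = emeasure \<mu>1 (A \<inter> Y)"
      "emeasure \<mu>1 (A \<inter> Z) + (emeasure \<mu>2 (A \<inter> Z) - emeasure \<mu>1 (A \<inter> Z)) = emeasure \<mu>2 (A \<inter> Z)"
      using le by (simp_all add: add_diff_inverse_ennreal)
    then show ?thesis
      unfolding ep[OF A] en[OF A] d[OF s(1)] d[OF s(2)]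
      by (metis (no_types, opaque_lifting) add.assoc add.commute)
  qed
  show ?thesis
    unfolding signed_integral_def
    by (rule integral_diff_eq_of_add_eq[symmetric])
       (use s f eq fin fin' in \<open>auto simp: jordan_pos_def sets_eq_imp_space_eq[OF s(1)] sets_eq_imp_space_eq[OF s(2)] cong: measurable_cong_sets intro!: finite_measure.integrable_bounded[where B=C]\<close>)
qed

lemma signed_integral_le_tv_norm:
  assumes "f \<in> borel_measurable N" "\<And>x. x \<in> space N \<Longrightarrow> \<bar>f x\<bar> \<le> 1"
  shows "ennreal \<bar>signed_integral N \<nu> f\<bar> \<le> tv_norm N \<nu>"
  unfolding tv_norm_def
  by (rule SUP_upper) (use assms in \<open>auto simp: abs_le_iff minus_le_iff\<close>)

section \<open>Finite differences of infinite measures\<close>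

text \<open>Subtraction in \<open>ennreal\<close> truncates, so the density is the positive part of
  \<open>f - g\<close>. It lives where \<open>g \<le> f\<close>, and its mass on \<open>R n\<close>
  is the excess of one measure over the other there, at most \<open>C\<close>. The bound does not
  depend on n and so survives the exhaustion.\<close>

lemma finite_measure_density_diff:
  assumes f: "f \<in> borel_measurable S" "g \<in> borel_measurable S"
    and R: "range R \<subseteq> sets S" "incseq R" "(\<Union>n::nat. R n) = space S"
    and fin: "\<And>n. emeasure (density S g) (R n) < \<infinity>" and C: "C < \<infinity>"
    and le: "\<And>n D. D \<in> sets S \<Longrightarrow> D \<subseteq> R n \<Longrightarrow> emeasure (density S f) D \<le> emeasure (density S g) D + C"
  shows "finite_measure (density S (\<lambda>x. f x - g x :: ennreal))"
proof -
  note [measurable] = f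
  let ?D = "density S (\<lambda>x. f x - g x)"
  have b: "emeasure ?D (R n) \<le> C" for n
  proof -
    have Rn[measurable]: "R n \<in> sets S" using R by auto
    define E where "E = {x \<in> R n. g x \<le> f x}"
    have "E = R n \<inter> {x \<in> space S. g x \<le> f x}"
      using sets.sets_into_space[OF Rn] by (auto simp: E_def)
    then have E[measurable]: "E \<in> sets S" by simp
    have "emeasure ?D (R n) = emeasure ?D E"
      by (simp add: emeasure_density, intro nn_integral_cong) (auto simp: E_def indicator_def diff_eq_0_iff_ennreal not_le less_top[symmetric])
    moreover have "emeasure ?D E + emeasure (density S g) E = emeasure (density S f) E"
      by (simp add: emeasure_density flip: nn_integral_add)
         (auto intro!: nn_integral_cong simp: E_def indicator_def diff_add_cancel_ennreal)
    moreover have "emeasure (density S f) E \<le> emeasure (density S g) E + C"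
      using le[OF E, of n] by (auto simp: E_def)
    \<comment> \<open>Finiteness inside \<open>R n\<close> is what allows this mass to be cancelled
      from both sides of the estimate.\<close>
    moreover have "emeasure (density S g) E < \<infinity>"
      using fin[of n] emeasure_mono[of E "R n" "density S g"] by (auto simp: E_def)
    ultimately have "emeasure (density S g) E + emeasure ?D (R n) \<le> emeasure (density S g) E + C"
      and "emeasure (density S g) E \<noteq> top"
      by (simp_all add: add.commute)
    then show ?thesis by (simp add: ennreal_add_left_cancel_le)
  qed
  have "emeasure ?D (space S) = (SUP n. emeasure ?D (R n))"
    using R by (subst SUP_emeasure_incseq) auto
  also have "\<dots> \<le> C" using b by (rule SUP_least)
  finally show ?thesis using C by (intro finite_measureI) (auto simp: top_unique)
qed

text \<open>Both measures have densities with respect to their sigma-finite sum. For the densities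
  \<open>f1\<close>, \<open>f2\<close> a difference makes sense pointwise, and \<open>N1\<close>,
  \<open>N2\<close> have its positive and negative part as densities; the uniform one-sided bounds
  by \<open>C\<close> make them finite.\<close>

lemma finite_difference_decomposition:
  assumes s: "sets A2 = sets A1"
    and R: "range R \<subseteq> sets A1" "incseq R" "(\<Union>n::nat. R n) = space A1"
    and fin: "\<And>n. emeasure A1 (R n) < \<infinity>" "\<And>n. emeasure A2 (R n) < \<infinity>" and C: "C < \<infinity>"
    and le: "\<And>n D. D \<in> sets A1 \<Longrightarrow> D \<subseteq> R n \<Longrightarrow> emeasure A1 D \<le> emeasure A2 D + C"
      "\<And>n D. D \<in> sets A1 \<Longrightarrow> D \<subseteq> R n \<Longrightarrow> emeasure A2 D \<le> emeasure A1 D + C"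
  obtains N1 N2 where "finite_measure N1" "finite_measure N2" "sets N1 = sets A1" "sets N2 = sets A1"
    "\<And>D. D \<in> sets A1 \<Longrightarrow> emeasure A1 D + emeasure N2 D = emeasure A2 D + emeasure N1 D"
proof -
  define S where "S = add_measure A1 A2"
  have sS[simp]: "sets S = sets A1" "space S = space A1" by (simp_all add: S_def)
  have "sigma_finite_measure S"
  proof
    show "\<exists>A. countable A \<and> A \<subseteq> sets S \<and> \<Union> A = space S \<and> (\<forall>a\<in>A. emeasure S a \<noteq> \<infinity>)"
      using R fin s by (intro exI[of _ "range R"]) (auto simp: S_def emeasure_add_measure range_subsetD less_top)
  qed
  then interpret S: sigma_finite_measure S .
  have "absolutely_continuous S A1" "absolutely_continuous S A2"
    using s by (auto simp: absolutely_continuous_def null_sets_def S_def emeasure_add_measure)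
  then obtain f1 f2 where f[measurable]: "f1 \<in> borel_measurable S" "f2 \<in> borel_measurable S"
    and d: "density S f1 = A1" "density S f2 = A2"
    using S.Radon_Nikodym[of A1] S.Radon_Nikodym[of A2] s by auto
  show ?thesis
  proof
    show "finite_measure (density S (\<lambda>x. f1 x - f2 x))"
      by (rule finite_measure_density_diff[of f1 S f2 R C]) (use f R fin le C in \<open>auto simp: d\<close>)
    show "finite_measure (density S (\<lambda>x. f2 x - f1 x))"
      by (rule finite_measure_density_diff[of f2 S f1 R C]) (use f R fin le C in \<open>auto simp: d\<close>)
    fix D assume "D \<in> sets A1"
    then have D[measurable]: "D \<in> sets S" by simp
    \<comment> \<open>Both sides are the maximum of a and b, also for infinite values.\<close>
    have mx: "a + (b - a) = b + (a - b)" for a b :: ennreal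
      by (cases a b rule: linorder_cases)
        (auto simp: diff_eq_0_iff_ennreal add_diff_inverse_ennreal less_imp_le less_top[symmetric] top_unique)
    have sum: "emeasure (density S g) D + emeasure (density S (\<lambda>x. h x - g x)) D =
        (\<integral>\<^sup>+x. (g x + (h x - g x)) * indicator D x \<partial>S)"
      if [measurable]: "g \<in> borel_measurable S" "h \<in> borel_measurable S" for g h
      by (simp add: emeasure_density[OF _ D] distrib_right nn_integral_add del: sS)
    show "emeasure A1 D + emeasure (density S (\<lambda>x. f2 x - f1 x)) D = emeasure A2 D + emeasure (density S (\<lambda>x. f1 x - f2 x)) D"
      unfolding d[symmetric] sum[OF f] sum[OF f(2) f(1)]
      by (intro nn_integral_cong arg_cong2[where f="(*)"] mx refl)
  qed auto
qed

section \<open>Measurability and exchange of integrals\<close>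

text \<open>For kernels into \<open>subprob_algebra\<close> this is
  \<open>nn_integral_measurable_subprob_algebra2\<close>. Such a kernel is obtained by cutting the
  measure off to a ball and dividing by one plus the mass of the ball, a divisor that is neither 0
  nor infinite. Multiplying back and letting the balls grow recovers the integral as a
  supremum.\<close>

lemma measurable_nn_integral_locally_finite:
  fixes \<Phi> :: "'s \<Rightarrow> (real^'d) measure"
  assumes lf: "\<And>s. s \<in> space N \<Longrightarrow> locally_finite (\<Phi> s)"
    and m[measurable]: "\<And>B. B \<in> sets borel \<Longrightarrow> (\<lambda>s. emeasure (\<Phi> s) B) \<in> borel_measurable N"
    and f[measurable]: "f \<in> borel_measurable (N \<Otimes>\<^sub>M borel)"
  shows "(\<lambda>s. \<integral>\<^sup>+x. f (s, x) \<partial>\<Phi> s) \<in> borel_measurable N"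
proof -
  define b where "b n = ball (0::real^'d) (real n)" for n :: nat
  have b[measurable]: "b n \<in> sets borel" for n by (simp add: b_def)
  have ss: "sets (\<Phi> s) = sets borel" if "s \<in> space N" for s using lf[OF that] by (simp add: locally_finite_def)
  have bf: "emeasure (\<Phi> s) (b n) < \<infinity>" if "s \<in> space N" for s n
    using lf[OF that] by (simp add: locally_finite_def b_def)
  define \<kappa> where "\<kappa> n s = density (\<Phi> s) (\<lambda>x. indicator (b n) x / (1 + emeasure (\<Phi> s) (b n)))" for n s
  have \<kappa>e: "emeasure (\<kappa> n s) B = emeasure (\<Phi> s) (B \<inter> b n) / (1 + emeasure (\<Phi> s) (b n))"
    if "s \<in> space N" "B \<in> sets borel" for n s B
  proof -
    have "emeasure (\<kappa> n s) B = (\<integral>\<^sup>+x. indicator (B \<inter> b n) x / (1 + emeasure (\<Phi> s) (b n)) \<partial>\<Phi> s)"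
      unfolding \<kappa>_def using that ss[OF that(1)]
      by (subst emeasure_density) (auto intro!: nn_integral_cong simp: indicator_def cong: measurable_cong_sets)
    also have "\<dots> = emeasure (\<Phi> s) (B \<inter> b n) / (1 + emeasure (\<Phi> s) (b n))"
      using that ss[OF that(1)] by (subst nn_integral_divide) (auto cong: measurable_cong_sets)
    finally show ?thesis .
  qed
  have \<kappa>m[measurable]: "\<kappa> n \<in> N \<rightarrow>\<^sub>M subprob_algebra borel" for n
  proof (rule measurable_subprob_algebra)
    fix s assume s: "s \<in> space N"
    show "sets (\<kappa> n s) = sets borel" using ss[OF s] by (simp add: \<kappa>_def)
    then have sp: "space (\<kappa> n s) = UNIV" by (simp add: sets_eq_imp_space_eq)
    show "subprob_space (\<kappa> n s)"
    proof
      have "emeasure (\<Phi> s) (b n) / (1 + emeasure (\<Phi> s) (b n)) \<le> 1"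
        using bf[OF s, of n] by (intro divide_le_posI_ennreal) (auto simp: add_pos_nonneg)
      then show "emeasure (\<kappa> n s) (space (\<kappa> n s)) \<le> 1" unfolding sp using \<kappa>e[OF s, of UNIV n] by simp
    qed (simp add: sp)
  next
    fix B :: "(real^'d) set" assume "B \<in> sets borel"
    then show "(\<lambda>s. emeasure (\<kappa> n s) B) \<in> borel_measurable N"
      by (subst measurable_cong[OF \<kappa>e]) auto
  qed
  have "(\<lambda>s. \<integral>\<^sup>+x. f (s, x) \<partial>\<Phi> s) \<in> borel_measurable N \<longleftrightarrow>
     (\<lambda>s. SUP n. (1 + emeasure (\<Phi> s) (b n)) * (\<integral>\<^sup>+x. f (s, x) \<partial>\<kappa> n s)) \<in> borel_measurable N"
  proof (rule measurable_cong)
    fix s assume s: "s \<in> space N"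
    note [measurable_cong] = ss[OF s]
    have [measurable]: "(\<lambda>x. f (s, x)) \<in> borel_measurable borel" using s by measurable
    have "(1 + emeasure (\<Phi> s) (b n)) * (\<integral>\<^sup>+x. f (s, x) \<partial>\<kappa> n s) = (\<integral>\<^sup>+x. f (s, x) * indicator (b n) x \<partial>\<Phi> s)" for n
    proof -
      have "(\<integral>\<^sup>+x. f (s, x) \<partial>\<kappa> n s) = (\<integral>\<^sup>+x. f (s, x) * indicator (b n) x / (1 + emeasure (\<Phi> s) (b n)) \<partial>\<Phi> s)"
        unfolding \<kappa>_def
        by (subst nn_integral_density) (auto simp: divide_ennreal_def ac_simps)
      also have "\<dots> = (\<integral>\<^sup>+x. f (s, x) * indicator (b n) x \<partial>\<Phi> s) / (1 + emeasure (\<Phi> s) (b n))"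
        by (rule nn_integral_divide) measurable
      finally show ?thesis using bf[OF s, of n]
        by (simp add: ennreal_times_divide) (subst mult.commute, rule ennreal_mult_divide_eq, auto simp: add_eq_0_iff_both_eq_0)
    qed
    moreover have "(\<integral>\<^sup>+x. f (s, x) \<partial>\<Phi> s) = (SUP n. \<integral>\<^sup>+x. f (s, x) * indicator (b n) x \<partial>\<Phi> s)"
    proof (subst nn_integral_monotone_convergence_SUP[symmetric])
      show "incseq (\<lambda>n x. f (s, x) * indicator (b n) x)"
        by (auto simp: incseq_def le_fun_def b_def indicator_def intro!: mult_left_mono)
      have "(SUP n. f (s, x) * indicator (b n) x) = f (s, x)" for x
      proof (rule antisym)
        obtain n where "norm x < real n" using reals_Archimedean2 by blast
        then have "f (s, x) = f (s, x) * indicator (b n) x" by (simp add: b_def)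
        then show "f (s, x) \<le> (SUP n. f (s, x) * indicator (b n) x)" by (metis SUP_upper UNIV_I)
      qed (auto intro!: SUP_least simp: indicator_def)
      then show "(\<integral>\<^sup>+x. f (s, x) \<partial>\<Phi> s) = (\<integral>\<^sup>+x. (SUP n. f (s, x) * indicator (b n) x) \<partial>\<Phi> s)" by simp
    qed measurable
    ultimately show "(\<integral>\<^sup>+x. f (s, x) \<partial>\<Phi> s) = (SUP n. (1 + emeasure (\<Phi> s) (b n)) * (\<integral>\<^sup>+x. f (s, x) \<partial>\<kappa> n s))"
      by simp
  qed
  also have "(\<lambda>s. SUP n. (1 + emeasure (\<Phi> s) (b n)) * (\<integral>\<^sup>+x. f (s, x) \<partial>\<kappa> n s)) \<in> borel_measurable N"
    by (intro borel_measurable_SUP borel_measurable_times_ennreal nn_integral_measurable_subprob_algebra2[where N=borel and f="\<lambda>s x. f (s,x)"]) (auto simp: case_prod_eta)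
  finally show ?thesis .
qed

lemma Fubini_integral_bounded:
  fixes f :: "'a \<Rightarrow> 'b \<Rightarrow> 'c::{banach, second_countable_topology}"
  assumes "finite_measure M1" "finite_measure M2"
    and f: "(\<lambda>(x, y). f x y) \<in> borel_measurable (M1 \<Otimes>\<^sub>M M2)"
    and b: "\<And>x y. norm (f x y) \<le> B"
  shows "(\<integral>x. (\<integral>y. f x y \<partial>M2) \<partial>M1) = (\<integral>y. (\<integral>x. f x y \<partial>M1) \<partial>M2)"
proof -
  interpret M1: finite_measure M1 by fact
  interpret M2: finite_measure M2 by fact
  interpret pair_sigma_finite M1 M2 ..
  interpret P: finite_measure "M1 \<Otimes>\<^sub>M M2"
    by (rule finite_measure_pair_measure) unfold_locales
  show ?thesis
    by (rule Fubini_integral[symmetric], rule P.integrable_const_bound[where B=B]) (use f b in auto)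
qed

section \<open>Fourier transforms of finite measures\<close>

text \<open>The standard Gaussian as a product over coordinates, the form in which integrals factor
  along \<open>lborel\<close>; \<open>gauss_density_eq\<close> is the radial form.\<close>

definition gauss_density :: "'a::euclidean_space \<Rightarrow> real" where
  "gauss_density x = (\<Prod>b\<in>Basis. std_normal_density (x \<bullet> b))"

definition gauss_const :: "'a::euclidean_space itself \<Rightarrow> real" where
  "gauss_const _ = (1 / sqrt (2 * pi)) ^ DIM('a)"

definition gauss_measure :: "'a::euclidean_space measure" where
  "gauss_measure = density lborel (\<lambda>x. ennreal (gauss_density x))"

lemma sets_gauss_measure [simp, measurable_cong]: "sets gauss_measure = sets borel"
  by (simp add: gauss_measure_def)

lemma space_gauss_measure [simp]: "space gauss_measure = UNIV"
  by (simp add: gauss_measure_def)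

lemma gauss_const_pos: "0 < gauss_const TYPE('a::euclidean_space)"
  by (simp add: gauss_const_def)

text \<open>Origin of the factor (2\<pi>)^d in Fourier inversion: the Gaussian normalisation enters
  that computation twice.\<close>

lemma gauss_const_square: "(gauss_const TYPE('a::euclidean_space))\<^sup>2 * (2 * pi) ^ DIM('a) = 1"
proof -
  have "(1 / sqrt (2 * pi))\<^sup>2 * (2 * pi) = 1" by (simp add: power_divide)
  then have "((1 / sqrt (2 * pi))\<^sup>2 * (2 * pi)) ^ DIM('a) = 1" by simp
  then show ?thesis
    unfolding gauss_const_def by (simp only: power_mult_distrib power_mult[symmetric] mult.commute[of 2])
qed

lemma norm_power2_eq_sum_Basis: "(norm (x::'a::euclidean_space))\<^sup>2 = (\<Sum>b\<in>Basis. (x \<bullet> b)\<^sup>2)"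
  by (subst power2_norm_eq_inner, subst euclidean_inner) (simp add: power2_eq_square)

lemma gauss_density_eq: "gauss_density (x::'a::euclidean_space) = gauss_const TYPE('a) * exp (- (norm x)\<^sup>2 / 2)"
proof -
  have "gauss_density x = (\<Prod>b\<in>(Basis::'a set). (1 / sqrt (2 * pi)) * exp (- (x \<bullet> b)\<^sup>2 / 2))"
    by (simp add: gauss_density_def std_normal_density_def)
  also have "\<dots> = gauss_const TYPE('a) * exp (\<Sum>b\<in>(Basis::'a set). - (x \<bullet> b)\<^sup>2 / 2)"
    by (simp add: prod_dividef gauss_const_def exp_sum power_divide)
  also have "(\<Sum>b\<in>(Basis::'a set). - (x \<bullet> b)\<^sup>2 / 2) = - (norm x)\<^sup>2 / 2"
    by (simp add: sum_divide_distrib[symmetric] sum_negf norm_power2_eq_sum_Basis)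
  finally show ?thesis .
qed

lemma gauss_density_nonneg [simp]: "0 \<le> gauss_density x"
  by (simp add: gauss_density_def prod_nonneg)

lemma borel_measurable_gauss_density [measurable]: "gauss_density \<in> borel_measurable borel"
  unfolding gauss_density_def[abs_def] by measurable

lemma gauss_fourier:
  fixes t :: "'a::euclidean_space"
  shows "(\<integral>x. exp (\<i> * complex_of_real (t \<bullet> x)) \<partial>gauss_measure) = complex_of_real (exp (- (norm t)\<^sup>2 / 2))"
proof -
  interpret product_sigma_finite "\<lambda>b::'a. lborel :: real measure" ..
  let ?g = "\<lambda>b x. std_normal_density x *\<^sub>R exp (\<i> * complex_of_real ((t \<bullet> b) * x))"
  have one: "integrable lborel (?g b)" "(\<integral>x. ?g b x \<partial>lborel) = complex_of_real (exp (- (t \<bullet> b)\<^sup>2 / 2))" for b :: 'a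
  proof -
    have "(\<integral>x. ?g b x \<partial>lborel) = char std_normal_distribution (t \<bullet> b)"
      unfolding char_def by (subst integral_density) auto
    then show "(\<integral>x. ?g b x \<partial>lborel) = complex_of_real (exp (- (t \<bullet> b)\<^sup>2 / 2))"
      by (simp add: char_std_normal_distribution)
    \<comment> \<open>A function that is not integrable has integral 0 by convention, and the value
      just computed is not 0.\<close>
    then show "integrable lborel (?g b)"
      by (metis exp_not_eq_zero not_integrable_integral_eq of_real_eq_0_iff)
  qed
  have "(\<integral>x. exp (\<i> * complex_of_real (t \<bullet> x)) \<partial>gauss_measure) =
      (\<integral>x. gauss_density x *\<^sub>R exp (\<i> * complex_of_real (t \<bullet> x)) \<partial>lborel)"
    unfolding gauss_measure_def by (rule integral_density) auto
  also have "\<dots> = (\<integral>f. gauss_density (\<Sum>b\<in>Basis. f b *\<^sub>R b) *\<^sub>R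
        exp (\<i> * complex_of_real (t \<bullet> (\<Sum>b\<in>Basis. f b *\<^sub>R b))) \<partial>(\<Pi>\<^sub>M b\<in>(Basis::'a set). lborel))"
    by (subst lborel_eq, subst integral_distr) auto
  also have "\<dots> = (\<integral>f. (\<Prod>b\<in>Basis. ?g b (f b)) \<partial>(\<Pi>\<^sub>M b\<in>(Basis::'a set). lborel))"
  proof (rule Bochner_Integration.integral_cong[OF refl])
    fix f :: "'a \<Rightarrow> real"
    have c: "(\<Sum>b\<in>Basis. f b *\<^sub>R b) \<bullet> b = f b" if "b \<in> Basis" for b
      using that by (simp add: inner_sum_left inner_Basis if_distrib cong: if_cong)
    have "exp (\<i> * complex_of_real (t \<bullet> (\<Sum>b\<in>Basis. f b *\<^sub>R b))) = (\<Prod>b\<in>(Basis::'a set). exp (\<i> * complex_of_real ((t \<bullet> b) * f b)))"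
      by (simp add: exp_sum[symmetric] inner_sum_right sum_distrib_left mult_ac)
    then show "gauss_density (\<Sum>b\<in>Basis. f b *\<^sub>R b) *\<^sub>R exp (\<i> * complex_of_real (t \<bullet> (\<Sum>b\<in>Basis. f b *\<^sub>R b))) = (\<Prod>b\<in>Basis. ?g b (f b))"
      by (simp add: gauss_density_def c scaleR_conv_of_real prod.distrib)
  qed
  also have "\<dots> = (\<Prod>b\<in>(Basis::'a set). complex_of_real (exp (- (t \<bullet> b)\<^sup>2 / 2)))"
    by (subst product_integral_prod) (use one in auto)
  also have "\<dots> = complex_of_real (exp (- (norm t)\<^sup>2 / 2))"
    by (simp add: exp_sum[symmetric] sum_divide_distrib[symmetric] sum_negf
        norm_power2_eq_sum_Basis flip: of_real_prod)
  finally show ?thesis .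
qed

lemma prob_space_gauss_measure: "prob_space (gauss_measure :: 'a::euclidean_space measure)"
proof
  have "emeasure gauss_measure (UNIV :: 'a set) = (\<integral>\<^sup>+x. (\<Prod>b\<in>(Basis::'a set). ennreal (std_normal_density (x \<bullet> b))) \<partial>lborel)"
    unfolding gauss_measure_def
    by (subst emeasure_density) (auto simp: gauss_density_def prod_ennreal)
  also have "\<dots> = (\<Prod>b\<in>(Basis::'a set). \<integral>\<^sup>+x. ennreal (std_normal_density x) \<partial>lborel)"
    by (rule nn_integral_lborel_prod) auto
  also have "\<dots> = 1"
    using prob_space.emeasure_space_1[OF prob_space_normal_density[of 1 0]]
    by (simp add: emeasure_density)
  finally show "emeasure gauss_measure (space (gauss_measure :: 'a measure)) = 1" by simp
qed

lemma integral_gauss_affine: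
  fixes f :: "'a::euclidean_space \<Rightarrow> 'b::{banach, second_countable_topology}"
  assumes [measurable]: "f \<in> borel_measurable borel" and r: "0 < r"
  shows "(\<integral>x. f (t + r *\<^sub>R x) \<partial>gauss_measure) =
    (\<integral>y. (gauss_density ((y - t) /\<^sub>R r) / r ^ DIM('a)) *\<^sub>R f y \<partial>lborel)"
proof -
  have "(\<integral>y. (gauss_density ((y - t) /\<^sub>R r) / r ^ DIM('a)) *\<^sub>R f y \<partial>lborel) =
      (\<integral>x. gauss_density x *\<^sub>R f (t + r *\<^sub>R x) \<partial>lborel)"
    using r by (subst lborel_affine[of r t], simp, subst integral_density, simp, simp, simp,
      subst integral_distr) (auto intro!: Bochner_Integration.integral_cong)
  also have "\<dots> = (\<integral>x. f (t + r *\<^sub>R x) \<partial>gauss_measure)"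
    unfolding gauss_measure_def by (rule integral_density[symmetric]) auto
  finally show ?thesis by simp
qed

lemma nn_integral_gauss_affine:
  fixes f :: "'a::euclidean_space \<Rightarrow> ennreal"
  assumes [measurable]: "f \<in> borel_measurable borel" and r: "0 < r"
  shows "(\<integral>\<^sup>+x. f (t + r *\<^sub>R x) \<partial>gauss_measure) =
    (\<integral>\<^sup>+y. ennreal (gauss_density ((y - t) /\<^sub>R r) / r ^ DIM('a)) * f y \<partial>lborel)"
proof -
  have "(\<integral>\<^sup>+y. ennreal (gauss_density ((y - t) /\<^sub>R r) / r ^ DIM('a)) * f y \<partial>lborel) =
      (\<integral>\<^sup>+x. ennreal (gauss_density x) * f (t + r *\<^sub>R x) \<partial>lborel)"
    using r by (subst lborel_affine[of r t], simp, subst nn_integral_density, simp, simp,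
      subst nn_integral_distr)
      (auto intro!: nn_integral_cong simp: mult.assoc[symmetric] ennreal_mult'[symmetric])
  also have "\<dots> = (\<integral>\<^sup>+x. f (t + r *\<^sub>R x) \<partial>gauss_measure)"
    unfolding gauss_measure_def by (rule nn_integral_density[symmetric]) auto
  finally show ?thesis by simp
qed

section \<open>Gaussian smoothing of functions and measures\<close>

lemma gauss_smoothing_tendsto:
  fixes f :: "'a::euclidean_space \<Rightarrow> real"
  assumes "continuous_on UNIV f" "\<And>x. \<bar>f x\<bar> \<le> B"
  shows "(\<lambda>n. \<integral>x. f (t + (1 / Suc n) *\<^sub>R x) \<partial>gauss_measure) \<longlonglongrightarrow> f t"
proof -
  interpret prob_space "gauss_measure :: 'a measure" by (rule prob_space_gauss_measure)
  have [measurable]: "f \<in> borel_measurable borel" using assms(1) by (rule borel_measurable_continuous_onI)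
  have "(\<lambda>n. \<integral>x. f (t + (1 / Suc n) *\<^sub>R x) \<partial>gauss_measure) \<longlonglongrightarrow> (\<integral>x. f t \<partial>(gauss_measure :: 'a measure))"
  proof (rule integral_dominated_convergence[where w="\<lambda>_. B"])
    have "(\<lambda>n. f (t + (1 / Suc n) *\<^sub>R x)) \<longlonglongrightarrow> f t" for x
    proof (rule continuous_on_tendsto_compose[OF assms(1)])
      have "(\<lambda>n. t + (1 / Suc n) *\<^sub>R x) \<longlonglongrightarrow> t + 0 *\<^sub>R x"
        using LIMSEQ_inverse_real_of_nat by (intro tendsto_intros) (simp add: divide_inverse)
      then show "(\<lambda>n. t + (1 / Suc n) *\<^sub>R x) \<longlonglongrightarrow> t" by simp
    qed auto
    then show "AE x in gauss_measure. (\<lambda>n. f (t + (1 / Suc n) *\<^sub>R x)) \<longlonglongrightarrow> f t" by simp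
  qed (use assms(2) in auto)
  then show ?thesis by (simp add: prob_space[simplified])
qed

text \<open>Smoothing with a centred Gaussian of scale \<open>r\<close> can be expressed through the Fourier transform alone,
  because the Gaussian is its own transform up to scaling.\<close>

lemma gauss_smoothing_fourier:
  fixes \<mu> :: "(real^'d) measure" and \<phi> :: "real^'d \<Rightarrow> ennreal"
  assumes fin: "finite_measure \<mu>" and s[measurable_cong]: "sets \<mu> = sets borel"
    and [measurable]: "\<phi> \<in> borel_measurable borel" and r: "0 < r"
  shows "(\<integral>\<^sup>+k. (\<integral>\<^sup>+x. \<phi> (k + r *\<^sub>R x) \<partial>gauss_measure) \<partial>\<mu>) =
    (\<integral>\<^sup>+y. ennreal (gauss_const TYPE(real^'d) / r ^ CARD('d) *
       Re (\<integral>x. exp (\<i> * complex_of_real (x \<bullet> (y /\<^sub>R r))) * fourier_measure \<mu> (x /\<^sub>R r) \<partial>gauss_measure)) * \<phi> y \<partial>lborel)"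
proof -
  interpret \<mu>: finite_measure \<mu> by fact
  interpret G: prob_space "gauss_measure :: (real^'d) measure" by (rule prob_space_gauss_measure)
  interpret pair_sigma_finite \<mu> "lborel :: (real^'d) measure" ..
  \<comment> \<open>\<open>gauss_fourier\<close> read backwards: the Gaussian kernel centred at k is
    a Fourier integral, and exchanging it with \<open>\<mu>\<close> leaves only
    \<open>fourier_measure \<mu>\<close>. The left side is real, so taking \<open>Re\<close> later
    loses nothing.\<close>
  have inner: "complex_of_real (\<integral>k. gauss_density ((y - k) /\<^sub>R r) \<partial>\<mu>) = complex_of_real (gauss_const TYPE(real^'d)) *
      (\<integral>x. exp (\<i> * complex_of_real (x \<bullet> (y /\<^sub>R r))) * fourier_measure \<mu> (x /\<^sub>R r) \<partial>gauss_measure)" for y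
  proof -
    have e: "exp (\<i> * complex_of_real (x \<bullet> (y /\<^sub>R r))) * exp (- (\<i> * complex_of_real ((x /\<^sub>R r) \<bullet> k))) =
        exp (\<i> * complex_of_real (((y - k) /\<^sub>R r) \<bullet> x))" for x k
      by (simp add: exp_add[symmetric] inner_commute[of x] inner_diff_left right_diff_distrib)
    have "(\<integral>x. exp (\<i> * complex_of_real (x \<bullet> (y /\<^sub>R r))) * fourier_measure \<mu> (x /\<^sub>R r) \<partial>gauss_measure) =
        (\<integral>x. (\<integral>k. exp (\<i> * complex_of_real (((y - k) /\<^sub>R r) \<bullet> x)) \<partial>\<mu>) \<partial>gauss_measure)"
      unfolding fourier_measure_def integral_mult_right_zero[symmetric] e ..
    also have "\<dots> = (\<integral>k. (\<integral>x. exp (\<i> * complex_of_real (((y - k) /\<^sub>R r) \<bullet> x)) \<partial>gauss_measure) \<partial>\<mu>)"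
      by (rule Fubini_integral_bounded[where B=1]) (use fin G.finite_measure_axioms in auto)
    also have "\<dots> = (\<integral>k. complex_of_real (exp (- (norm ((y - k) /\<^sub>R r))\<^sup>2 / 2)) \<partial>\<mu>)"
      unfolding gauss_fourier ..
    finally show ?thesis
      unfolding gauss_density_eq integral_mult_right_zero[symmetric] integral_complex_of_real[symmetric] by simp
  qed
  have int: "integrable \<mu> (\<lambda>k. gauss_density ((y - k) /\<^sub>R r))" for y
    by (rule \<mu>.integrable_bounded[where B="gauss_const TYPE(real^'d)"])
       (auto simp: gauss_density_eq gauss_const_pos less_imp_le intro!: mult_left_le)
  have "(\<integral>\<^sup>+k. (\<integral>\<^sup>+x. \<phi> (k + r *\<^sub>R x) \<partial>gauss_measure) \<partial>\<mu>) =
      (\<integral>\<^sup>+k. (\<integral>\<^sup>+y. ennreal (gauss_density ((y - k) /\<^sub>R r) / r ^ CARD('d)) * \<phi> y \<partial>lborel) \<partial>\<mu>)"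
    using r by (simp add: nn_integral_gauss_affine)
  also have "\<dots> = (\<integral>\<^sup>+y. (\<integral>\<^sup>+k. ennreal (gauss_density ((y - k) /\<^sub>R r) / r ^ CARD('d)) * \<phi> y \<partial>\<mu>) \<partial>lborel)"
    by (rule Fubini'[symmetric]) measurable
  also have "\<dots> = (\<integral>\<^sup>+y. ennreal (gauss_const TYPE(real^'d) / r ^ CARD('d) *
       Re (\<integral>x. exp (\<i> * complex_of_real (x \<bullet> (y /\<^sub>R r))) * fourier_measure \<mu> (x /\<^sub>R r) \<partial>gauss_measure)) * \<phi> y \<partial>lborel)"
  proof (rule nn_integral_cong)
    fix y :: "real^'d"
    have "(\<integral>\<^sup>+k. ennreal (gauss_density ((y - k) /\<^sub>R r) / r ^ CARD('d)) \<partial>\<mu>) =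
        ennreal ((\<integral>k. gauss_density ((y - k) /\<^sub>R r) \<partial>\<mu>) / r ^ CARD('d))"
      using int[of y] r by (subst nn_integral_eq_integral) auto
    also have "(\<integral>k. gauss_density ((y - k) /\<^sub>R r) \<partial>\<mu>) = gauss_const TYPE(real^'d) *
      Re (\<integral>x. exp (\<i> * complex_of_real (x \<bullet> (y /\<^sub>R r))) * fourier_measure \<mu> (x /\<^sub>R r) \<partial>gauss_measure)"
      using arg_cong[OF inner[of y], of Re] by simp
    finally show "(\<integral>\<^sup>+k. ennreal (gauss_density ((y - k) /\<^sub>R r) / r ^ CARD('d)) * \<phi> y \<partial>\<mu>) = ennreal (gauss_const TYPE(real^'d) / r ^ CARD('d) *
       Re (\<integral>x. exp (\<i> * complex_of_real (x \<bullet> (y /\<^sub>R r))) * fourier_measure \<mu> (x /\<^sub>R r) \<partial>gauss_measure)) * \<phi> y"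
      by (subst nn_integral_multc) auto
  qed
  finally show ?thesis .
qed

lemma gauss_smoothing_measure_tendsto:
  fixes f :: "real^'d \<Rightarrow> real"
  assumes fin: "finite_measure \<mu>" and s[measurable_cong]: "sets \<mu> = sets borel"
    and f: "continuous_on UNIV f" "\<And>x. 0 \<le> f x" "\<And>x. f x \<le> B"
  shows "(\<lambda>n. \<integral>\<^sup>+k. (\<integral>\<^sup>+x. ennreal (f (k + (1 / Suc n) *\<^sub>R x)) \<partial>gauss_measure) \<partial>\<mu>) \<longlonglongrightarrow> (\<integral>\<^sup>+k. ennreal (f k) \<partial>\<mu>)"
proof -
  interpret \<mu>: finite_measure \<mu> by fact
  interpret G: prob_space "gauss_measure :: (real^'d) measure" by (rule prob_space_gauss_measure)
  have [measurable]: "f \<in> borel_measurable borel" using f(1) by (rule borel_measurable_continuous_onI)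
  have B: "0 \<le> B" using f(2,3) order_trans by blast
  have ii: "integrable gauss_measure (\<lambda>x. f (k + r *\<^sub>R x))" for k r
    by (rule G.integrable_bounded[where B=B]) (use f in auto)
  have eq: "(\<integral>\<^sup>+x. ennreal (f (k + r *\<^sub>R x)) \<partial>gauss_measure) = ennreal (\<integral>x. f (k + r *\<^sub>R x) \<partial>gauss_measure)" for k r
    using ii f by (intro nn_integral_eq_integral) auto
  show ?thesis
    unfolding eq
  proof (rule nn_integral_dominated_convergence[where w="\<lambda>_. ennreal B"])
    show "AE k in \<mu>. ennreal (\<integral>x. f (k + (1 / Suc j) *\<^sub>R x) \<partial>gauss_measure) \<le> ennreal B" for j
    proof (intro AE_I2 ennreal_leI)
      fix k
      have "(\<integral>x. f (k + (1 / Suc j) *\<^sub>R x) \<partial>gauss_measure) \<le> (\<integral>x. B \<partial>(gauss_measure :: (real^'d) measure))"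
        by (rule integral_mono) (use ii f in auto)
      then show "(\<integral>x. f (k + (1 / Suc j) *\<^sub>R x) \<partial>gauss_measure) \<le> B" by (simp add: G.prob_space[simplified])
    qed
    show "(\<integral>\<^sup>+x. ennreal B \<partial>\<mu>) < \<infinity>"
      by (simp add: ennreal_mult_less_top ennreal_mult_eq_top_iff \<mu>.emeasure_finite less_top[symmetric])
    show "AE k in \<mu>. (\<lambda>i. ennreal (\<integral>x. f (k + (1 / Suc i) *\<^sub>R x) \<partial>gauss_measure)) \<longlonglongrightarrow> ennreal (f k)"
      by (intro AE_I2 tendsto_ennrealI gauss_smoothing_tendsto[where B=B]) (use f in auto)
  qed auto
qed

section \<open>Injectivity and inversion of the Fourier transform\<close>

text \<open>The functions min(1, n dist(x, complement of U)) are continuous and increase to the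
  indicator of an open set U. Open sets are stable under intersection and generate the Borel
  sets.\<close>

lemma measure_eq_of_nn_integral_continuous:
  fixes \<mu> \<nu> :: "'a::metric_space measure"
  assumes fin: "finite_measure \<mu>" "finite_measure \<nu>"
    and s[measurable_cong]: "sets \<mu> = sets borel" "sets \<nu> = sets borel"
    and eq: "\<And>f. continuous_on UNIV f \<Longrightarrow> (\<And>x. 0 \<le> f x) \<Longrightarrow> (\<And>x. f x \<le> 1) \<Longrightarrow>
      (\<integral>\<^sup>+x. ennreal (f x) \<partial>\<mu>) = (\<integral>\<^sup>+x. ennreal (f x) \<partial>\<nu>)"
  shows "\<mu> = \<nu>"
proof -
  have open_eq: "emeasure \<mu> U = emeasure \<nu> U" if U: "open U" for U
  \<comment> \<open>The distance to the empty set is 0 by convention, so the approximating functions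
    below would vanish for the whole space.\<close>
  proof (cases "- U = {}")
    case True
    then have "U = UNIV" by auto
    then show ?thesis using eq[of "\<lambda>_. 1"] by (simp add: sets_eq_imp_space_eq[OF s(1)] sets_eq_imp_space_eq[OF s(2)])
  next
    case False
    define f where "f n x = min 1 (real n * infdist x (- U))" for n x
    have cf: "continuous_on UNIV (f n)" for n unfolding f_def[abs_def] by (intro continuous_intros)
    have [measurable]: "f n \<in> borel_measurable borel" for n using cf by (rule borel_measurable_continuous_onI)
    have f01: "0 \<le> f n x" "f n x \<le> 1" for n x by (auto simp: f_def infdist_nonneg)
    have sup: "(SUP n. ennreal (f n x)) = indicator U x" for x
    proof (cases "x \<in> U")
      case True
      then have "infdist x (- U) \<noteq> 0"
        using U False in_closed_iff_infdist_zero[of "- U" x] by (auto simp: closed_Compl)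
      then have p: "0 < infdist x (- U)" by (simp add: infdist_nonneg less_le)
      obtain n where "1 < real n * infdist x (- U)" using p reals_Archimedean3 by blast
      then have "f n x = 1" by (simp add: f_def)
      then have "1 \<le> (SUP n. ennreal (f n x))" by (metis SUP_upper UNIV_I ennreal_1)
      moreover have "(SUP n. ennreal (f n x)) \<le> 1" using f01 by (intro SUP_least) auto
      ultimately show ?thesis using True by simp
    next
      case out: False
      then have "infdist x (- U) = 0" by simp
      then show ?thesis using out by (simp add: f_def)
    qed
    have "emeasure N U = (SUP n. \<integral>\<^sup>+x. ennreal (f n x) \<partial>N)" if [measurable_cong]: "sets N = sets borel" for N
    proof -
      have "emeasure N U = (\<integral>\<^sup>+x. (SUP n. ennreal (f n x)) \<partial>N)"
        unfolding sup using U that by simp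
      also have "\<dots> = (SUP n. \<integral>\<^sup>+x. ennreal (f n x) \<partial>N)"
      proof (rule nn_integral_monotone_convergence_SUP)
        have "f m x \<le> f n x" if "m \<le> n" for m n x
          unfolding f_def using that by (intro min.mono mult_right_mono) (auto simp: infdist_nonneg)
        then show "incseq (\<lambda>n x. ennreal (f n x))" by (auto simp: incseq_def le_fun_def intro: ennreal_leI)
      qed measurable
      finally show ?thesis .
    qed
    from this[OF s(1)] this[OF s(2)] show ?thesis using eq[OF cf f01] by simp
  qed
  show ?thesis
  proof (rule measure_eqI_generator_eq[where E="{U. open U}" and \<Omega>=UNIV and A="\<lambda>_. UNIV"])
    show "Int_stable {U::'a set. open U}" by (auto simp: Int_stable_def)
    show "sets \<mu> = sigma_sets UNIV {U. open U}" "sets \<nu> = sigma_sets UNIV {U. open U}"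
      using s by (simp_all add: borel_def)
    show "emeasure \<mu> UNIV \<noteq> \<infinity>" using fin(1) by (simp add: finite_measure.emeasure_finite)
  qed (use open_eq in auto)
qed

text \<open>Smoothed integrals are functions of the Fourier transform alone. Letting the scale
  1/(n+1) tend to 0 recovers the integrals of bounded continuous functions, and these determine a
  finite measure.\<close>

lemma fourier_measure_inject:
  fixes \<mu> \<nu> :: "(real^'d) measure"
  assumes fin: "finite_measure \<mu>" "finite_measure \<nu>"
    and s: "sets \<mu> = sets borel" "sets \<nu> = sets borel"
    and eq: "\<And>k. fourier_measure \<mu> k = fourier_measure \<nu> k"
  shows "\<mu> = \<nu>"
proof (rule measure_eq_of_nn_integral_continuous[OF fin s])
  fix f :: "real^'d \<Rightarrow> real"
  assume f: "continuous_on UNIV f" "\<And>x. 0 \<le> f x" "\<And>x. f x \<le> 1"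
  have [measurable]: "f \<in> borel_measurable borel" using f(1) by (rule borel_measurable_continuous_onI)
  have "(\<integral>\<^sup>+k. (\<integral>\<^sup>+x. ennreal (f (k + (1 / Suc n) *\<^sub>R x)) \<partial>gauss_measure) \<partial>\<mu>) =
      (\<integral>\<^sup>+k. (\<integral>\<^sup>+x. ennreal (f (k + (1 / Suc n) *\<^sub>R x)) \<partial>gauss_measure) \<partial>\<nu>)" for n
    by (subst (1 2) gauss_smoothing_fourier) (use fin s eq in auto)
  with gauss_smoothing_measure_tendsto[OF fin(1) s(1) f] gauss_smoothing_measure_tendsto[OF fin(2) s(2) f]
  show "(\<integral>\<^sup>+x. ennreal (f x) \<partial>\<mu>) = (\<integral>\<^sup>+x. ennreal (f x) \<partial>\<nu>)"
    by (auto intro: LIMSEQ_unique)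
qed

text \<open>Integrability of the transform is a conclusion here. Gaussian damping turns the inverse
  integral into a Gaussian average of \<open>h\<close>, bounded by \<open>B\<close>; since
  \<open>w\<close> is nonnegative, Fatou's lemma removes the damping at y = 0. Then a multiple of
  \<open>w\<close> dominates, and the formula follows as the damping disappears.\<close>

lemma fourier_inversion_nonneg:
  fixes h w :: "real^'d \<Rightarrow> real"
  assumes h: "continuous_on UNIV h" "\<And>x. 0 \<le> h x" "\<And>x. h x \<le> B" "integrable lborel h"
    and w: "\<And>k. 0 \<le> w k" "w \<in> borel_measurable borel" "\<And>k. fourier_fun h k = complex_of_real (w k)"
  shows "integrable lborel w"
    and "(\<integral>k. complex_of_real (w k) * exp (\<i> * complex_of_real (k \<bullet> y)) \<partial>lborel) = complex_of_real ((2 * pi) ^ CARD('d) * h y)"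
proof -
  interpret G: prob_space "gauss_measure :: (real^'d) measure" by (rule prob_space_gauss_measure)
  have [measurable]: "h \<in> borel_measurable borel" using h(1) by (rule borel_measurable_continuous_onI)
  note [measurable] = w(2)
  define H where "H = density lborel (\<lambda>x. ennreal (h x))"
  have sH[measurable_cong, simp]: "sets H = sets borel" by (simp add: H_def)
  have fH: "finite_measure H"
  proof
    show "emeasure H (space H) \<noteq> \<infinity>"
      using h(2,4) by (simp add: H_def emeasure_density nn_integral_eq_integral)
  qed
  define c where "c = gauss_const TYPE(real^'d)"
  have c0: "0 < c" by (simp add: c_def gauss_const_pos)
  \<comment> \<open>Rescaling k by 1/r makes the damping a Gaussian measure. Writing
    \<open>w\<close> as the transform of \<open>h\<close> and exchanging the integrals leaves the
    average of \<open>h\<close> around y at scale r. The factor 1/c is due to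
    \<open>gauss_density\<close> being c times the bare exponential that
    \<open>gauss_fourier\<close> produces.\<close>
  have key: "(\<integral>k. gauss_density (r *\<^sub>R k) *\<^sub>R (complex_of_real (w k) * exp (\<i> * complex_of_real (k \<bullet> y))) \<partial>lborel) =
      complex_of_real ((\<integral>x. h (y + r *\<^sub>R x) \<partial>gauss_measure) / c)" if r: "0 < r" for r y
  proof -
    let ?F = "\<lambda>k. complex_of_real (w k) * exp (\<i> * complex_of_real (k \<bullet> y))"
    have e: "exp (- (\<i> * complex_of_real ((x /\<^sub>R r) \<bullet> z))) * exp (\<i> * complex_of_real ((x /\<^sub>R r) \<bullet> y)) =
        exp (\<i> * complex_of_real (((y - z) /\<^sub>R r) \<bullet> x))" for x z
      by (simp add: exp_add[symmetric] inner_commute[of x] inner_diff_left right_diff_distrib)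
    have wF: "complex_of_real (w k) = (\<integral>z. exp (- (\<i> * complex_of_real (k \<bullet> z))) \<partial>H)" for k
      unfolding w(3)[symmetric] fourier_fun_def H_def
      by (subst integral_density) (auto simp: h(2) scaleR_conv_of_real)
    have "(\<integral>k. gauss_density (r *\<^sub>R k) *\<^sub>R ?F k \<partial>lborel) =
        (\<integral>k. (gauss_density ((k - 0) /\<^sub>R (1/r)) / (1/r) ^ DIM(real^'d)) *\<^sub>R ((1 / r) ^ CARD('d) *\<^sub>R ?F k) \<partial>lborel)"
      using r by (intro Bochner_Integration.integral_cong) auto
    also have "\<dots> = (\<integral>x. (1 / r) ^ CARD('d) *\<^sub>R ?F (0 + (1 / r) *\<^sub>R x) \<partial>gauss_measure)"
      by (rule integral_gauss_affine[symmetric]) (use r in auto)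
    also have "\<dots> = (1 / r) ^ CARD('d) *\<^sub>R (\<integral>x. ?F (x /\<^sub>R r) \<partial>gauss_measure)"
      by (simp add: divide_inverse)
    also have "(\<integral>x. ?F (x /\<^sub>R r) \<partial>gauss_measure) = (\<integral>x. (\<integral>z. exp (\<i> * complex_of_real (((y - z) /\<^sub>R r) \<bullet> x)) \<partial>H) \<partial>gauss_measure)"
      unfolding wF integral_mult_left_zero[symmetric] e ..
    also have "\<dots> = (\<integral>z. (\<integral>x. exp (\<i> * complex_of_real (((y - z) /\<^sub>R r) \<bullet> x)) \<partial>gauss_measure) \<partial>H)"
      by (rule Fubini_integral_bounded[where B=1]) (use fH G.finite_measure_axioms in auto)
    also have "\<dots> = (\<integral>z. complex_of_real (gauss_density ((z - y) /\<^sub>R r) / c) \<partial>H)"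
      unfolding gauss_fourier gauss_density_eq c_def using gauss_const_pos[where 'a="real^'d"]
      by (simp add: norm_minus_commute)
    also have "\<dots> = complex_of_real (\<integral>z. h z *\<^sub>R (gauss_density ((z - y) /\<^sub>R r) / c) \<partial>lborel)"
      unfolding H_def integral_complex_of_real by (subst integral_density) (auto simp: h(2))
    also have "(\<integral>z. h z *\<^sub>R (gauss_density ((z - y) /\<^sub>R r) / c) \<partial>lborel) =
        (\<integral>z. (r ^ CARD('d) / c) * ((gauss_density ((z - y) /\<^sub>R r) / r ^ DIM(real^'d)) *\<^sub>R h z) \<partial>lborel)"
      using r by (intro Bochner_Integration.integral_cong) auto
    also have "\<dots> = r ^ CARD('d) / c * (\<integral>x. h (y + r *\<^sub>R x) \<partial>gauss_measure)"
      using r by (subst integral_gauss_affine) auto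
    finally show ?thesis using r by (simp add: scaleR_conv_of_real power_divide)
  qed
  define g where "g n k = gauss_density ((1 / Suc n) *\<^sub>R k)" for n and k :: "real^'d"
  have [measurable]: "g n \<in> borel_measurable borel" for n unfolding g_def[abs_def] by measurable
  have g0: "0 \<le> g n k" "g n k \<le> c" for n k
    using c0 by (simp_all add: g_def) (simp add: gauss_density_eq c_def mult_left_le)
  have glim: "(\<lambda>n. g n k) \<longlonglongrightarrow> c" for k
  proof -
    have "(\<lambda>n. c * exp (- (\<bar>1 / Suc n\<bar> * norm k)\<^sup>2 / 2)) \<longlonglongrightarrow> c * exp (- (\<bar>0\<bar> * norm k)\<^sup>2 / 2)"
      using LIMSEQ_inverse_real_of_nat by (intro tendsto_intros) (simp_all add: divide_inverse)
    then show ?thesis by (simp add: g_def gauss_density_eq c_def)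
  qed
  have B: "0 \<le> B" using h(2,3) order_trans by blast
  have hs: "\<bar>\<integral>x. h (y + r *\<^sub>R x) \<partial>gauss_measure\<bar> \<le> B" for y r
  proof -
    have "(\<integral>x. h (y + r *\<^sub>R x) \<partial>gauss_measure) \<le> (\<integral>x. B \<partial>(gauss_measure :: (real^'d) measure))"
      by (rule integral_mono) (use h in \<open>auto intro!: G.integrable_bounded[where B=B]\<close>)
    then show ?thesis using h(2) by (simp add: G.prob_space[simplified])
  qed
  have bound: "(\<integral>\<^sup>+k. ennreal (g n k * w k) \<partial>lborel) \<le> ennreal (B / c)" for n
  proof -
    \<comment> \<open>This crude bound makes the damped function integrable, so that its nonnegative
      integral can be read off from \<open>key\<close> at y = 0.\<close>
    have wb: "w k \<le> (\<integral>x. h x \<partial>lborel)" for k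
    proof -
      have "cmod (fourier_fun h k) \<le> (\<integral>x. norm (complex_of_real (h x) * exp (- (\<i> * complex_of_real (k \<bullet> x)))) \<partial>lborel)"
        unfolding fourier_fun_def by (rule integral_norm_bound)
      then show ?thesis using w(1)[of k] h(2) by (simp add: w(3) norm_mult)
    qed
    have "integrable lborel (\<lambda>k. g n k * w k)"
    proof (rule Bochner_Integration.integrable_bound)
      have "integrable gauss_measure (\<lambda>x::real^'d. 1 :: real)" by simp
      then have "integrable lborel (gauss_density :: real^'d \<Rightarrow> real)"
        unfolding gauss_measure_def by (subst (asm) integrable_density) auto
      then have "integrable (density (distr lborel borel (\<lambda>x. 0 + (1 / Suc n) *\<^sub>R x)) (\<lambda>_. ennreal (\<bar>1 / Suc n\<bar> ^ DIM(real^'d)))) (gauss_density :: real^'d \<Rightarrow> real)"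
        by (subst (asm) lborel_affine[of "1 / Suc n" 0]) auto
      then have "integrable lborel (\<lambda>k. (1 / Suc n) ^ CARD('d) * g n k)"
        by (subst (asm) integrable_density) (auto simp: integrable_distr_eq g_def[abs_def])
      then have "integrable lborel (g n)" by simp
      then show "integrable lborel (\<lambda>k. g n k * (\<integral>x. h x \<partial>lborel))" by simp
      show "AE k in lborel. norm (g n k * w k) \<le> norm (g n k * (\<integral>x. h x \<partial>lborel))"
        using wb w(1) g0 h(2) by (auto simp: abs_mult intro!: mult_left_mono)
    qed measurable
    moreover have "(\<integral>k. g n k * w k \<partial>lborel) \<le> B / c"
    proof -
      have "complex_of_real (\<integral>k. g n k * w k \<partial>lborel) = complex_of_real ((\<integral>x. h (0 + (1 / Suc n) *\<^sub>R x) \<partial>gauss_measure) / c)"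
        using key[of "1 / Suc n" 0] by (simp add: g_def scaleR_conv_of_real flip: integral_complex_of_real)
      then have "(\<integral>k. g n k * w k \<partial>lborel) = (\<integral>x. h (0 + (1 / Suc n) *\<^sub>R x) \<partial>gauss_measure) / c"
        by (simp only: of_real_eq_iff)
      then show ?thesis using hs[of 0 "1 / Suc n"] c0 by (simp add: divide_right_mono)
    qed
    ultimately show ?thesis using g0 w(1) by (subst nn_integral_eq_integral) (auto intro: ennreal_leI)
  qed
  have "(\<integral>\<^sup>+k. ennreal (c * w k) \<partial>lborel) = (\<integral>\<^sup>+k. liminf (\<lambda>n. ennreal (g n k * w k)) \<partial>lborel)"
    by (intro nn_integral_cong lim_imp_Liminf[symmetric] tendsto_ennrealI tendsto_mult glim tendsto_const) auto
  also have "\<dots> \<le> liminf (\<lambda>n. \<integral>\<^sup>+k. ennreal (g n k * w k) \<partial>lborel)"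
    by (rule nn_integral_liminf) measurable
  also have "\<dots> \<le> ennreal (B / c)"
    by (rule Liminf_le) (use bound in auto)
  also have "\<dots> < \<infinity>" by simp
  finally have "(\<integral>\<^sup>+k. ennreal (c * w k) \<partial>lborel) < \<infinity>" .
  then have "integrable lborel (\<lambda>k. c * w k)"
    using c0 w(1) by (intro integrableI_nonneg) auto
  then show int: "integrable lborel w" using c0 by simp
  let ?F = "\<lambda>k. complex_of_real (w k) * exp (\<i> * complex_of_real (k \<bullet> y))"
  have "(\<lambda>n. \<integral>k. g n k *\<^sub>R ?F k \<partial>lborel) \<longlonglongrightarrow> (\<integral>k. c *\<^sub>R ?F k \<partial>lborel)"
  proof (rule integral_dominated_convergence[where w="\<lambda>k. c * w k"])
    show "AE k in lborel. (\<lambda>n. g n k *\<^sub>R ?F k) \<longlonglongrightarrow> c *\<^sub>R ?F k" by (intro AE_I2 tendsto_scaleR glim tendsto_const)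
    show "AE k in lborel. norm (g n k *\<^sub>R ?F k) \<le> c * w k" for n
      using g0 w(1) by (auto simp: norm_mult intro!: mult_right_mono)
  qed (use int in auto)
  moreover have "(\<lambda>n. \<integral>k. g n k *\<^sub>R ?F k \<partial>lborel) \<longlonglongrightarrow> complex_of_real (h y / c)"
  proof -
    have eq: "(\<integral>k. g n k *\<^sub>R ?F k \<partial>lborel) = complex_of_real ((\<integral>x. h (y + (1 / Suc n) *\<^sub>R x) \<partial>gauss_measure) / c)" for n
      unfolding g_def by (rule key) simp
    have "(\<lambda>n. \<integral>x. h (y + (1 / Suc n) *\<^sub>R x) \<partial>gauss_measure) \<longlonglongrightarrow> h y"
      by (rule gauss_smoothing_tendsto[OF h(1), where B=B]) (use h in auto)
    then show ?thesis
      unfolding eq using c0 by (intro tendsto_of_real tendsto_divide tendsto_const) auto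
  qed
  ultimately have "c *\<^sub>R (\<integral>k. ?F k \<partial>lborel) = complex_of_real (h y / c)"
    by (simp add: LIMSEQ_unique)
  then have "(\<integral>k. ?F k \<partial>lborel) = complex_of_real (h y / c) / complex_of_real c"
    using c0 by (simp add: scaleR_conv_of_real field_simps)
  \<comment> \<open>One factor 1/c comes from \<open>key\<close>, the other from the limit c of the
    damping.\<close>
  also have "\<dots> = complex_of_real ((2 * pi) ^ CARD('d) * h y)"
  proof -
    have "(2 * pi) ^ CARD('d) = 1 / c\<^sup>2"
      using gauss_const_square[where 'a="real^'d"] c0 by (simp add: c_def field_simps)
    then show ?thesis by (simp add: power2_eq_square flip: of_real_divide)
  qed
  finally show "(\<integral>k. ?F k \<partial>lborel) = complex_of_real ((2 * pi) ^ CARD('d) * h y)" .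
qed

section \<open>Tent functions\<close>

lemma integral_lborel_translate:
  fixes f :: "'a::euclidean_space \<Rightarrow> 'b::{banach, second_countable_topology}"
  assumes [measurable]: "f \<in> borel_measurable borel"
  shows "(\<integral>x. f (x + t) \<partial>lborel) = (\<integral>x. f x \<partial>lborel)"
  by (subst lborel_distr_plus[of t, symmetric], subst integral_distr) (auto simp: add.commute)

lemma integral_lborel_reflect:
  fixes f :: "'a::euclidean_space \<Rightarrow> 'b::{banach, second_countable_topology}"
  assumes [measurable]: "f \<in> borel_measurable borel"
  shows "(\<integral>x. f (t - x) \<partial>lborel) = (\<integral>x. f x \<partial>lborel)"
  by (subst (2) lborel_affine[of "-1" t], simp, subst integral_density, simp_all, subst integral_distr) auto

lemma emeasure_lborel_cball_finite: "emeasure lborel (cball (c::'a::euclidean_space) r) < top"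
  and emeasure_lborel_ball_finite: "emeasure lborel (ball c r) < top"
  using emeasure_bounded_finite[of "cball c r"] emeasure_bounded_finite[of "ball c r"] by simp_all

text \<open>A cone of height 1 supported in the ball of radius 1/R. The scale is inverse to R so
  that |<k, x>| \<le> 1 on the support for every frequency k of norm at most R.\<close>

definition tent :: "real \<Rightarrow> 'a::euclidean_space \<Rightarrow> real" where
  "tent R x = max 0 (1 - R * norm x)"

definition tent_corr :: "real \<Rightarrow> real^'d \<Rightarrow> real" where
  "tent_corr R = star_conv (tent R) (tent R)"

definition tent_spec :: "real \<Rightarrow> real^'d \<Rightarrow> real" where
  "tent_spec R k = (cmod (fourier_fun (tent R) k))\<^sup>2"

lemma continuous_on_tent: "continuous_on A (tent R)"
  unfolding tent_def[abs_def] by (intro continuous_intros)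

lemma borel_measurable_tent [measurable]: "tent R \<in> borel_measurable borel"
  using continuous_on_tent by (rule borel_measurable_continuous_onI)

context
  fixes R :: real assumes R: "0 < R"
begin

lemma tent_nonneg: "0 \<le> tent R x" by (simp add: tent_def)

lemma tent_le_1: "tent R x \<le> 1" using R by (simp add: tent_def)

lemma tent_support: "tent R x \<noteq> 0 \<Longrightarrow> norm x \<le> 1 / R"
  using R by (auto simp: tent_def max_def field_simps split: if_splits)

lemma bounded_test_fun_tent: "bounded_test_fun (\<lambda>y. tent R (y - x))"
  unfolding bounded_test_fun_def
proof (intro conjI)
  show "bounded (range (\<lambda>y. tent R (y - x)))"
    by (intro boundedI[where B=1]) (auto simp: tent_nonneg tent_le_1)
  have "norm y \<le> 1 / R + norm x" if "tent R (y - x) \<noteq> 0" for y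
    using tent_support[OF that] norm_triangle_ineq[of "y - x" x] by simp
  then show "bounded {y. tent R (y - x) \<noteq> 0}" by (intro boundedI) auto
qed measurable

lemma integrable_tent: "integrable lborel (tent R :: 'a::euclidean_space \<Rightarrow> real)"
proof (rule Bochner_Integration.integrable_bound)
  show "integrable lborel (indicator (cball 0 (1 / R)) :: 'a \<Rightarrow> real)"
    by (simp add: integrable_indicator_iff emeasure_lborel_cball_finite)
  show "AE x in lborel. norm (tent R (x :: 'a)) \<le> norm (indicator (cball 0 (1 / R)) x :: real)"
  proof (rule AE_I2)
    fix x :: 'a
    show "norm (tent R x) \<le> norm (indicator (cball 0 (1 / R)) x :: real)"
      using tent_support[of x] tent_le_1[of x] tent_nonneg[of x]
      by (cases "tent R x = 0") (auto simp: dist_norm)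
  qed
qed measurable

lemma integral_tent_pos: "0 < (\<integral>x. tent R x \<partial>(lborel :: 'a::euclidean_space measure))"
proof -
  \<comment> \<open>On the ball of half the support radius the tent is at least 1/2.\<close>
  let ?b = "ball (0::'a) (1 / (2 * R))"
  have "0 < (1 / 2) * measure lborel ?b" using content_ball_pos[of "1 / (2 * R)" "0::'a"] R by simp
  also have "\<dots> = (\<integral>x. (1 / 2) * indicator ?b x \<partial>lborel)" by simp
  also have "\<dots> \<le> (\<integral>x. tent R x \<partial>(lborel :: 'a measure))"
  proof (rule integral_mono)
    fix x :: 'a
    show "1 / 2 * indicator ?b x \<le> tent R x"
    proof (cases "x \<in> ?b")
      case True
      then have "R * norm x \<le> 1 / 2" using R by (simp add: field_simps)
      then show ?thesis using True by (simp add: tent_def)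
    qed (simp add: tent_nonneg)
  qed (auto simp: integrable_tent integrable_indicator_iff emeasure_lborel_ball_finite simp del: mult_cancel_right1 times_divide_eq_left intro!: integrable_divide_zero)
  finally show ?thesis .
qed

lemma fourier_tent_translate:
  "fourier_fun (\<lambda>y. tent R (y - x)) k = exp (- (\<i> * complex_of_real (k \<bullet> x))) * fourier_fun (tent R) k"
proof -
  have "fourier_fun (\<lambda>y. tent R (y - x)) k =
      (\<integral>y. complex_of_real (tent R (y + x - x)) * exp (- (\<i> * complex_of_real (k \<bullet> (y + x)))) \<partial>lborel)"
    unfolding fourier_fun_def by (rule integral_lborel_translate[symmetric]) measurable
  also have "\<dots> = (\<integral>y. exp (- (\<i> * complex_of_real (k \<bullet> x))) * (complex_of_real (tent R y) * exp (- (\<i> * complex_of_real (k \<bullet> y)))) \<partial>lborel)"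
    by (intro Bochner_Integration.integral_cong refl)
       (simp add: inner_add_right distrib_left exp_diff exp_minus divide_inverse mult_ac)
  finally show ?thesis by (simp add: fourier_fun_def)
qed

lemma star_conv_tent_translate: "star_conv (\<lambda>z. tent R (z - x)) (tent R) y = tent_corr R (y - x)"
proof -
  have "star_conv (\<lambda>z. tent R (z - x)) (tent R) y = (\<integral>z. tent R (z + x - x) * tent R (z + x - y) \<partial>lborel)"
    unfolding star_conv_def by (rule integral_lborel_translate[symmetric]) measurable
  then show ?thesis by (simp add: tent_corr_def star_conv_def algebra_simps)
qed

lemma tent_corr_nonneg: "0 \<le> tent_corr R x"
  unfolding tent_corr_def star_conv_def by (intro integral_nonneg_AE) (simp add: tent_nonneg)

lemma integrable_tent_prod: "integrable lborel (\<lambda>x. tent R x * tent R (x - z))"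
  by (rule Bochner_Integration.integrable_bound[OF integrable_tent])
     (auto simp: tent_nonneg tent_le_1 mult_left_le)

lemma tent_corr_le: "tent_corr R x \<le> (\<integral>x. tent R x \<partial>(lborel :: (real^'d) measure))" for x :: "real^'d"
  unfolding tent_corr_def star_conv_def
  by (rule integral_mono[OF integrable_tent_prod integrable_tent])
     (simp add: tent_nonneg tent_le_1 mult_left_le)

lemma continuous_on_tent_corr: "continuous_on UNIV (tent_corr R)"
  unfolding continuous_on_sequentially
proof (intro allI ballI impI, elim conjE)
  fix x :: "nat \<Rightarrow> real^'d" and a assume x: "x \<longlonglongrightarrow> a"
  have "(\<lambda>n. \<integral>z. tent R z * tent R (z - x n) \<partial>lborel) \<longlonglongrightarrow> (\<integral>z. tent R z * tent R (z - a) \<partial>lborel)"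
  proof (rule integral_dominated_convergence[where w="tent R"])
    have "(\<lambda>n. tent R (z - x n)) \<longlonglongrightarrow> tent R (z - a)" for z
      by (rule continuous_on_tendsto_compose[OF continuous_on_tent[of UNIV]]) (use x in \<open>auto intro!: tendsto_intros\<close>)
    then show "AE z in lborel. (\<lambda>n. tent R z * tent R (z - x n)) \<longlonglongrightarrow> tent R z * tent R (z - a)"
      by (auto intro!: tendsto_intros)
  qed (auto simp: integrable_tent tent_nonneg tent_le_1 mult_left_le)
  then show "(tent_corr R \<circ> x) \<longlonglongrightarrow> tent_corr R a" by (simp add: tent_corr_def star_conv_def comp_def)
qed

lemma borel_measurable_tent_corr [measurable]: "tent_corr R \<in> borel_measurable borel"
  using continuous_on_tent_corr by (rule borel_measurable_continuous_onI)

lemma tent_corr_support: "tent_corr R z \<noteq> 0 \<Longrightarrow> norm z \<le> 2 / R" for z :: "real^'d"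
proof (rule ccontr)
  assume nz: "tent_corr R z \<noteq> 0" and "\<not> norm z \<le> 2 / R"
  then have z: "1 / R + 1 / R < norm z" by simp
  have "tent R x * tent R (x - z) = 0" for x
  proof (rule ccontr)
    assume "tent R x * tent R (x - z) \<noteq> 0"
    then have "norm x \<le> 1 / R" "norm (x - z) \<le> 1 / R" using tent_support by auto
    then show False using z norm_triangle_ineq4[of x "x - z"] by simp
  qed
  then have "tent_corr R z = (\<integral>x. 0 \<partial>(lborel :: (real^'d) measure))"
    unfolding tent_corr_def star_conv_def by (intro Bochner_Integration.integral_cong) auto
  then show False using nz by simp
qed

lemma integrable_tent_corr: "integrable lborel (tent_corr R :: real^'d \<Rightarrow> real)"
proof (rule Bochner_Integration.integrable_bound)
  let ?B = "\<integral>x. tent R x \<partial>(lborel :: (real^'d) measure)"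
  show "integrable lborel (\<lambda>x :: real^'d. ?B * indicator (cball 0 (2 / R)) x)"
    by (simp add: integrable_indicator_iff emeasure_lborel_cball_finite)
  show "AE x in lborel. norm (tent_corr R x) \<le> norm (?B * indicator (cball 0 (2 / R)) (x :: real^'d))"
  proof (rule AE_I2)
    fix x :: "real^'d"
    show "norm (tent_corr R x) \<le> norm (?B * indicator (cball 0 (2 / R)) x)"
      using tent_corr_support[of x] tent_corr_le[of x] tent_corr_nonneg[of x]
      by (cases "tent_corr R x = 0") (auto simp: dist_norm)
  qed
qed measurable

lemma borel_measurable_tent_spec [measurable]: "(tent_spec R :: real^'d \<Rightarrow> real) \<in> borel_measurable borel"
  unfolding tent_spec_def[abs_def] fourier_fun_def by measurable

text \<open>The autocorrelation is the convolution of the tent with its reflection, and reflection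
  conjugates the transform of a real function. One tent is absorbed into the finite measure
  \<open>F\<close>; Fubini then asks only for the absolute integral of the other, which does not
  depend on the shift.\<close>

lemma fourier_tent_corr: "fourier_fun (tent_corr R) k = complex_of_real (tent_spec R k)" for k :: "real^'d"
proof -
  define F where "F = density lborel (\<lambda>x :: real^'d. ennreal (tent R x))"
  have [simp, measurable_cong]: "sets F = sets borel" by (simp add: F_def)
  interpret F: finite_measure F
  proof
    show "emeasure F (space F) \<noteq> \<infinity>"
      using integrable_tent[where 'a="real^'d"] by (simp add: F_def emeasure_density nn_integral_eq_integral tent_nonneg)
  qed
  have iF: "(\<integral>x. g x \<partial>F) = (\<integral>x. tent R x *\<^sub>R g x \<partial>lborel)" if [measurable]: "g \<in> borel_measurable borel"
    for g :: "real^'d \<Rightarrow> complex"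
    unfolding F_def by (rule integral_density) (auto simp: tent_nonneg)
  interpret pair_sigma_finite F "lborel :: (real^'d) measure" ..
  let ?e = "\<lambda>x. exp (- (\<i> * complex_of_real (k \<bullet> x)))"
  have sh: "(\<integral>z. complex_of_real (tent R (x - z)) * ?e z \<partial>lborel) = ?e x * cnj (fourier_fun (tent R) k)" for x
  proof -
    have "(\<integral>z. complex_of_real (tent R (x - z)) * ?e z \<partial>lborel) = (\<integral>z. complex_of_real (tent R (x - (x - z))) * ?e (x - z) \<partial>lborel)"
      by (rule integral_lborel_reflect[symmetric]) measurable
    also have "\<dots> = (\<integral>z. ?e x * cnj (complex_of_real (tent R z) * ?e z) \<partial>lborel)"
      by (intro Bochner_Integration.integral_cong refl)
         (simp add: exp_cnj inner_diff_right exp_add[symmetric] algebra_simps exp_diff exp_minus divide_inverse)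
    finally show ?thesis by (simp only: fourier_fun_def integral_mult_right_zero Bochner_Integration.integral_cnj)
  qed
  have iz: "integrable lborel (\<lambda>z. tent R (x - z))" for x :: "real^'d"
  proof -
    have "integrable (density (distr lborel borel (\<lambda>z. x + (-1) *\<^sub>R z)) (\<lambda>_. ennreal (\<bar>-1\<bar> ^ DIM(real^'d)))) (tent R)"
      using integrable_tent[where 'a="real^'d"] by (subst (asm) lborel_affine[of "-1" x]) auto
    then show ?thesis by (subst (asm) integrable_density) (auto simp: integrable_distr_eq)
  qed
  have "fourier_fun (tent_corr R) k = (\<integral>z. (\<integral>x. complex_of_real (tent R (x - z)) * ?e z \<partial>F) \<partial>lborel)"
    unfolding fourier_fun_def tent_corr_def star_conv_def
    by (simp add: iF scaleR_conv_of_real integral_complex_of_real[symmetric] mult.assoc del: integral_complex_of_real flip: of_real_mult)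
  also have "\<dots> = (\<integral>x. (\<integral>z. complex_of_real (tent R (x - z)) * ?e z \<partial>lborel) \<partial>F)"
  proof (rule Fubini_integral, rule Fubini_integrable)
    have "(\<integral>z. norm (complex_of_real (tent R (x - z)) * ?e z) \<partial>lborel) = (\<integral>z. tent R z \<partial>(lborel :: (real^'d) measure))" for x
    proof -
      have "(\<integral>z. norm (complex_of_real (tent R (x - z)) * ?e z) \<partial>lborel) = (\<integral>z. tent R (x - z) \<partial>lborel)"
        by (simp add: norm_mult tent_nonneg)
      then show ?thesis by (simp add: integral_lborel_reflect)
    qed
    then show "integrable F (\<lambda>x. \<integral>z. norm (case (x, z) of (x, z) \<Rightarrow> complex_of_real (tent R (x - z)) * ?e z) \<partial>lborel)"
      by simp
    show "AE x in F. integrable lborel (\<lambda>z. case (x, z) of (x, z) \<Rightarrow> complex_of_real (tent R (x - z)) * ?e z)"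
    proof (rule AE_I2)
      fix x
      show "integrable lborel (\<lambda>z. case (x, z) of (x, z) \<Rightarrow> complex_of_real (tent R (x - z)) * ?e z)"
        by (rule Bochner_Integration.integrable_bound[OF iz[of x]]) (auto simp: norm_mult)
    qed
  qed measurable
  also have "\<dots> = (\<integral>x. ?e x \<partial>F) * cnj (fourier_fun (tent R) k)" unfolding sh by simp
  also have "(\<integral>x. ?e x \<partial>F) = fourier_fun (tent R) k" by (simp add: iF fourier_fun_def scaleR_conv_of_real)
  finally show ?thesis by (simp only: tent_spec_def complex_norm_square)
qed

lemma tent_spec_nonneg: "0 \<le> tent_spec R k" by (simp add: tent_spec_def)

text \<open>On the support of the tent the phase has modulus at most 1 < \<pi>/2, so its cosine is
  at least cos 1 > 0. The real part of the transform is thus at least cos 1 times the integral of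
  the tent.\<close>

lemma tent_spec_pos: "norm k \<le> R \<Longrightarrow> 0 < tent_spec R k" for k :: "real^'d"
proof -
  assume k: "norm k \<le> R"
  have i: "integrable lborel (\<lambda>x. complex_of_real (tent R x) * exp (- (\<i> * complex_of_real (k \<bullet> x))))"
    by (rule Bochner_Integration.integrable_bound[OF integrable_tent]) (auto simp: norm_mult)
  have re: "Re (complex_of_real (tent R x) * exp (- (\<i> * complex_of_real (k \<bullet> x)))) = tent R x * cos (k \<bullet> x)" for x
    by (simp add: exp_eq_polar cis.ctr Re_exp)
  have "0 < cos 1 * (\<integral>x. tent R x \<partial>(lborel :: (real^'d) measure))" using integral_tent_pos[where 'a="real^'d"] cos_gt_zero_pi[of 1] pi_gt3 by simp
  also have "\<dots> = (\<integral>x. cos 1 * tent R x \<partial>(lborel :: (real^'d) measure))" by simp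
  also have "\<dots> \<le> (\<integral>x. tent R x * cos (k \<bullet> x) \<partial>lborel)"
  proof (rule integral_mono)
    show "integrable lborel (\<lambda>x. tent R x * cos (k \<bullet> x))" using integrable_Re[OF i] unfolding re .
    fix x :: "real^'d"
    show "cos 1 * tent R x \<le> tent R x * cos (k \<bullet> x)"
    proof (cases "tent R x = 0")
      case False
      have "\<bar>k \<bullet> x\<bar> \<le> norm k * norm x" by (rule Cauchy_Schwarz_ineq2)
      also have "\<dots> \<le> R * (1 / R)" using k tent_support[OF False] R by (intro mult_mono) auto
      finally have "\<bar>k \<bullet> x\<bar> \<le> 1" using R by simp
      then have "cos 1 \<le> cos \<bar>k \<bullet> x\<bar>" using pi_gt3 by (intro cos_monotone_0_pi_le) auto
      then show ?thesis using tent_nonneg[of x] by (simp add: mult.commute[of "cos 1"] mult_left_mono)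
    qed simp
  qed (simp add: integrable_tent)
  also have "\<dots> = Re (fourier_fun (tent R) k)"
    unfolding fourier_fun_def re[symmetric] by (rule integral_Re[OF i])
  finally show ?thesis by (auto simp: tent_spec_def)
qed

lemma integrable_tent_spec: "integrable lborel (tent_spec R :: real^'d \<Rightarrow> real)"
  by (rule fourier_inversion_nonneg(1)[OF continuous_on_tent_corr tent_corr_nonneg tent_corr_le integrable_tent_corr tent_spec_nonneg borel_measurable_tent_spec fourier_tent_corr])

lemma tent_corr_inversion:
  "(\<integral>k. complex_of_real (tent_spec R k) * exp (\<i> * complex_of_real (k \<bullet> y)) \<partial>lborel) =
    complex_of_real ((2 * pi) ^ CARD('d) * tent_corr R y)" for y :: "real^'d"
  by (rule fourier_inversion_nonneg(2)[OF continuous_on_tent_corr tent_corr_nonneg tent_corr_le integrable_tent_corr tent_spec_nonneg borel_measurable_tent_spec fourier_tent_corr])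

end

section \<open>Identifying a spectral measure locally\<close>

lemma norm_exp_minus_ii [simp]: "cmod (exp (- (\<i> * complex_of_real x))) = 1"
  using norm_exp_i_times[of "- x"] by simp

lemma borel_measurable_cnj [measurable (raw)]:
  "f \<in> borel_measurable M \<Longrightarrow> (\<lambda>x. cnj (f x)) \<in> borel_measurable M"
  by (rule measurable_compose[OF _ borel_measurable_continuous_onI]) (auto intro!: continuous_intros)

lemma borel_measurable_fourier_measure:
  assumes "finite_measure \<mu>" and [measurable_cong]: "sets \<mu> = sets borel"
  shows "fourier_measure \<mu> \<in> borel_measurable borel"
proof -
  interpret finite_measure \<mu> by fact
  show ?thesis unfolding fourier_measure_def[abs_def] by measurable
qed

lemma norm_fourier_measure_le:
  assumes "finite_measure \<mu>"
  shows "cmod (fourier_measure \<mu> k) \<le> measure \<mu> (space \<mu>)"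
proof -
  have "cmod (fourier_measure \<mu> k) \<le> (\<integral>x. cmod (exp (- (\<i> * complex_of_real (k \<bullet> x)))) \<partial>\<mu>)"
    unfolding fourier_measure_def by (rule integral_norm_bound)
  then show ?thesis by simp
qed

lemma cnj_fourier_measure: "cnj (fourier_measure \<mu> k) = fourier_measure \<mu> (- k)"
  unfolding fourier_measure_def by (subst Bochner_Integration.integral_cnj[symmetric]) (simp add: exp_cnj)

lemma integrable_exp_finite:
  assumes "finite_measure \<mu>" and [measurable_cong]: "sets \<mu> = sets (borel :: (real^'d) measure)"
  shows "integrable \<mu> (\<lambda>x. exp (- (\<i> * complex_of_real (k \<bullet> x))))"
  by (rule finite_measure.integrable_bounded[OF assms(1), where B=1]) auto

lemma fourier_measure_add_measure:
  assumes "finite_measure \<mu>" "finite_measure \<nu>"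
    and s: "sets \<mu> = sets borel" "sets \<nu> = sets borel"
  shows "fourier_measure (add_measure \<mu> \<nu>) k = fourier_measure \<mu> k + fourier_measure \<nu> k"
  unfolding fourier_measure_def
  by (rule integral_add_measure) (use assms integrable_exp_finite in auto)

lemma finite_measure_add_measure:
  assumes "finite_measure \<mu>" "finite_measure \<nu>" "sets \<nu> = sets \<mu>"
  shows "finite_measure (add_measure \<mu> \<nu>)"
  by (rule finite_measureI) (use assms in \<open>auto simp: emeasure_add_measure finite_measure.emeasure_finite\<close>)

lemma finite_measure_density_bounded:
  assumes "finite_measure W" "f \<in> borel_measurable W" "\<And>x. f x \<le> B"
  shows "finite_measure (density W (\<lambda>x. ennreal (f x)))"
proof (rule finite_measureI)
  have "(\<integral>\<^sup>+x. ennreal (f x) \<partial>W) \<le> (\<integral>\<^sup>+x. ennreal B \<partial>W)" using assms by (intro nn_integral_mono ennreal_leI) auto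
  also have "\<dots> < \<infinity>" using assms(1) by (simp add: ennreal_mult_less_top finite_measure.emeasure_finite less_top[symmetric] ennreal_mult_eq_top_iff)
  finally show "emeasure (density W (\<lambda>x. ennreal (f x))) (space (density W (\<lambda>x. ennreal (f x)))) \<noteq> \<infinity>"
    using assms(2) by (simp add: emeasure_density cong: nn_integral_cong)
qed

text \<open>The coercion to \<open>ennreal\<close> truncates negative values, so the two densities
  are the positive and the negative part of \<open>r\<close>. This lets a signed density be handled
  by the injectivity result for positive measures.\<close>

lemma fourier_density_pos_part:
  assumes W: "finite_measure W" and [measurable_cong]: "sets W = sets (borel :: (real^'d) measure)"
    and [measurable]: "r \<in> borel_measurable borel" and r: "\<And>k. \<bar>r k\<bar> \<le> B"
  shows "fourier_measure (density W (\<lambda>k. ennreal (r k))) x - fourier_measure (density W (\<lambda>k. ennreal (- r k))) x =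
    (\<integral>k. exp (- (\<i> * complex_of_real (x \<bullet> k))) * complex_of_real (r k) \<partial>W)"
proof -
  have ii: "integrable W (\<lambda>k. max 0 (s * r k) *\<^sub>R exp (- (\<i> * complex_of_real (x \<bullet> k))))" if "\<bar>s\<bar> = 1" for s
  proof -
    have "\<bar>max 0 (s * r k)\<bar> \<le> B" for k
      using r[of k] that by (cases "s = 1") (auto simp: abs_if max_def split: if_splits)
    then show ?thesis
      by (intro finite_measure.integrable_bounded[OF W, where B=B]) auto
  qed
  have e: "fourier_measure (density W (\<lambda>k. ennreal (q k))) x = (\<integral>k. max 0 (q k) *\<^sub>R exp (- (\<i> * complex_of_real (x \<bullet> k))) \<partial>W)"
    if [measurable]: "q \<in> borel_measurable borel" for q
  proof -
    have d: "density W (\<lambda>k. ennreal (q k)) = density W (\<lambda>k. ennreal (max 0 (q k)))"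
      by (intro arg_cong[where f="density W"] ext) (auto simp: max_def ennreal_neg)
    show ?thesis unfolding fourier_measure_def d by (rule integral_density) auto
  qed
  have "fourier_measure (density W (\<lambda>k. ennreal (r k))) x - fourier_measure (density W (\<lambda>k. ennreal (- r k))) x =
      (\<integral>k. max 0 (r k) *\<^sub>R exp (- (\<i> * complex_of_real (x \<bullet> k))) - max 0 (- r k) *\<^sub>R exp (- (\<i> * complex_of_real (x \<bullet> k))) \<partial>W)"
    using ii[of 1] ii[of "- 1"] by (simp only: e assms(3) borel_measurable_uminus Bochner_Integration.integral_diff mult_1 mult_minus1 abs_one abs_minus_cancel simp_thms)
  then show ?thesis
    by (simp only:) (auto intro!: Bochner_Integration.integral_cong simp: scaleR_conv_of_real max_def)
qed

text \<open>Conjugating the hypothesis at \<open>- x\<close> shows that it also holds with \<open>cnj c\<close> in place of \<open>c\<close>. Hence the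
  real and imaginary parts of \<open>c\<close> can be treated separately, as differences of positive measures.\<close>

lemma fourier_complex_density_decomposition:
  fixes P Q W :: "(real^'d) measure" and c :: "real^'d \<Rightarrow> complex"
  assumes fin: "finite_measure P" "finite_measure Q" "finite_measure W"
    and s: "sets P = sets borel" "sets Q = sets borel" "sets W = sets borel"
    and c[measurable]: "c \<in> borel_measurable borel" and b: "\<And>k. cmod (c k) \<le> B"
    and eq: "\<And>x. fourier_measure P x = fourier_measure Q x + (\<integral>k. exp (- (\<i> * complex_of_real (x \<bullet> k))) * c k \<partial>W)"
  shows "add_measure P (density W (\<lambda>k. ennreal (- Re (c k)))) = add_measure Q (density W (\<lambda>k. ennreal (Re (c k))))"
    and "density W (\<lambda>k. ennreal (Im (c k))) = density W (\<lambda>k. ennreal (- Im (c k)))"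
proof -
  note [measurable_cong] = s(3)
  let ?e = "\<lambda>x k. exp (- (\<i> * complex_of_real (x \<bullet> k)))"
  have re: "\<bar>Re (c k)\<bar> \<le> B" and im: "\<bar>Im (c k)\<bar> \<le> B" for k
    using abs_Re_le_cmod[of "c k"] abs_Im_le_cmod[of "c k"] b[of k] by linarith+
  have ib: "integrable W (\<lambda>k. ?e x k * f k)" if "f \<in> borel_measurable borel" "\<And>k. cmod (f k) \<le> B" for f x
    using that by (intro finite_measure.integrable_bounded[OF fin(3), where B=B]) (auto simp: norm_mult)
  have cc: "(\<integral>k. ?e x k * c k \<partial>W) = (\<integral>k. ?e x k * cnj (c k) \<partial>W)" for x
  proof -
    have "(\<integral>k. ?e x k * cnj (c k) \<partial>W) = cnj (\<integral>k. ?e (- x) k * c k \<partial>W)"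
      by (subst Bochner_Integration.integral_cnj[symmetric]) (simp add: exp_cnj)
    also have "(\<integral>k. ?e (- x) k * c k \<partial>W) = fourier_measure P (- x) - fourier_measure Q (- x)"
      using eq[of "- x"] by simp
    also have "cnj \<dots> = fourier_measure P x - fourier_measure Q x" by (simp add: cnj_fourier_measure)
    finally show ?thesis using eq[of x] by simp
  qed
  have rez: "complex_of_real (Re z) = (z + cnj z) / 2" and imz: "complex_of_real (Im z) = (z - cnj z) / (2 * \<i>)" for z
    by (simp_all add: complex_add_cnj complex_diff_cnj complex_eq_iff)
  have R: "(\<integral>k. ?e x k * complex_of_real (Re (c k)) \<partial>W) = (\<integral>k. ?e x k * c k \<partial>W)"
    and I: "(\<integral>k. ?e x k * complex_of_real (Im (c k)) \<partial>W) = 0" for x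
  proof -
    have i: "integrable W (\<lambda>k. ?e x k * c k)" "integrable W (\<lambda>k. ?e x k * cnj (c k))"
      using b by (auto intro!: ib)
    have "(\<integral>k. ?e x k * complex_of_real (Re (c k)) \<partial>W) = (\<integral>k. (?e x k * c k + ?e x k * cnj (c k)) / 2 \<partial>W)"
      by (intro Bochner_Integration.integral_cong refl) (simp only: rez times_divide_eq_right distrib_left)
    also have "\<dots> = ((\<integral>k. ?e x k * c k \<partial>W) + (\<integral>k. ?e x k * cnj (c k) \<partial>W)) / 2"
      using i by simp
    finally show "(\<integral>k. ?e x k * complex_of_real (Re (c k)) \<partial>W) = (\<integral>k. ?e x k * c k \<partial>W)"
      unfolding cc[symmetric] by simp
    have "(\<integral>k. ?e x k * complex_of_real (Im (c k)) \<partial>W) = (\<integral>k. (?e x k * c k - ?e x k * cnj (c k)) / (2 * \<i>) \<partial>W)"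
      by (intro Bochner_Integration.integral_cong refl) (simp only: imz times_divide_eq_right right_diff_distrib)
    also have "\<dots> = ((\<integral>k. ?e x k * c k \<partial>W) - (\<integral>k. ?e x k * cnj (c k) \<partial>W)) / (2 * \<i>)"
      using i by simp
    finally show "(\<integral>k. ?e x k * complex_of_real (Im (c k)) \<partial>W) = 0"
      unfolding cc[symmetric] by simp
  qed
  have fd: "finite_measure (density W (\<lambda>k. ennreal (f k)))" if "f \<in> borel_measurable borel" "\<And>k. \<bar>f k\<bar> \<le> B" for f
    using that s(3) by (intro finite_measure_density_bounded[OF fin(3), where B=B]) (auto simp: abs_le_iff cong: measurable_cong_sets)
  show "add_measure P (density W (\<lambda>k. ennreal (- Re (c k)))) = add_measure Q (density W (\<lambda>k. ennreal (Re (c k))))"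
  proof (rule fourier_measure_inject)
    fix x
    have "fourier_measure (density W (\<lambda>k. ennreal (Re (c k)))) x - fourier_measure (density W (\<lambda>k. ennreal (- Re (c k)))) x =
        (\<integral>k. ?e x k * c k \<partial>W)"
      unfolding R[symmetric] by (rule fourier_density_pos_part[OF fin(3) s(3) _ re]) measurable
    then show "fourier_measure (add_measure P (density W (\<lambda>k. ennreal (- Re (c k))))) x =
        fourier_measure (add_measure Q (density W (\<lambda>k. ennreal (Re (c k))))) x"
      using eq[of x] re fin s by (simp add: fourier_measure_add_measure fd algebra_simps)
  qed (use fin s re in \<open>auto intro!: finite_measure_add_measure fd\<close>)
  show "density W (\<lambda>k. ennreal (Im (c k))) = density W (\<lambda>k. ennreal (- Im (c k)))"
  proof (rule fourier_measure_inject)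
    fix x
    show "fourier_measure (density W (\<lambda>k. ennreal (Im (c k)))) x = fourier_measure (density W (\<lambda>k. ennreal (- Im (c k)))) x"
      using fourier_density_pos_part[OF fin(3) s(3), of "\<lambda>k. Im (c k)" B x] im I[of x] by simp
  qed (use s im in \<open>auto intro!: fd\<close>)
qed

section \<open>Comparison of weighted spectral measures\<close>

text \<open>Insert the inversion formula for \<open>tent_corr\<close> and exchange the integrals.
  The phase belonging to z is exp(+i<k,z>), opposite to the one in \<open>fourier_measure\<close>,
  hence the conjugate. The factor (2\<pi>)^d is the one of the Bartlett property.\<close>

lemma tent_corr_fourier_finite:
  fixes E :: "(real^'d) measure"
  assumes R: "0 < R" and fin: "finite_measure E" and s[measurable_cong]: "sets E = sets borel"
  shows "complex_of_real ((2 * pi) ^ CARD('d) * (\<integral>z. tent_corr R (z - x) \<partial>E)) =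
    (\<integral>k. exp (- (\<i> * complex_of_real (x \<bullet> k))) * cnj (fourier_measure E k) \<partial>density lborel (\<lambda>k. ennreal (tent_spec R k)))"
proof -
  define W where "W = density lborel (\<lambda>k. ennreal (tent_spec R (k :: real^'d)))"
  have [measurable_cong, simp]: "sets W = sets borel" by (simp add: W_def)
  have fW: "finite_measure W"
    by (rule finite_measureI)
       (use integrable_tent_spec[OF R, where 'd='d] in \<open>simp add: W_def emeasure_density nn_integral_eq_integral tent_spec_nonneg[OF R] borel_measurable_tent_spec[OF R]\<close>)
  have "complex_of_real ((2 * pi) ^ CARD('d) * (\<integral>z. tent_corr R (z - x) \<partial>E)) =
      (\<integral>z. complex_of_real ((2 * pi) ^ CARD('d) * tent_corr R (z - x)) \<partial>E)"
    by (subst integral_complex_of_real) simp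
  also have "\<dots> = (\<integral>z. (\<integral>k. exp (\<i> * complex_of_real (k \<bullet> (z - x))) \<partial>W) \<partial>E)"
    unfolding tent_corr_inversion[OF R, symmetric] W_def
    by (subst integral_density) (auto simp: tent_spec_nonneg[OF R] borel_measurable_tent_spec[OF R] scaleR_conv_of_real)
  also have "\<dots> = (\<integral>k. (\<integral>z. exp (\<i> * complex_of_real (k \<bullet> (z - x))) \<partial>E) \<partial>W)"
    by (rule Fubini_integral_bounded[where B=1]) (use fin fW in auto)
  also have "\<dots> = (\<integral>k. exp (- (\<i> * complex_of_real (x \<bullet> k))) * cnj (fourier_measure E k) \<partial>W)"
  proof (rule Bochner_Integration.integral_cong[OF refl])
    fix k :: "real^'d"
    have "(\<integral>z. exp (\<i> * complex_of_real (k \<bullet> (z - x))) \<partial>E) =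
        (\<integral>z. exp (- (\<i> * complex_of_real (x \<bullet> k))) * exp (- (\<i> * complex_of_real ((- k) \<bullet> z))) \<partial>E)"
      by (intro Bochner_Integration.integral_cong refl)
         (simp add: exp_add[symmetric] inner_diff_right right_diff_distrib inner_commute[of x k])
    then show "(\<integral>z. exp (\<i> * complex_of_real (k \<bullet> (z - x))) \<partial>E) =
        exp (- (\<i> * complex_of_real (x \<bullet> k))) * cnj (fourier_measure E k)"
      unfolding cnj_fourier_measure unfolding fourier_measure_def by simp
  qed
  finally show ?thesis unfolding W_def .
qed

text \<open>Turns the additive form of a difference into a real subtraction. All four terms must be
  finite, since \<open>enn2real\<close> sends infinity to 0.\<close>

lemma enn2real_add_eq:
  assumes "a + y = b + x" "a < \<infinity>" "b < \<infinity>" "x < \<infinity>" "y < \<infinity>"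
  shows "enn2real a = enn2real b + (enn2real x - enn2real y)"
  using arg_cong[OF assms(1), of enn2real] assms(2-) by (simp add: enn2real_plus)

text \<open>The weight \<open>tent_spec R\<close> makes all measures involved finite, and the
  hypothesis then says that \<open>P\<close> equals \<open>Q\<close> plus a complex density times
  \<open>W\<close>. After this has been separated into identities of positive measures, the weight
  is divided out again on \<open>B\<close>, where it is positive.\<close>

lemma spectral_decomposition:
  fixes S1 S2 E1 E2 :: "(real^'d) measure" and a :: "real^'d \<Rightarrow> complex"
  assumes R: "0 < R" and lf: "locally_finite S1" "locally_finite S2"
    and iw: "integrable S1 (tent_spec R)" "integrable S2 (tent_spec R)"
    and a[measurable]: "a \<in> borel_measurable borel" and a1: "\<And>k. cmod (a k) \<le> 1"
    and fE: "finite_measure E1" "finite_measure E2" and sE: "sets E1 = sets borel" "sets E2 = sets borel"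
    and eq: "\<And>x. (\<integral>k. exp (- (\<i> * complex_of_real (x \<bullet> k))) * complex_of_real (tent_spec R k) \<partial>S1) =
      (\<integral>k. exp (- (\<i> * complex_of_real (x \<bullet> k))) * complex_of_real (tent_spec R k * (cmod (a k))\<^sup>2) \<partial>S2) +
      complex_of_real ((2 * pi) ^ CARD('d) * ((\<integral>z. tent_corr R (z - x) \<partial>E1) - (\<integral>z. tent_corr R (z - x) \<partial>E2)))"
    and B: "B \<in> sets borel" "B \<subseteq> cball 0 R"
  shows "complex_of_real (measure S1 B) = complex_of_real (measure (density S2 (\<lambda>k. ennreal ((cmod (a k))\<^sup>2))) B) +
    (LINT k:B|lborel. fourier_measure E1 k - fourier_measure E2 k)"
proof -
  have sS[measurable_cong]: "sets S1 = sets borel" "sets S2 = sets borel" using lf by (auto simp: locally_finite_def)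
  note [measurable] = B(1) borel_measurable_fourier_measure[OF fE(1) sE(1)] borel_measurable_fourier_measure[OF fE(2) sE(2)]
    borel_measurable_tent_spec[OF R]
  define W where "W = density lborel (\<lambda>k. ennreal (tent_spec R (k :: real^'d)))"
  define P where "P = density S1 (\<lambda>k. ennreal (tent_spec R k))"
  define Q where "Q = density S2 (\<lambda>k. ennreal (tent_spec R k * (cmod (a k))\<^sup>2))"
  define c where "c k = cnj (fourier_measure E1 k - fourier_measure E2 k)" for k
  have [measurable]: "c \<in> borel_measurable borel" unfolding c_def[abs_def] by measurable
  define C where "C = measure E1 (space E1) + measure E2 (space E2)"
  have cC: "cmod (c k) \<le> C" for k
    using norm_triangle_ineq4[of "fourier_measure E1 k" "fourier_measure E2 k"]
      norm_fourier_measure_le[OF fE(1), of k] norm_fourier_measure_le[OF fE(2), of k] by (simp add: c_def C_def del: complex_cnj_diff)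
  have s[simp, measurable_cong]: "sets P = sets borel" "sets Q = sets borel" "sets W = sets borel" by (simp_all add: P_def Q_def W_def sS)
  have iwa: "integrable S2 (\<lambda>k. tent_spec R k * (cmod (a k))\<^sup>2)"
    by (rule Bochner_Integration.integrable_bound[OF iw(2)])
       (auto simp: abs_mult tent_spec_nonneg[OF R] mult_left_le power_le_one a1)
  have fin: "finite_measure P" "finite_measure Q" "finite_measure W"
    using iw iwa integrable_tent_spec[OF R, where 'd='d]
    by (auto intro!: finite_measureI simp: P_def Q_def W_def emeasure_density nn_integral_eq_integral tent_spec_nonneg[OF R] cong: measurable_cong_sets)
  have i: "integrable W (\<lambda>k. exp (- (\<i> * complex_of_real (x \<bullet> k))) * cnj (fourier_measure E k))"
    if "finite_measure E" "sets E = sets borel" for E x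
    using that borel_measurable_fourier_measure[OF that] norm_fourier_measure_le[OF that(1)]
    by (intro finite_measure.integrable_bounded[OF fin(3), where B="measure E (space E)"])
       (auto simp: norm_mult W_def)
  have "fourier_measure P x = fourier_measure Q x + (\<integral>k. exp (- (\<i> * complex_of_real (x \<bullet> k))) * c k \<partial>W)" for x
  proof -
    have "fourier_measure P x = (\<integral>k. exp (- (\<i> * complex_of_real (x \<bullet> k))) * complex_of_real (tent_spec R k) \<partial>S1)"
      unfolding fourier_measure_def P_def
      by (subst integral_density) (auto simp: tent_spec_nonneg[OF R] scaleR_conv_of_real mult.commute)
    moreover have "fourier_measure Q x = (\<integral>k. exp (- (\<i> * complex_of_real (x \<bullet> k))) * complex_of_real (tent_spec R k * (cmod (a k))\<^sup>2) \<partial>S2)"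
      unfolding fourier_measure_def Q_def
      by (subst integral_density) (auto simp: tent_spec_nonneg[OF R] scaleR_conv_of_real mult.commute)
    moreover have "(\<integral>k. exp (- (\<i> * complex_of_real (x \<bullet> k))) * c k \<partial>W) =
        complex_of_real ((2 * pi) ^ CARD('d) * ((\<integral>z. tent_corr R (z - x) \<partial>E1) - (\<integral>z. tent_corr R (z - x) \<partial>E2)))"
      using i[OF fE(1) sE(1)] i[OF fE(2) sE(2)]
      by (simp only: right_diff_distrib of_real_diff tent_corr_fourier_finite[OF R fE(1) sE(1)] tent_corr_fourier_finite[OF R fE(2) sE(2)]
          c_def complex_cnj_diff W_def Bochner_Integration.integral_diff)
    ultimately show ?thesis using eq[of x] by simp
  qed
  note D = fourier_complex_density_decomposition[OF fin s _ cC this, OF \<open>c \<in> borel_measurable borel\<close>]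
  have pos: "0 < tent_spec R k" if "k \<in> B" for k using that B(2) by (intro tent_spec_pos[OF R]) auto
  \<comment> \<open>Integrating \<open>?g\<close> divides by the weight on B. Outside B it is 0, so
    the infinite inverse at zeros of the weight does no harm.\<close>
  let ?g = "\<lambda>k. indicator B k * inverse (ennreal (tent_spec R k))"
  have cancel: "ennreal (tent_spec R k) * ?g k = indicator B k" for k
    using pos[of k] by (cases "k \<in> B") (simp_all add: inverse_ennreal ennreal_mult[symmetric] flip: ennreal_1)
  have gW: "(\<integral>\<^sup>+k. ?g k \<partial>density W (\<lambda>k. ennreal (f k))) = (\<integral>\<^sup>+k. ennreal (indicator B k * f k) \<partial>lborel)"
    if [measurable]: "f \<in> borel_measurable borel" for f
  proof -
    have "(\<integral>\<^sup>+k. ?g k \<partial>density W (\<lambda>k. ennreal (f k))) = (\<integral>\<^sup>+k. ennreal (tent_spec R k) * (ennreal (f k) * ?g k) \<partial>lborel)"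
      unfolding W_def by (simp add: nn_integral_density)
    also have "\<dots> = (\<integral>\<^sup>+k. ennreal (f k) * (ennreal (tent_spec R k) * ?g k) \<partial>lborel)"
      by (intro nn_integral_cong) (simp only: mult_ac)
    also have "\<dots> = (\<integral>\<^sup>+k. ennreal (indicator B k * f k) \<partial>lborel)"
      unfolding cancel by (intro nn_integral_cong) (simp split: split_indicator)
    finally show ?thesis .
  qed
  have gP: "(\<integral>\<^sup>+k. ?g k \<partial>P) = emeasure S1 B"
    unfolding P_def by (simp add: nn_integral_density cancel sS)
  let ?D = "density S2 (\<lambda>k. ennreal ((cmod (a k))\<^sup>2))"
  have gQ: "(\<integral>\<^sup>+k. ?g k \<partial>Q) = emeasure ?D B"
  proof -
    have "(\<integral>\<^sup>+k. ?g k \<partial>Q) = (\<integral>\<^sup>+k. ennreal (tent_spec R k * (cmod (a k))\<^sup>2) * ?g k \<partial>S2)"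
      unfolding Q_def by (simp add: nn_integral_density)
    also have "\<dots> = (\<integral>\<^sup>+k. ennreal ((cmod (a k))\<^sup>2) * (ennreal (tent_spec R k) * ?g k) \<partial>S2)"
      by (intro nn_integral_cong) (simp only: ennreal_mult'[OF tent_spec_nonneg[OF R]] mult_ac)
    finally show ?thesis unfolding cancel by (simp add: emeasure_density sS)
  qed
  have bB: "bounded B" using B(2) bounded_cball bounded_subset by blast
  have iB: "integrable lborel (\<lambda>k. indicator B k * f k)"
    if [measurable]: "f \<in> borel_measurable borel" and "\<And>k. \<bar>f k\<bar> \<le> C" for f :: "real^'d \<Rightarrow> real"
  proof (rule Bochner_Integration.integrable_bound)
    show "integrable lborel (\<lambda>k. indicator B k * C)"
      using emeasure_bounded_finite[OF bB] by (simp add: integrable_indicator_iff)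
    show "AE k in lborel. norm (indicator B k * f k) \<le> norm (indicator B k * C)"
      using that(2) order_trans[OF abs_ge_zero that(2)] by (intro AE_I2) (auto simp: abs_mult split: split_indicator intro: order_trans[OF _ abs_ge_self])
  qed measurable
  have re: "\<bar>Re (c k)\<bar> \<le> C" and im: "\<bar>Im (c k)\<bar> \<le> C" for k
    using abs_Re_le_cmod[of "c k"] abs_Im_le_cmod[of "c k"] cC[of k] by linarith+
  have iR: "integrable lborel (\<lambda>k. indicator B k * Re (c k))" and iI: "integrable lborel (\<lambda>k. indicator B k * Im (c k))"
    using re im by (auto intro!: iB)
  have nf: "(\<integral>\<^sup>+k. ennreal (f k) \<partial>lborel) < \<infinity>" "(\<integral>\<^sup>+k. ennreal (- f k) \<partial>lborel) < \<infinity>"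
    if "integrable lborel f" for f :: "real^'d \<Rightarrow> real"
    using that by (auto simp: real_integrable_def less_top)
  have eS: "emeasure S1 B < \<infinity>" using lf(1) bB B(1) by (simp add: locally_finite_def)
  have "emeasure ?D B \<le> emeasure S2 B"
  proof -
    have "emeasure ?D B \<le> (\<integral>\<^sup>+k. indicator B k \<partial>S2)"
      using a1 by (simp add: emeasure_density sS del: nn_integral_indicator)
        (intro nn_integral_mono, auto split: split_indicator simp: power_le_one)
    then show ?thesis by (simp add: sS)
  qed
  also have "\<dots> < \<infinity>" using lf(2) bB B(1) by (simp add: locally_finite_def)
  finally have eD: "emeasure ?D B < \<infinity>" .
  have "emeasure S1 B + (\<integral>\<^sup>+k. ennreal (- (indicator B k * Re (c k))) \<partial>lborel) =
      emeasure ?D B + (\<integral>\<^sup>+k. ennreal (indicator B k * Re (c k)) \<partial>lborel)"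
  proof -
    have "(\<integral>\<^sup>+k. ?g k \<partial>add_measure P (density W (\<lambda>k. ennreal (- Re (c k))))) = (\<integral>\<^sup>+k. ?g k \<partial>add_measure Q (density W (\<lambda>k. ennreal (Re (c k)))))"
      by (simp only: D(1))
    then show ?thesis by (simp add: nn_integral_add_measure gP gQ gW)
  qed
  then have R1: "measure S1 B = measure ?D B + (\<integral>k. indicator B k * Re (c k) \<partial>lborel)"
    unfolding measure_def real_lebesgue_integral_def[OF iR] by (rule enn2real_add_eq[OF _ eS eD nf(1)[OF iR] nf(2)[OF iR]])
  have "(\<integral>\<^sup>+k. ennreal (indicator B k * Im (c k)) \<partial>lborel) = (\<integral>\<^sup>+k. ennreal (- (indicator B k * Im (c k))) \<partial>lborel)"
    using arg_cong[OF D(2), of "\<lambda>W. \<integral>\<^sup>+k. ?g k \<partial>W"] by (simp add: gW)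
  then have I0: "(\<integral>k. indicator B k * Im (c k) \<partial>lborel) = 0"
    unfolding real_lebesgue_integral_def[OF iI] by simp
  have ic: "integrable lborel (\<lambda>k. indicat_real B k *\<^sub>R (fourier_measure E1 k - fourier_measure E2 k))"
  proof (rule Bochner_Integration.integrable_bound)
    show "integrable lborel (\<lambda>k. indicator B k * C)"
      using emeasure_bounded_finite[OF bB] by (simp add: integrable_indicator_iff)
    show "AE k in lborel. norm (indicat_real B k *\<^sub>R (fourier_measure E1 k - fourier_measure E2 k)) \<le> norm (indicator B k * C)"
      using cC by (intro AE_I2) (auto simp: c_def split: split_indicator simp del: complex_cnj_diff intro: order_trans[OF _ abs_ge_self])
  qed measurable
  \<comment> \<open>\<open>c\<close> is the conjugate of this integrand. Its imaginary part
    integrates to 0 over B, so the difference in sign disappears.\<close>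
  have "(LINT k:B|lborel. fourier_measure E1 k - fourier_measure E2 k) = complex_of_real (\<integral>k. indicator B k * Re (c k) \<partial>lborel)"
  proof (rule complex_eqI)
    show "Re (LINT k:B|lborel. fourier_measure E1 k - fourier_measure E2 k) = Re (complex_of_real (\<integral>k. indicator B k * Re (c k) \<partial>lborel))"
      unfolding set_lebesgue_integral_def by (subst integral_Re[OF ic, symmetric]) (simp add: c_def)
    have "Im (LINT k:B|lborel. fourier_measure E1 k - fourier_measure E2 k) = - (\<integral>k. indicator B k * Im (c k) \<partial>lborel)"
      unfolding set_lebesgue_integral_def by (subst integral_Im[OF ic, symmetric], subst integral_minus[symmetric]) (simp add: c_def right_diff_distrib)
    then show "Im (LINT k:B|lborel. fourier_measure E1 k - fourier_measure E2 k) = Im (complex_of_real (\<integral>k. indicator B k * Re (c k) \<partial>lborel))"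
      by (simp add: I0)
  qed
  then show ?thesis by (simp add: R1)
qed

section \<open>Palm calculus for stationary random measures\<close>

lemma sigma_finite_locally_finite:
  fixes \<mu> :: "(real^'d) measure"
  assumes "locally_finite \<mu>"
  shows "sigma_finite_measure \<mu>"
proof
  have s: "sets \<mu> = sets borel" using assms by (simp add: locally_finite_def)
  have "(\<Union>n::nat. cball (0::real^'d) (real n)) = UNIV" by (auto intro: real_arch_simple)
  then show "\<exists>A. countable A \<and> A \<subseteq> sets \<mu> \<and> \<Union> A = space \<mu> \<and> (\<forall>a\<in>A. emeasure \<mu> a \<noteq> \<infinity>)"
    using assms s
    by (intro exI[of _ "range (\<lambda>n::nat. cball 0 (real n))"])
       (auto simp: locally_finite_def sets_eq_imp_space_eq[OF s] less_top)
qed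

lemma emeasure_lborel_unit_cbox: "emeasure lborel (cbox 0 (1 :: real^'d)) = 1"
proof -
  have "(1 :: real^'d) \<bullet> b = 1" if "b \<in> Basis" for b using that by (auto simp: Basis_vec_def inner_axis)
  then show ?thesis by (simp add: emeasure_lborel_cbox_eq)
qed

locale stationary_random_measure =
  fixes M :: "'w measure"
    and \<theta> :: "real^'d \<Rightarrow> 'w \<Rightarrow> 'w"
    and \<Phi> :: "'w \<Rightarrow> (real^'d) measure"
    and P2 :: "real^'d \<Rightarrow> 'w measure"
  assumes prob: "prob_space M"
    and flow: "measurable_flow M \<theta>"
    and stat: "flow_stationary M \<theta>"
    and rm: "random_measure M \<Phi>"
    and inv: "invariant_measure M \<theta> \<Phi>"
    and lsi: "locally_square_integrable M \<Phi>"
    and ipos: "0 < intensity M \<Phi>" and ifin: "intensity M \<Phi> < \<infinity>"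
    and tpp: "two_point_palm M \<theta> \<Phi> P2"
begin

sublocale prob_space M by (rule prob)

lemma measurable_\<theta> [measurable (raw)]:
  assumes "f \<in> N \<rightarrow>\<^sub>M M" "g \<in> N \<rightarrow>\<^sub>M borel"
  shows "(\<lambda>s. \<theta> (g s) (f s)) \<in> N \<rightarrow>\<^sub>M M"
proof -
  have "(\<lambda>(\<omega>, x). \<theta> x \<omega>) \<in> (M \<Otimes>\<^sub>M borel) \<rightarrow>\<^sub>M M" using flow by (simp add: measurable_flow_def)
  from measurable_compose[OF measurable_Pair[OF assms] this] show ?thesis by simp
qed

lemma \<theta>_space: "\<omega> \<in> space M \<Longrightarrow> \<theta> x \<omega> \<in> space M"
  by (rule measurable_space[of "\<theta> x" M M]) simp_all

lemma \<theta>_0: "\<omega> \<in> space M \<Longrightarrow> \<theta> 0 \<omega> = \<omega>"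
  and \<theta>_\<theta>: "\<omega> \<in> space M \<Longrightarrow> \<theta> x (\<theta> y \<omega>) = \<theta> (x + y) \<omega>"
  using flow by (auto simp: measurable_flow_def)

text \<open>Stationarity is given for images of sets, whereas a push-forward needs preimages. The
  flow is a group action, so the preimage under \<open>\<theta> x\<close> is the image under
  \<open>\<theta> (- x)\<close>.\<close>

lemma distr_\<theta>: "distr M M (\<theta> x) = M"
proof (rule measure_eqI)
  fix A assume "A \<in> sets (distr M M (\<theta> x))"
  then have A: "A \<in> sets M" by simp
  have "\<theta> x -` A \<inter> space M = \<theta> (- x) ` A"
  proof (intro set_eqI iffI)
    fix \<omega> assume "\<omega> \<in> \<theta> x -` A \<inter> space M"
    then show "\<omega> \<in> \<theta> (- x) ` A" by (intro image_eqI[of _ _ "\<theta> x \<omega>"]) (auto simp: \<theta>_\<theta> \<theta>_0)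
  next
    fix \<omega> assume "\<omega> \<in> \<theta> (- x) ` A"
    then show "\<omega> \<in> \<theta> x -` A \<inter> space M"
      using sets.sets_into_space[OF A] by (auto simp: \<theta>_\<theta> \<theta>_0 \<theta>_space subset_iff)
  qed
  then show "emeasure (distr M M (\<theta> x)) A = emeasure M A"
    using stat A by (simp add: emeasure_distr flow_stationary_def)
qed simp

lemma nn_integral_\<theta>: "f \<in> borel_measurable M \<Longrightarrow> (\<integral>\<^sup>+\<omega>. f (\<theta> x \<omega>) \<partial>M) = (\<integral>\<^sup>+\<omega>. f \<omega> \<partial>M)"
  using nn_integral_distr[of "\<theta> x" M M f] by (simp add: distr_\<theta>)

lemma locally_finite_\<Phi>: "\<omega> \<in> space M \<Longrightarrow> locally_finite (\<Phi> \<omega>)"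
  and measurable_emeasure_\<Phi> [measurable]: "B \<in> sets borel \<Longrightarrow> (\<lambda>\<omega>. emeasure (\<Phi> \<omega>) B) \<in> borel_measurable M"
  using rm by (auto simp: random_measure_def)

lemma sets_\<Phi>: "\<omega> \<in> space M \<Longrightarrow> sets (\<Phi> \<omega>) = sets borel"
  using locally_finite_\<Phi> by (simp add: locally_finite_def)

lemma space_\<Phi>: "\<omega> \<in> space M \<Longrightarrow> space (\<Phi> \<omega>) = UNIV"
  by (simp add: sets_eq_imp_space_eq[OF sets_\<Phi>])

lemma measurable_\<Phi>_cong: "\<omega> \<in> space M \<Longrightarrow> f \<in> \<Phi> \<omega> \<rightarrow>\<^sub>M N \<longleftrightarrow> f \<in> borel \<rightarrow>\<^sub>M N"
  by (rule arg_cong[OF measurable_cong_sets[OF sets_\<Phi> refl]])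

lemma sigma_finite_\<Phi>: "\<omega> \<in> space M \<Longrightarrow> sigma_finite_measure (\<Phi> \<omega>)"
  by (intro sigma_finite_locally_finite locally_finite_\<Phi>)

lemma measurable_nn_integral_\<Phi>:
  assumes "g \<in> N \<rightarrow>\<^sub>M M" "(\<lambda>(s, x). f s x) \<in> borel_measurable (N \<Otimes>\<^sub>M borel)"
  shows "(\<lambda>s. \<integral>\<^sup>+x. f s x \<partial>\<Phi> (g s)) \<in> borel_measurable N"
proof -
  have "(\<lambda>s. \<integral>\<^sup>+x. (\<lambda>(s, x). f s x) (s, x) \<partial>\<Phi> (g s)) \<in> borel_measurable N"
  proof (rule measurable_nn_integral_locally_finite)
    fix s assume "s \<in> space N"
    then show "locally_finite (\<Phi> (g s))" by (rule locally_finite_\<Phi>[OF measurable_space[OF assms(1)]])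
  next
    fix B :: "(real^'d) set" assume "B \<in> sets borel"
    then show "(\<lambda>s. emeasure (\<Phi> (g s)) B) \<in> borel_measurable N"
      by (rule measurable_compose[OF assms(1) measurable_emeasure_\<Phi>])
  qed (rule assms(2))
  then show ?thesis by simp
qed

lemma nn_integral_\<Phi>_shift:
  assumes \<omega>: "\<omega> \<in> space M" and [measurable]: "f \<in> borel_measurable borel"
  shows "(\<integral>\<^sup>+x. f x \<partial>\<Phi> (\<theta> z \<omega>)) = (\<integral>\<^sup>+x. f (x - z) \<partial>\<Phi> \<omega>)"
proof -
  note [measurable_cong] = sets_\<Phi>[OF \<omega>]
  have "\<Phi> (\<theta> z \<omega>) = distr (\<Phi> \<omega>) borel (\<lambda>x. x - z)"
  proof (rule measure_eqI)
    fix B assume "B \<in> sets (\<Phi> (\<theta> z \<omega>))"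
    then have B: "B \<in> sets borel" using sets_\<Phi>[OF \<theta>_space[OF \<omega>]] by simp
    have "(\<lambda>x. x - z) -` B = (\<lambda>y. y + z) ` B" by (auto intro: image_eqI[of _ _ "_ - z"])
    then show "emeasure (\<Phi> (\<theta> z \<omega>)) B = emeasure (distr (\<Phi> \<omega>) borel (\<lambda>x. x - z)) B"
      using inv \<omega> B by (simp add: emeasure_distr space_\<Phi> invariant_measure_def)
  qed (simp add: sets_\<Phi> \<omega> \<theta>_space)
  then show ?thesis by (simp add: nn_integral_distr)
qed

section \<open>Palm measure and Campbell's formula\<close>

abbreviation "\<gamma> \<equiv> intensity M \<Phi>"

lemma \<gamma>_inverse: "\<gamma> * inverse \<gamma> = 1"
  using ipos ifin by (simp flip: divide_ennreal_def)

lemma sets_palm [simp, measurable_cong]: "sets (palm M \<theta> \<Phi>) = sets M"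
  and space_palm [simp]: "space (palm M \<theta> \<Phi>) = space M"
  by (simp_all add: palm_def)

text \<open>A \<open>measure_of\<close> takes its prescribed values only once the set function is
  countably additive; here that is the exchange of a series with both integrals.\<close>

lemma emeasure_palm:
  assumes A: "A \<in> sets M"
  shows "emeasure (palm M \<theta> \<Phi>) A = inverse \<gamma> *
    (\<integral>\<^sup>+\<omega>. (\<integral>\<^sup>+x. indicator A (\<theta> x \<omega>) * indicator (cbox 0 1) x \<partial>\<Phi> \<omega>) \<partial>M)"
  unfolding palm_def
proof (rule emeasure_measure_of_sigma[OF _ _ _ A])
  show "sigma_algebra (space M) (sets M)" ..
  show "countably_additive (sets M) (\<lambda>A. inverse \<gamma> * (\<integral>\<^sup>+\<omega>. (\<integral>\<^sup>+x. indicator A (\<theta> x \<omega>) * indicator (cbox 0 1) x \<partial>\<Phi> \<omega>) \<partial>M))"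
  proof (rule countably_additiveI)
    fix A :: "nat \<Rightarrow> 'w set" assume A: "range A \<subseteq> sets M" "disjoint_family A" "\<Union>(range A) \<in> sets M"
    have [measurable]: "A i \<in> sets M" for i using A by auto
    have "(\<Sum>i. \<integral>\<^sup>+\<omega>. (\<integral>\<^sup>+x. indicator (A i) (\<theta> x \<omega>) * indicator (cbox 0 1) x \<partial>\<Phi> \<omega>) \<partial>M) =
        (\<integral>\<^sup>+\<omega>. (\<Sum>i. \<integral>\<^sup>+x. indicator (A i) (\<theta> x \<omega>) * indicator (cbox 0 1) x \<partial>\<Phi> \<omega>) \<partial>M)"
      by (rule nn_integral_suminf[symmetric]) (auto intro!: measurable_nn_integral_\<Phi>)
    also have "\<dots> = (\<integral>\<^sup>+\<omega>. (\<integral>\<^sup>+x. indicator (\<Union>i. A i) (\<theta> x \<omega>) * indicator (cbox 0 1) x \<partial>\<Phi> \<omega>) \<partial>M)"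
    proof (rule nn_integral_cong)
      fix \<omega> assume \<omega>: "\<omega> \<in> space M"
      note [measurable_cong] = sets_\<Phi>[OF \<omega>]
      have [measurable]: "(\<lambda>x. \<theta> x \<omega>) \<in> borel \<rightarrow>\<^sub>M M" using \<omega> by measurable
      have "(\<Sum>i. \<integral>\<^sup>+x. indicator (A i) (\<theta> x \<omega>) * indicator (cbox 0 1) x \<partial>\<Phi> \<omega>) =
          (\<integral>\<^sup>+x. (\<Sum>i. indicator (A i) (\<theta> x \<omega>) * indicator (cbox 0 1) x) \<partial>\<Phi> \<omega>)"
        by (rule nn_integral_suminf[symmetric]) measurable
      also have "\<dots> = (\<integral>\<^sup>+x. indicator (\<Union>i. A i) (\<theta> x \<omega>) * indicator (cbox 0 1) x \<partial>\<Phi> \<omega>)"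
        using A(2) by (simp add: suminf_indicator)
      finally show "(\<Sum>i. \<integral>\<^sup>+x. indicator (A i) (\<theta> x \<omega>) * indicator (cbox 0 1) x \<partial>\<Phi> \<omega>) =
          (\<integral>\<^sup>+x. indicator (\<Union>i. A i) (\<theta> x \<omega>) * indicator (cbox 0 1) x \<partial>\<Phi> \<omega>)" .
    qed
    finally show "(\<Sum>i. inverse \<gamma> * (\<integral>\<^sup>+\<omega>. (\<integral>\<^sup>+x. indicator (A i) (\<theta> x \<omega>) * indicator (cbox 0 1) x \<partial>\<Phi> \<omega>) \<partial>M)) =
        inverse \<gamma> * (\<integral>\<^sup>+\<omega>. (\<integral>\<^sup>+x. indicator (\<Union>i. A i) (\<theta> x \<omega>) * indicator (cbox 0 1) x \<partial>\<Phi> \<omega>) \<partial>M)"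
      by simp
  qed
qed (simp add: positive_def)

lemma nn_integral_palm:
  assumes "f \<in> borel_measurable M"
  shows "(\<integral>\<^sup>+\<omega>. f \<omega> \<partial>palm M \<theta> \<Phi>) = inverse \<gamma> *
    (\<integral>\<^sup>+\<omega>. (\<integral>\<^sup>+x. f (\<theta> x \<omega>) * indicator (cbox 0 1) x \<partial>\<Phi> \<omega>) \<partial>M)"
  using assms
proof (induction rule: borel_measurable_induct)
  case (cong f g)
  have "(\<integral>\<^sup>+\<omega>. f \<omega> \<partial>palm M \<theta> \<Phi>) = (\<integral>\<^sup>+\<omega>. g \<omega> \<partial>palm M \<theta> \<Phi>)"
    using cong(3) by (intro nn_integral_cong) auto
  moreover have "(\<integral>\<^sup>+\<omega>. (\<integral>\<^sup>+x. f (\<theta> x \<omega>) * indicator (cbox 0 1) x \<partial>\<Phi> \<omega>) \<partial>M) =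
      (\<integral>\<^sup>+\<omega>. (\<integral>\<^sup>+x. g (\<theta> x \<omega>) * indicator (cbox 0 1) x \<partial>\<Phi> \<omega>) \<partial>M)"
    using cong(3) by (intro nn_integral_cong) (simp add: \<theta>_space)
  ultimately show ?case using cong(4) by simp
next
  case (set A)
  then show ?case by (simp add: emeasure_palm)
next
  case (mult u c)
  note [measurable] = mult(2)
  have "(\<integral>\<^sup>+\<omega>. (\<integral>\<^sup>+x. c * u (\<theta> x \<omega>) * indicator (cbox 0 1) x \<partial>\<Phi> \<omega>) \<partial>M) =
      (\<integral>\<^sup>+\<omega>. c * (\<integral>\<^sup>+x. u (\<theta> x \<omega>) * indicator (cbox 0 1) x \<partial>\<Phi> \<omega>) \<partial>M)"
    by (intro nn_integral_cong) (simp add: mult.assoc nn_integral_cmult measurable_\<Phi>_cong)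
  also have "\<dots> = c * (\<integral>\<^sup>+\<omega>. (\<integral>\<^sup>+x. u (\<theta> x \<omega>) * indicator (cbox 0 1) x \<partial>\<Phi> \<omega>) \<partial>M)"
    by (rule nn_integral_cmult) (auto intro!: measurable_nn_integral_\<Phi>)
  finally show ?case using mult by (simp add: nn_integral_cmult mult.left_commute)
next
  case (add u v)
  have [measurable]: "u \<in> borel_measurable M" "v \<in> borel_measurable M" using add by auto
  have "(\<integral>\<^sup>+\<omega>. (\<integral>\<^sup>+x. (v (\<theta> x \<omega>) + u (\<theta> x \<omega>)) * indicator (cbox 0 1) x \<partial>\<Phi> \<omega>) \<partial>M) =
      (\<integral>\<^sup>+\<omega>. (\<integral>\<^sup>+x. v (\<theta> x \<omega>) * indicator (cbox 0 1) x \<partial>\<Phi> \<omega>) + (\<integral>\<^sup>+x. u (\<theta> x \<omega>) * indicator (cbox 0 1) x \<partial>\<Phi> \<omega>) \<partial>M)"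
  proof (rule nn_integral_cong)
    fix \<omega> assume \<omega>: "\<omega> \<in> space M"
    note [measurable_cong] = sets_\<Phi>[OF \<omega>]
    have [measurable]: "(\<lambda>x. \<theta> x \<omega>) \<in> borel \<rightarrow>\<^sub>M M" using \<omega> by measurable
    show "(\<integral>\<^sup>+x. (v (\<theta> x \<omega>) + u (\<theta> x \<omega>)) * indicator (cbox 0 1) x \<partial>\<Phi> \<omega>) =
        (\<integral>\<^sup>+x. v (\<theta> x \<omega>) * indicator (cbox 0 1) x \<partial>\<Phi> \<omega>) + (\<integral>\<^sup>+x. u (\<theta> x \<omega>) * indicator (cbox 0 1) x \<partial>\<Phi> \<omega>)"
      unfolding distrib_right by (rule nn_integral_add) measurable
  qed
  also have "\<dots> = (\<integral>\<^sup>+\<omega>. (\<integral>\<^sup>+x. v (\<theta> x \<omega>) * indicator (cbox 0 1) x \<partial>\<Phi> \<omega>) \<partial>M) +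
      (\<integral>\<^sup>+\<omega>. (\<integral>\<^sup>+x. u (\<theta> x \<omega>) * indicator (cbox 0 1) x \<partial>\<Phi> \<omega>) \<partial>M)"
    by (rule nn_integral_add) (auto intro!: measurable_nn_integral_\<Phi>)
  finally show ?case using add by (simp add: nn_integral_add distrib_left)
next
  case (seq U)
  note [measurable] = seq(1)
  have S: "(SUP i. U i) x = (SUP i. U i x)" for x by (simp add: image_comp)
  have inc: "U i x \<le> U j x" if "i \<le> j" for i j x using seq(3) that by (auto simp: incseq_def le_fun_def)
  have "(\<integral>\<^sup>+\<omega>. (\<integral>\<^sup>+x. (SUP i. U i (\<theta> x \<omega>)) * indicator (cbox 0 1) x \<partial>\<Phi> \<omega>) \<partial>M) =
      (\<integral>\<^sup>+\<omega>. (SUP i. \<integral>\<^sup>+x. U i (\<theta> x \<omega>) * indicator (cbox 0 1) x \<partial>\<Phi> \<omega>) \<partial>M)"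
  proof (rule nn_integral_cong)
    fix \<omega> assume \<omega>: "\<omega> \<in> space M"
    have "(SUP i. U i (\<theta> x \<omega>)) * indicator (cbox 0 1) x = (SUP i. U i (\<theta> x \<omega>) * indicator (cbox 0 1) x)" for x
      by (rule SUP_mult_right_ennreal)
    moreover have "(\<integral>\<^sup>+x. (SUP i. U i (\<theta> x \<omega>) * indicator (cbox 0 1) x) \<partial>\<Phi> \<omega>) =
        (SUP i. \<integral>\<^sup>+x. U i (\<theta> x \<omega>) * indicator (cbox 0 1) x \<partial>\<Phi> \<omega>)"
      using \<omega> by (intro nn_integral_monotone_convergence_SUP)
        (auto simp: measurable_\<Phi>_cong incseq_def le_fun_def intro!: mult_right_mono inc)
    ultimately show "(\<integral>\<^sup>+x. (SUP i. U i (\<theta> x \<omega>)) * indicator (cbox 0 1) x \<partial>\<Phi> \<omega>) =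
        (SUP i. \<integral>\<^sup>+x. U i (\<theta> x \<omega>) * indicator (cbox 0 1) x \<partial>\<Phi> \<omega>)" by simp
  qed
  also have "\<dots> = (SUP i. \<integral>\<^sup>+\<omega>. \<integral>\<^sup>+x. U i (\<theta> x \<omega>) * indicator (cbox 0 1) x \<partial>\<Phi> \<omega> \<partial>M)"
    by (rule nn_integral_monotone_convergence_SUP)
       (auto simp: incseq_def le_fun_def intro!: measurable_nn_integral_\<Phi> nn_integral_mono mult_right_mono inc)
  finally show ?case
    unfolding S using seq by (simp add: nn_integral_monotone_convergence_SUP SUP_mult_left_ennreal)
qed

lemma prob_space_palm: "prob_space (palm M \<theta> \<Phi>)"
proof
  have "emeasure (palm M \<theta> \<Phi>) (space M) = inverse \<gamma> * (\<integral>\<^sup>+\<omega>. emeasure (\<Phi> \<omega>) (cbox 0 1) \<partial>M)"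
    unfolding emeasure_palm[OF sets.top]
    by (intro arg_cong2[where f="(*)"] refl nn_integral_cong) (simp add: \<theta>_space sets_\<Phi>)
  also have "\<dots> = 1" using \<gamma>_inverse by (simp add: intensity_def mult.commute)
  finally show "emeasure (palm M \<theta> \<Phi>) (space (palm M \<theta> \<Phi>)) = 1" by simp
qed

text \<open>The refined Campbell theorem, which frees the Palm measure from the unit cube of its
  definition. After substituting x - z for z, stationarity under \<open>\<theta> z\<close> moves the
  shift from \<open>f\<close> onto the cube, and the cube, having volume 1, is integrated out over
  z.\<close>

lemma campbell:
  assumes [measurable]: "(\<lambda>(x, \<omega>). f x \<omega>) \<in> borel_measurable (borel \<Otimes>\<^sub>M M)"
  shows "(\<integral>\<^sup>+\<omega>. (\<integral>\<^sup>+x. f x (\<theta> x \<omega>) \<partial>\<Phi> \<omega>) \<partial>M) =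
    \<gamma> * (\<integral>\<^sup>+\<omega>. (\<integral>\<^sup>+x. f x \<omega> \<partial>lborel) \<partial>palm M \<theta> \<Phi>)"
proof -
  interpret pair_sigma_finite M "lborel :: (real^'d) measure" ..
  have "\<gamma> * (\<integral>\<^sup>+\<omega>. (\<integral>\<^sup>+z. f z \<omega> \<partial>lborel) \<partial>palm M \<theta> \<Phi>) =
      (\<integral>\<^sup>+\<omega>. (\<integral>\<^sup>+x. (\<integral>\<^sup>+z. f z (\<theta> x \<omega>) \<partial>lborel) * indicator (cbox 0 1) x \<partial>\<Phi> \<omega>) \<partial>M)"
    by (subst nn_integral_palm) (auto simp: mult.assoc[symmetric] \<gamma>_inverse)
  also have "\<dots> = (\<integral>\<^sup>+\<omega>. (\<integral>\<^sup>+z. (\<integral>\<^sup>+x. f (x - z) (\<theta> x \<omega>) * indicator (cbox 0 1) x \<partial>\<Phi> \<omega>) \<partial>lborel) \<partial>M)"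
  proof (rule nn_integral_cong)
    fix \<omega> assume \<omega>: "\<omega> \<in> space M"
    note [measurable_cong] = sets_\<Phi>[OF \<omega>]
    interpret S: sigma_finite_measure "\<Phi> \<omega>" by (rule sigma_finite_\<Phi>[OF \<omega>])
    interpret P: pair_sigma_finite "\<Phi> \<omega>" "lborel :: (real^'d) measure" ..
    have [measurable]: "(\<lambda>x. \<theta> x \<omega>) \<in> borel \<rightarrow>\<^sub>M M" using \<omega> by measurable
    have "(\<integral>\<^sup>+z. f z (\<theta> x \<omega>) \<partial>lborel) * indicator (cbox 0 1) x = (\<integral>\<^sup>+z. f (x - z) (\<theta> x \<omega>) * indicator (cbox 0 1) x \<partial>lborel)" for x
    proof -
      have [measurable]: "(\<lambda>z. f z (\<theta> x \<omega>)) \<in> borel_measurable borel" using \<theta>_space[OF \<omega>] by measurable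
      have "(\<integral>\<^sup>+z. f z (\<theta> x \<omega>) \<partial>lborel) = (\<integral>\<^sup>+z. f (x - z) (\<theta> x \<omega>) \<partial>lborel)"
        by (subst lborel_affine[of "-1" x], simp, subst nn_integral_density, simp_all, subst nn_integral_distr) auto
      then show ?thesis by (simp add: nn_integral_multc)
    qed
    then show "(\<integral>\<^sup>+x. (\<integral>\<^sup>+z. f z (\<theta> x \<omega>) \<partial>lborel) * indicator (cbox 0 1) x \<partial>\<Phi> \<omega>) =
        (\<integral>\<^sup>+z. (\<integral>\<^sup>+x. f (x - z) (\<theta> x \<omega>) * indicator (cbox 0 1) x \<partial>\<Phi> \<omega>) \<partial>lborel)"
      by (simp only:) (rule P.Fubini'[symmetric], measurable)
  qed
  also have "\<dots> = (\<integral>\<^sup>+z. (\<integral>\<^sup>+\<omega>. (\<integral>\<^sup>+x. f (x - z) (\<theta> x \<omega>) * indicator (cbox 0 1) x \<partial>\<Phi> \<omega>) \<partial>M) \<partial>lborel)"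
    by (rule Fubini'[symmetric]) (unfold case_prod_beta, rule measurable_nn_integral_\<Phi>, measurable)
  also have "\<dots> = (\<integral>\<^sup>+z. (\<integral>\<^sup>+\<omega>. (\<integral>\<^sup>+x. f x (\<theta> x \<omega>) * indicator (cbox 0 1) (x + z) \<partial>\<Phi> \<omega>) \<partial>M) \<partial>lborel)"
  proof (rule nn_integral_cong)
    fix z :: "real^'d"
    let ?h = "\<lambda>\<omega>. \<integral>\<^sup>+x. f x (\<theta> x \<omega>) * indicator (cbox 0 1) (x + z) \<partial>\<Phi> \<omega>"
    have "?h \<in> borel_measurable M" by (intro measurable_nn_integral_\<Phi>) auto
    then have "(\<integral>\<^sup>+\<omega>. ?h \<omega> \<partial>M) = (\<integral>\<^sup>+\<omega>. ?h (\<theta> z \<omega>) \<partial>M)" by (rule nn_integral_\<theta>[symmetric])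
    also have "\<dots> = (\<integral>\<^sup>+\<omega>. (\<integral>\<^sup>+x. f (x - z) (\<theta> x \<omega>) * indicator (cbox 0 1) x \<partial>\<Phi> \<omega>) \<partial>M)"
    proof (rule nn_integral_cong)
      fix \<omega> assume \<omega>: "\<omega> \<in> space M"
      have [measurable]: "(\<lambda>x. \<theta> x (\<theta> z \<omega>)) \<in> borel \<rightarrow>\<^sub>M M" using \<theta>_space[OF \<omega>] by measurable
      show "?h (\<theta> z \<omega>) = (\<integral>\<^sup>+x. f (x - z) (\<theta> x \<omega>) * indicator (cbox 0 1) x \<partial>\<Phi> \<omega>)"
        using \<omega> by (subst nn_integral_\<Phi>_shift) (auto simp: \<theta>_\<theta>)
    qed
    finally show "(\<integral>\<^sup>+\<omega>. (\<integral>\<^sup>+x. f (x - z) (\<theta> x \<omega>) * indicator (cbox 0 1) x \<partial>\<Phi> \<omega>) \<partial>M) = (\<integral>\<^sup>+\<omega>. ?h \<omega> \<partial>M)" ..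
  qed
  also have "\<dots> = (\<integral>\<^sup>+\<omega>. (\<integral>\<^sup>+z. (\<integral>\<^sup>+x. f x (\<theta> x \<omega>) * indicator (cbox 0 1) (x + z) \<partial>\<Phi> \<omega>) \<partial>lborel) \<partial>M)"
    by (rule Fubini') (unfold case_prod_beta, rule measurable_nn_integral_\<Phi>, measurable)
  also have "\<dots> = (\<integral>\<^sup>+\<omega>. (\<integral>\<^sup>+x. f x (\<theta> x \<omega>) \<partial>\<Phi> \<omega>) \<partial>M)"
  proof (rule nn_integral_cong)
    fix \<omega> assume \<omega>: "\<omega> \<in> space M"
    note [measurable_cong] = sets_\<Phi>[OF \<omega>]
    interpret S: sigma_finite_measure "\<Phi> \<omega>" by (rule sigma_finite_\<Phi>[OF \<omega>])
    interpret P: pair_sigma_finite "\<Phi> \<omega>" "lborel :: (real^'d) measure" ..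
    have [measurable]: "(\<lambda>x. \<theta> x \<omega>) \<in> borel \<rightarrow>\<^sub>M M" using \<omega> by measurable
    have "(\<integral>\<^sup>+z. (\<integral>\<^sup>+x. f x (\<theta> x \<omega>) * indicator (cbox 0 1) (x + z) \<partial>\<Phi> \<omega>) \<partial>lborel) =
        (\<integral>\<^sup>+x. (\<integral>\<^sup>+z. f x (\<theta> x \<omega>) * indicator (cbox 0 1) (x + z) \<partial>lborel) \<partial>\<Phi> \<omega>)"
      by (rule P.Fubini') measurable
    also have "\<dots> = (\<integral>\<^sup>+x. f x (\<theta> x \<omega>) \<partial>\<Phi> \<omega>)"
    proof (rule nn_integral_cong)
      fix x :: "real^'d"
      have "(\<integral>\<^sup>+z. indicator (cbox 0 1) (x + z) \<partial>lborel) = (\<integral>\<^sup>+z. indicator (cbox 0 (1 :: real^'d)) z \<partial>lborel)"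
        by (subst (2) lborel_distr_plus[of x, symmetric], subst nn_integral_distr) auto
      also have "\<dots> = 1" by (simp add: emeasure_lborel_unit_cbox)
      finally show "(\<integral>\<^sup>+z. f x (\<theta> x \<omega>) * indicator (cbox 0 1) (x + z) \<partial>lborel) = f x (\<theta> x \<omega>)"
        by (simp add: nn_integral_cmult)
    qed
    finally show "(\<integral>\<^sup>+z. (\<integral>\<^sup>+x. f x (\<theta> x \<omega>) * indicator (cbox 0 1) (x + z) \<partial>\<Phi> \<omega>) \<partial>lborel) = (\<integral>\<^sup>+x. f x (\<theta> x \<omega>) \<partial>\<Phi> \<omega>)" .
  qed
  finally show ?thesis ..
qed

end

section \<open>The reduced second moment measure of \<Phi>\<close>

context stationary_random_measure
begin

abbreviation "\<alpha> \<equiv> second_moment M \<Phi>"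

lemma sets_second_moment [simp, measurable_cong]: "sets (second_moment M \<Psi>) = sets borel"
  and space_second_moment [simp]: "space (second_moment M \<Psi>) = UNIV"
  for \<Psi> :: "'w \<Rightarrow> (real^'d) measure"
  using sets.sigma_sets_eq[of "borel :: (real^'d) measure"] by (simp_all add: second_moment_def space_borel)

lemma P2_measurable [measurable]: "P2 \<in> borel \<rightarrow>\<^sub>M prob_algebra M"
  using tpp by (simp add: two_point_palm_def)

lemma sets_P2 [simp, measurable_cong]: "sets (P2 y) = sets M"
  using measurable_space[OF P2_measurable, of y] by (simp add: space_prob_algebra)

lemma space_P2 [simp]: "space (P2 y) = space M"
  by (rule sets_eq_imp_space_eq) simp

lemma prob_space_P2: "prob_space (P2 y)"
  using measurable_space[OF P2_measurable, of y] by (simp add: space_prob_algebra)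

text \<open>Each \<open>\<Phi> \<omega>\<close> is sigma-finite, so the product measure in the
  defining property may be replaced by iterated integrals.\<close>

lemma two_point_palm_iterated:
  assumes f[measurable]: "(\<lambda>(x, y, \<omega>). f x y \<omega>) \<in> borel_measurable (borel \<Otimes>\<^sub>M borel \<Otimes>\<^sub>M M)"
  shows "(\<integral>\<^sup>+\<omega>. (\<integral>\<^sup>+x. (\<integral>\<^sup>+y. f x (y - x) (\<theta> x \<omega>) \<partial>\<Phi> \<omega>) \<partial>\<Phi> \<omega>) \<partial>M) =
    (\<integral>\<^sup>+x. (\<integral>\<^sup>+y. (\<integral>\<^sup>+\<omega>. f x y \<omega> \<partial>P2 y) \<partial>\<alpha>) \<partial>lborel)"
proof -
  let ?f = "\<lambda>(x, y, \<omega>). f x y \<omega>"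
  have "(\<integral>\<^sup>+\<omega>. (\<integral>\<^sup>+(x, y). ?f (x, y - x, \<theta> x \<omega>) \<partial>(\<Phi> \<omega> \<Otimes>\<^sub>M \<Phi> \<omega>)) \<partial>M) =
      (\<integral>\<^sup>+x. (\<integral>\<^sup>+y. (\<integral>\<^sup>+\<omega>. ?f (x, y, \<omega>) \<partial>P2 y) \<partial>\<alpha>) \<partial>lborel)"
    using tpp f unfolding two_point_palm_def by blast
  moreover have "(\<integral>\<^sup>+(x, y). ?f (x, y - x, \<theta> x \<omega>) \<partial>(\<Phi> \<omega> \<Otimes>\<^sub>M \<Phi> \<omega>)) =
      (\<integral>\<^sup>+x. (\<integral>\<^sup>+y. f x (y - x) (\<theta> x \<omega>) \<partial>\<Phi> \<omega>) \<partial>\<Phi> \<omega>)" if \<omega>: "\<omega> \<in> space M" for \<omega>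
  proof -
    note [measurable_cong] = sets_\<Phi>[OF \<omega>]
    interpret S: sigma_finite_measure "\<Phi> \<omega>" by (rule sigma_finite_\<Phi>[OF \<omega>])
    have "(\<lambda>x. \<theta> x \<omega>) \<in> borel \<rightarrow>\<^sub>M M" using \<omega> by measurable
    then have [measurable]: "(\<lambda>p. \<theta> (fst p) \<omega>) \<in> \<Phi> \<omega> \<Otimes>\<^sub>M \<Phi> \<omega> \<rightarrow>\<^sub>M M" by measurable
    have "(\<lambda>p. ?f (fst p, snd p - fst p, \<theta> (fst p) \<omega>)) \<in> borel_measurable (\<Phi> \<omega> \<Otimes>\<^sub>M \<Phi> \<omega>)"
      by (rule measurable_compose[OF _ f]) measurable
    from S.nn_integral_fst[OF this] show ?thesis by (simp add: case_prod_unfold)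
  qed
  ultimately show ?thesis by (simp cong: nn_integral_cong)
qed

text \<open>Countable additivity of the defining set function need not be checked: the two-point Palm formula
  already expresses it through the measure \<open>\<alpha>\<close>.\<close>

lemma emeasure_second_moment:
  assumes [measurable]: "B \<in> sets borel"
  shows "emeasure \<alpha> B = (\<integral>\<^sup>+\<omega>. (\<integral>\<^sup>+x. (\<integral>\<^sup>+y. indicator (cbox 0 1) x * indicator B (y - x) \<partial>\<Phi> \<omega>) \<partial>\<Phi> \<omega>) \<partial>M)"
proof -
  have "(\<integral>\<^sup>+\<omega>. (\<integral>\<^sup>+x. (\<integral>\<^sup>+y. indicator (cbox 0 1) x * indicator B (y - x) \<partial>\<Phi> \<omega>) \<partial>\<Phi> \<omega>) \<partial>M) =
      (\<integral>\<^sup>+x. (\<integral>\<^sup>+y. (\<integral>\<^sup>+\<omega>. indicator (cbox 0 (1 :: real^'d)) x * indicator B y \<partial>P2 y) \<partial>\<alpha>) \<partial>lborel)"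
    by (rule two_point_palm_iterated[of "\<lambda>x y \<omega>. indicator (cbox 0 1) x * indicator B y"]) measurable
  also have "\<dots> = (\<integral>\<^sup>+x. indicator (cbox 0 (1 :: real^'d)) x * emeasure \<alpha> B \<partial>lborel)"
    by (simp add: prob_space.emeasure_space_1[OF prob_space_P2, simplified] nn_integral_cmult)
  also have "\<dots> = emeasure \<alpha> B" by (simp add: nn_integral_multc emeasure_lborel_unit_cbox)
  finally show ?thesis ..
qed

text \<open>If x lies in the unit cube and y - x in a ball around z, then y lies in a larger ball
  around z. The product of the two masses is at most the sum of their squares, and stationarity
  moves the centre z to 0, which makes the bound uniform in z. Uniformity is what survives the
  smearing by the mean kernel.\<close>

lemma second_moment_translation_bounded:
  obtains C where "C < \<infinity>" "\<And>z. emeasure \<alpha> (cball z r) \<le> C"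
proof -
  \<comment> \<open>The radius by which the ball has to grow in order to absorb a point x of the
    unit cube.\<close>
  obtain s where s: "cbox 0 1 \<subseteq> cball (0 :: real^'d) s"
    using bounded_subset_ballD[OF bounded_cbox] ball_subset_cball by (metis subset_trans)
  let ?C = "(\<integral>\<^sup>+\<omega>. (emeasure (\<Phi> \<omega>) (cbox 0 1))\<^sup>2 \<partial>M)" and ?D = "(\<integral>\<^sup>+\<omega>. (emeasure (\<Phi> \<omega>) (cball 0 (r + s)))\<^sup>2 \<partial>M)"
  have le: "a * b \<le> a\<^sup>2 + b\<^sup>2" for a b :: ennreal
  proof -
    have "a * b \<le> max a b * max a b" by (intro mult_mono) auto
    also have "\<dots> \<le> a\<^sup>2 + b\<^sup>2" by (auto simp: max_def power2_eq_square)
    finally show ?thesis .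
  qed
  show ?thesis
  proof
    show "?C + ?D < \<infinity>" using lsi by (auto simp: locally_square_integrable_def)
    fix z :: "real^'d"
    have "emeasure \<alpha> (cball z r) \<le> (\<integral>\<^sup>+\<omega>. emeasure (\<Phi> \<omega>) (cbox 0 1) * emeasure (\<Phi> \<omega>) (cball z (r + s)) \<partial>M)"
      unfolding emeasure_second_moment[OF borel_closed[OF closed_cball]]
    proof (rule nn_integral_mono)
      fix \<omega> assume \<omega>: "\<omega> \<in> space M"
      note [measurable_cong] = sets_\<Phi>[OF \<omega>]
      have "(\<integral>\<^sup>+x. (\<integral>\<^sup>+y. indicator (cbox 0 1) x * indicator (cball z r) (y - x) \<partial>\<Phi> \<omega>) \<partial>\<Phi> \<omega>) \<le>
          (\<integral>\<^sup>+x. (\<integral>\<^sup>+y. indicator (cbox 0 1) x * indicator (cball z (r + s)) y \<partial>\<Phi> \<omega>) \<partial>\<Phi> \<omega>)"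
      proof (intro nn_integral_mono)
        fix x y :: "real^'d"
        have "y \<in> cball z (r + s)" if x: "x \<in> cbox 0 1" and y: "y - x \<in> cball z r"
        proof -
          have "norm x \<le> s" using s x by (auto simp: subset_iff)
          moreover have "norm (z - (y - x)) \<le> r" using y by (simp add: dist_norm)
          moreover have "norm (z - y) \<le> norm (z - (y - x)) + norm x"
            using norm_triangle_ineq4[of "z - (y - x)" x] by simp
          ultimately show ?thesis by (simp add: dist_norm)
        qed
        then show "(indicator (cbox 0 1) x * indicator (cball z r) (y - x) :: ennreal) \<le> indicator (cbox 0 1) x * indicator (cball z (r + s)) y"
          by (simp split: split_indicator)
      qed
      also have "\<dots> = emeasure (\<Phi> \<omega>) (cbox 0 1) * emeasure (\<Phi> \<omega>) (cball z (r + s))"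
      proof -
        have "(\<integral>\<^sup>+y. indicator (cbox 0 1) x * indicator (cball z (r + s)) y \<partial>\<Phi> \<omega>) =
            indicator (cbox 0 1) x * emeasure (\<Phi> \<omega>) (cball z (r + s))" for x :: "real^'d"
          by (rule nn_integral_cmult_indicator) (simp add: sets_\<Phi>[OF \<omega>])
        then show ?thesis by (simp add: nn_integral_multc sets_\<Phi>[OF \<omega>])
      qed
      finally show "(\<integral>\<^sup>+x. (\<integral>\<^sup>+y. indicator (cbox 0 1) x * indicator (cball z r) (y - x) \<partial>\<Phi> \<omega>) \<partial>\<Phi> \<omega>) \<le>
          emeasure (\<Phi> \<omega>) (cbox 0 1) * emeasure (\<Phi> \<omega>) (cball z (r + s))" .
    qed
    also have "\<dots> \<le> (\<integral>\<^sup>+\<omega>. (emeasure (\<Phi> \<omega>) (cbox 0 1))\<^sup>2 + (emeasure (\<Phi> \<omega>) (cball z (r + s)))\<^sup>2 \<partial>M)"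
      by (intro nn_integral_mono le)
    also have "\<dots> = ?C + (\<integral>\<^sup>+\<omega>. (emeasure (\<Phi> \<omega>) (cball z (r + s)))\<^sup>2 \<partial>M)"
      by (rule nn_integral_add) measurable
    also have "(\<integral>\<^sup>+\<omega>. (emeasure (\<Phi> \<omega>) (cball z (r + s)))\<^sup>2 \<partial>M) = (\<integral>\<^sup>+\<omega>. (emeasure (\<Phi> (\<theta> z \<omega>)) (cball 0 (r + s)))\<^sup>2 \<partial>M)"
    proof (rule nn_integral_cong)
      fix \<omega> assume \<omega>: "\<omega> \<in> space M"
      have "(\<lambda>y. y + z) ` cball 0 (r + s) = cball z (r + s)"
        by (simp add: cball_translation[symmetric] add.commute[of _ z])
      then show "(emeasure (\<Phi> \<omega>) (cball z (r + s)))\<^sup>2 = (emeasure (\<Phi> (\<theta> z \<omega>)) (cball 0 (r + s)))\<^sup>2"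
        using inv \<omega> unfolding invariant_measure_def by (metis borel_closed closed_cball)
    qed
    also have "\<dots> = ?D" by (rule nn_integral_\<theta>) measurable
    finally show "emeasure \<alpha> (cball z r) \<le> ?C + ?D" .
  qed
qed

lemma locally_finite_of_cball:
  assumes s: "sets \<mu> = sets (borel :: (real^'d) measure)" and b: "\<And>r. emeasure \<mu> (cball 0 r) < \<infinity>"
  shows "locally_finite \<mu>"
  unfolding locally_finite_def
proof (intro conjI ballI impI s)
  fix B :: "(real^'d) set" assume B: "B \<in> sets borel" "bounded B"
  obtain r where "B \<subseteq> cball 0 r" using bounded_subset_ballD[OF B(2)] ball_subset_cball by (metis subset_trans)
  then have "emeasure \<mu> B \<le> emeasure \<mu> (cball 0 r)" using s by (intro emeasure_mono) auto
  then show "emeasure \<mu> B < \<infinity>" using b[of r] by (rule le_less_trans)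
qed

lemma locally_finite_second_moment: "locally_finite \<alpha>"
proof (rule locally_finite_of_cball)
  fix r
  obtain C where "C < \<infinity>" "\<And>z. emeasure \<alpha> (cball z r) \<le> C" using second_moment_translation_bounded by blast
  then show "emeasure \<alpha> (cball 0 r) < \<infinity>" by (meson le_less_trans)
qed simp

sublocale \<alpha>: sigma_finite_measure \<alpha>
  by (rule sigma_finite_locally_finite[OF locally_finite_second_moment])

end

section \<open>Transport by an invariant kernel\<close>

locale transported_random_measure = stationary_random_measure M \<theta> \<Phi> P2
  for M :: "'w measure" and \<theta> :: "real^'d \<Rightarrow> 'w \<Rightarrow> 'w" and \<Phi> :: "'w \<Rightarrow> (real^'d) measure"
    and P2 :: "real^'d \<Rightarrow> 'w measure" +
  fixes K :: "'w \<Rightarrow> real^'d \<Rightarrow> (real^'d) measure"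
  assumes ker: "invariant_prob_kernel M \<theta> K"
begin

lemma K_measurable: "(\<lambda>(\<omega>, x). K \<omega> x) \<in> (M \<Otimes>\<^sub>M borel) \<rightarrow>\<^sub>M prob_algebra borel"
  using ker by (simp add: invariant_prob_kernel_def)

lemma K_measurable2 [measurable (raw)]:
  assumes "f \<in> N \<rightarrow>\<^sub>M M" "g \<in> N \<rightarrow>\<^sub>M borel"
  shows "(\<lambda>s. K (f s) (g s)) \<in> N \<rightarrow>\<^sub>M prob_algebra borel"
  using measurable_compose[OF measurable_Pair[OF assms] K_measurable] by simp

lemma K_space:
  assumes \<omega>: "\<omega> \<in> space M"
  shows "prob_space (K \<omega> x)" "sets (K \<omega> x) = sets borel"
  using measurable_space[OF K_measurable, of "(\<omega>, x)"] \<omega>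
  by (simp_all add: space_pair_measure space_prob_algebra)

lemma kernel_star_eq:
  assumes \<omega>: "\<omega> \<in> space M"
  shows "kernel_star K \<omega> x = K (\<theta> x \<omega>) 0"
proof (rule measure_eqI)
  fix B assume "B \<in> sets (kernel_star K \<omega> x)"
  then have B: "B \<in> sets borel" by (simp add: kernel_star_def)
  have "(\<lambda>y. y - x) -` B = (\<lambda>y. y + x) ` B" by (auto intro: image_eqI[of _ _ "_ - x"])
  then have "emeasure (kernel_star K \<omega> x) B = emeasure (K \<omega> x) ((\<lambda>y. y + x) ` B)"
    using B K_space(2)[OF \<omega>, of x]
    by (simp add: kernel_star_def emeasure_distr sets_eq_imp_space_eq[OF K_space(2)[OF \<omega>]] cong: measurable_cong_sets)
  also have "\<dots> = emeasure (K (\<theta> x \<omega>) 0) B"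
    using ker \<omega> B by (simp add: invariant_prob_kernel_def)
  finally show "emeasure (kernel_star K \<omega> x) B = emeasure (K (\<theta> x \<omega>) 0) B" .
qed (simp add: kernel_star_def K_space \<omega> \<theta>_space)

lemma kernel_star_\<theta>: "\<omega> \<in> space M \<Longrightarrow> kernel_star K (\<theta> x \<omega>) y = kernel_star K \<omega> (y + x)"
  by (simp add: kernel_star_eq \<theta>_space \<theta>_\<theta>)

lemma kernel_star_space:
  assumes "\<omega> \<in> space M"
  shows "prob_space (kernel_star K \<omega> x)" "sets (kernel_star K \<omega> x) = sets borel"
  using K_space[OF \<theta>_space[OF assms]] by (simp_all add: kernel_star_eq assms)

lemma kernel_star_measurable [measurable (raw)]:
  assumes "f \<in> N \<rightarrow>\<^sub>M M" "g \<in> N \<rightarrow>\<^sub>M borel"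
  shows "(\<lambda>s. kernel_star K (f s) (g s)) \<in> N \<rightarrow>\<^sub>M prob_algebra borel"
  using assms measurable_space[OF assms(1)] by (subst measurable_cong[OF kernel_star_eq]) auto

lemma nn_integral_K:
  assumes \<omega>: "\<omega> \<in> space M" and [measurable]: "f \<in> borel_measurable borel"
  shows "(\<integral>\<^sup>+z. f z \<partial>K \<omega> x) = (\<integral>\<^sup>+u. f (x + u) \<partial>kernel_star K \<omega> x)"
proof -
  note [measurable_cong] = K_space(2)[OF \<omega>]
  show ?thesis unfolding kernel_star_def by (subst nn_integral_distr) (auto simp: add.commute)
qed

lemma sets_transport: "\<omega> \<in> space M \<Longrightarrow> sets (transport K \<Phi> \<omega>) = sets borel"
  and nn_integral_transport: "\<omega> \<in> space M \<Longrightarrow> f \<in> borel_measurable borel \<Longrightarrow>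
    (\<integral>\<^sup>+z. f z \<partial>transport K \<Phi> \<omega>) = (\<integral>\<^sup>+x. (\<integral>\<^sup>+u. f (x + u) \<partial>kernel_star K \<omega> x) \<partial>\<Phi> \<omega>)"
proof -
  assume \<omega>: "\<omega> \<in> space M"
  note [measurable_cong] = sets_\<Phi>[OF \<omega>]
  have "K \<omega> \<in> borel \<rightarrow>\<^sub>M prob_algebra borel" using \<omega> by measurable
  then have k: "K \<omega> \<in> \<Phi> \<omega> \<rightarrow>\<^sub>M subprob_algebra borel" by (simp add: measurable_\<Phi>_cong[OF \<omega>] measurable_prob_algebraD)
  show "sets (transport K \<Phi> \<omega>) = sets borel"
    unfolding transport_def by (rule sets_bind) (use k in \<open>auto simp: space_\<Phi>[OF \<omega>] dest: sets_kernel\<close>)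
  assume f: "f \<in> borel_measurable borel"
  show "(\<integral>\<^sup>+z. f z \<partial>transport K \<Phi> \<omega>) = (\<integral>\<^sup>+x. (\<integral>\<^sup>+u. f (x + u) \<partial>kernel_star K \<omega> x) \<partial>\<Phi> \<omega>)"
    unfolding transport_def nn_integral_bind[OF f k] by (simp add: nn_integral_K[OF \<omega> f])
qed

section \<open>Second moments of the transported measure\<close>

text \<open>In the notation of the overview, \<open>pair_palm y\<close> is \<mu> at y,
  \<open>joint_palm\<close> is the measure A for K, and \<open>transported_moment\<close> is its
  image. The image is identified with the second moment measure of the transport only under local
  finiteness, so it carries a name of its own.\<close>

definition pair_palm :: "real^'d \<Rightarrow> ((real^'d) \<times> (real^'d)) measure" where
  "pair_palm y = bind (P2 y) (\<lambda>\<omega>. kernel_star K \<omega> y \<Otimes>\<^sub>M kernel_star K \<omega> 0)"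

definition joint_palm :: "((real^'d) \<times> (real^'d) \<times> (real^'d)) measure" where
  "joint_palm = bind \<alpha> (\<lambda>y. distr (pair_palm y) (borel \<Otimes>\<^sub>M borel \<Otimes>\<^sub>M borel) (Pair y))"

definition transported_moment :: "(real^'d) measure" where
  "transported_moment = distr joint_palm borel (\<lambda>(y, v, u). y + v - u)"

lemma pair_kernel_measurable [measurable (raw)]:
  assumes "f \<in> N \<rightarrow>\<^sub>M M" "g \<in> N \<rightarrow>\<^sub>M borel"
  shows "(\<lambda>s. kernel_star K (f s) (g s) \<Otimes>\<^sub>M kernel_star K (f s) 0) \<in> N \<rightarrow>\<^sub>M prob_algebra (borel \<Otimes>\<^sub>M borel)"
proof (rule measurable_prob_algebraI)
  fix s assume "s \<in> space N"
  then have "f s \<in> space M" by (rule measurable_space[OF assms(1)])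
  then interpret pair_prob_space "kernel_star K (f s) (g s)" "kernel_star K (f s) 0"
    by (simp add: pair_prob_space_def pair_sigma_finite_def kernel_star_space prob_space_imp_sigma_finite)
  show "prob_space (kernel_star K (f s) (g s) \<Otimes>\<^sub>M kernel_star K (f s) 0)" by unfold_locales
next
  show "(\<lambda>s. kernel_star K (f s) (g s) \<Otimes>\<^sub>M kernel_star K (f s) 0) \<in> N \<rightarrow>\<^sub>M subprob_algebra (borel \<Otimes>\<^sub>M borel)"
    by (intro measurable_pair_measure measurable_prob_algebraD kernel_star_measurable assms measurable_const) simp
qed

lemma pair_palm_measurable [measurable]: "pair_palm \<in> borel \<rightarrow>\<^sub>M prob_algebra (borel \<Otimes>\<^sub>M borel)"
  unfolding pair_palm_def[abs_def] by measurable

lemma sets_pair_palm [simp, measurable_cong]: "sets (pair_palm y) = sets (borel \<Otimes>\<^sub>M borel)"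
  and prob_space_pair_palm: "prob_space (pair_palm y)"
  using measurable_space[OF pair_palm_measurable, of y] by (simp_all add: space_prob_algebra)

lemma joint_kernel_measurable [measurable]:
  "(\<lambda>y. distr (pair_palm y) (borel \<Otimes>\<^sub>M borel \<Otimes>\<^sub>M borel) (Pair y)) \<in> borel \<rightarrow>\<^sub>M subprob_algebra (borel \<Otimes>\<^sub>M borel \<Otimes>\<^sub>M borel)"
  by (intro measurable_prob_algebraD measurable_distr_prob_space2[where N="borel \<Otimes>\<^sub>M borel"]) measurable

lemma sets_joint_palm [simp, measurable_cong]: "sets joint_palm = sets (borel \<Otimes>\<^sub>M borel \<Otimes>\<^sub>M borel)"
  unfolding joint_palm_def by (rule sets_bind) auto

lemma nn_integral_joint_palm:
  assumes [measurable]: "f \<in> borel_measurable (borel \<Otimes>\<^sub>M borel \<Otimes>\<^sub>M borel)"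
  shows "(\<integral>\<^sup>+p. f p \<partial>joint_palm) = (\<integral>\<^sup>+y. (\<integral>\<^sup>+p. f (y, p) \<partial>pair_palm y) \<partial>\<alpha>)"
  unfolding joint_palm_def
  by (subst nn_integral_bind[where B="borel \<Otimes>\<^sub>M borel \<Otimes>\<^sub>M borel"]) (simp_all add: nn_integral_distr)

end

lemma nn_integral_lborel_translate:
  fixes f :: "'a::euclidean_space \<Rightarrow> ennreal"
  assumes [measurable]: "f \<in> borel_measurable borel"
  shows "(\<integral>\<^sup>+x. f (x + t) \<partial>lborel) = (\<integral>\<^sup>+x. f x \<partial>lborel)"
  by (subst lborel_distr_plus[of t, symmetric], subst nn_integral_distr) (auto simp: add.commute)

context transported_random_measure
begin

lemma nn_integral_kernel_star_measurable:
  assumes "f \<in> N \<rightarrow>\<^sub>M M" "g \<in> N \<rightarrow>\<^sub>M borel" "(\<lambda>(s, u). h s u) \<in> borel_measurable (N \<Otimes>\<^sub>M borel)"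
  shows "(\<lambda>s. \<integral>\<^sup>+u. h s u \<partial>kernel_star K (f s) (g s)) \<in> borel_measurable N"
  by (rule nn_integral_measurable_subprob_algebra2[OF assms(3) measurable_prob_algebraD[OF kernel_star_measurable[OF assms(1,2)]]])

text \<open>Each \<open>pair_palm y\<close> has mass 1, so the part over a ball has the mass that
  \<alpha> gives to the ball. Sigma-finiteness lets Fubini exchange this infinite measure with
  Lebesgue measure.\<close>

sublocale joint: sigma_finite_measure joint_palm
proof
  let ?A = "\<lambda>n::nat. cball (0::real^'d) (real n) \<times> (UNIV :: ((real^'d) \<times> (real^'d)) set)"
  have "emeasure joint_palm (?A n) \<noteq> \<infinity>" for n
  proof -
    have [measurable]: "?A n \<in> sets (borel \<Otimes>\<^sub>M borel \<Otimes>\<^sub>M borel)"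
      by (intro pair_measureI) (simp_all add: sets.top[of "borel \<Otimes>\<^sub>M borel", simplified space_pair_measure, simplified])
    have "emeasure joint_palm (?A n) = (\<integral>\<^sup>+p. indicator (?A n) p \<partial>joint_palm)" by simp
    also have "\<dots> = (\<integral>\<^sup>+y. (\<integral>\<^sup>+p. indicator (?A n) (y, p) \<partial>pair_palm y) \<partial>\<alpha>)"
      by (rule nn_integral_joint_palm) measurable
    also have "\<dots> = (\<integral>\<^sup>+y. indicator (cball 0 (real n)) y \<partial>\<alpha>)"
      by (intro nn_integral_cong) (simp add: indicator_times prob_space.emeasure_space_1[OF prob_space_pair_palm])
    also have "\<dots> = emeasure \<alpha> (cball 0 (real n))" by simp
    also have "\<dots> < \<infinity>" using locally_finite_second_moment by (simp add: locally_finite_def)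
    finally show ?thesis by simp
  qed
  moreover have "(\<Union>n. ?A n) = UNIV"
  proof -
    have "\<exists>n::nat. norm x \<le> real n" for x :: "real^'d" by (rule real_arch_simple)
    then show ?thesis by auto
  qed
  moreover have "?A n \<in> sets (borel \<Otimes>\<^sub>M borel \<Otimes>\<^sub>M borel)" for n
    by (intro pair_measureI) (simp_all add: sets.top[of "borel \<Otimes>\<^sub>M borel", simplified space_pair_measure, simplified])
  moreover have "space joint_palm = UNIV"
    using sets_eq_imp_space_eq[OF sets_joint_palm] by (simp add: space_pair_measure)
  ultimately show "\<exists>A. countable A \<and> A \<subseteq> sets joint_palm \<and> \<Union> A = space joint_palm \<and> (\<forall>a\<in>A. emeasure joint_palm a \<noteq> \<infinity>)"
    by (intro exI[of _ "range ?A"]) auto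
qed

lemma sets_transported_moment [simp, measurable_cong]: "sets transported_moment = sets borel"
  by (simp add: transported_moment_def)

lemma nn_integral_pair_palm:
  assumes [measurable]: "h \<in> borel_measurable (borel \<Otimes>\<^sub>M borel)"
  shows "(\<integral>\<^sup>+p. h p \<partial>pair_palm y) =
    (\<integral>\<^sup>+\<omega>. (\<integral>\<^sup>+u. (\<integral>\<^sup>+v. h (v, u) \<partial>kernel_star K \<omega> y) \<partial>kernel_star K \<omega> 0) \<partial>P2 y)"
proof -
  have "(\<integral>\<^sup>+p. h p \<partial>pair_palm y) = (\<integral>\<^sup>+\<omega>. (\<integral>\<^sup>+p. h p \<partial>(kernel_star K \<omega> y \<Otimes>\<^sub>M kernel_star K \<omega> 0)) \<partial>P2 y)"
    unfolding pair_palm_def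
    by (rule nn_integral_bind[where B="borel \<Otimes>\<^sub>M borel"]) (simp_all add: measurable_prob_algebraD)
  also have "\<dots> = (\<integral>\<^sup>+\<omega>. (\<integral>\<^sup>+u. (\<integral>\<^sup>+v. h (v, u) \<partial>kernel_star K \<omega> y) \<partial>kernel_star K \<omega> 0) \<partial>P2 y)"
  proof (rule nn_integral_cong)
    fix \<omega> assume "\<omega> \<in> space (P2 y)"
    then have \<omega>: "\<omega> \<in> space M" by simp
    note [measurable_cong] = kernel_star_space(2)[OF \<omega>]
    interpret pair_sigma_finite "kernel_star K \<omega> y" "kernel_star K \<omega> 0"
      by (simp add: pair_sigma_finite_def kernel_star_space[OF \<omega>] prob_space_imp_sigma_finite)
    show "(\<integral>\<^sup>+p. h p \<partial>(kernel_star K \<omega> y \<Otimes>\<^sub>M kernel_star K \<omega> 0)) =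
        (\<integral>\<^sup>+u. (\<integral>\<^sup>+v. h (v, u) \<partial>kernel_star K \<omega> y) \<partial>kernel_star K \<omega> 0)"
      by (rule nn_integral_snd[symmetric]) measurable
  qed
  finally show ?thesis .
qed

text \<open>The two-point formula for \<Phi> is applied to an integrand that already contains the
  integrals over the displacements u and v. Iterated integrals are used on the left because
  sigma-finiteness of the transported measure is not known at this stage.\<close>

lemma transport_second_moment:
  assumes F[measurable]: "(\<lambda>(a, b). F a b) \<in> borel_measurable (borel \<Otimes>\<^sub>M borel)"
  shows "(\<integral>\<^sup>+\<omega>. (\<integral>\<^sup>+a. (\<integral>\<^sup>+b. F a b \<partial>transport K \<Phi> \<omega>) \<partial>transport K \<Phi> \<omega>) \<partial>M) =
    (\<integral>\<^sup>+z. (\<integral>\<^sup>+x. F x (x + z) \<partial>lborel) \<partial>transported_moment)"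
proof -
  interpret pair_sigma_finite joint_palm "lborel :: (real^'d) measure" ..
  let ?f = "\<lambda>x y \<omega>. \<integral>\<^sup>+u. (\<integral>\<^sup>+v. F (x + u) (x + y + v) \<partial>kernel_star K \<omega> y) \<partial>kernel_star K \<omega> 0"
  have f: "(\<lambda>(x, y, \<omega>). ?f x y \<omega>) \<in> borel_measurable (borel \<Otimes>\<^sub>M borel \<Otimes>\<^sub>M M)"
    unfolding case_prod_beta
  proof (rule nn_integral_kernel_star_measurable)
    show "(\<lambda>(p, u). \<integral>\<^sup>+v. F (fst p + u) (fst p + fst (snd p) + v) \<partial>kernel_star K (snd (snd p)) (fst (snd p)))
        \<in> borel_measurable ((borel \<Otimes>\<^sub>M borel \<Otimes>\<^sub>M M) \<Otimes>\<^sub>M borel)"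
      unfolding case_prod_beta by (rule nn_integral_kernel_star_measurable) measurable
  qed measurable
  have "(\<integral>\<^sup>+\<omega>. (\<integral>\<^sup>+a. (\<integral>\<^sup>+b. F a b \<partial>transport K \<Phi> \<omega>) \<partial>transport K \<Phi> \<omega>) \<partial>M) =
      (\<integral>\<^sup>+\<omega>. (\<integral>\<^sup>+x. (\<integral>\<^sup>+y. ?f x (y - x) (\<theta> x \<omega>) \<partial>\<Phi> \<omega>) \<partial>\<Phi> \<omega>) \<partial>M)"
  proof (rule nn_integral_cong)
    fix \<omega> assume \<omega>: "\<omega> \<in> space M"
    note [measurable_cong] = sets_\<Phi>[OF \<omega>] kernel_star_space(2)[OF \<omega>]
    interpret S: sigma_finite_measure "\<Phi> \<omega>" by (rule sigma_finite_\<Phi>[OF \<omega>])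
    have [measurable]: "(\<lambda>y. kernel_star K \<omega> y) \<in> borel \<rightarrow>\<^sub>M subprob_algebra borel"
      using \<omega> by (intro measurable_prob_algebraD) measurable
    have G[measurable]: "(\<lambda>(a, y). \<integral>\<^sup>+v. F a (y + v) \<partial>kernel_star K \<omega> y) \<in> borel_measurable (borel \<Otimes>\<^sub>M borel)"
      unfolding case_prod_beta
      by (intro nn_integral_measurable_subprob_algebra2[where N=borel]) measurable
    have [measurable]: "(\<lambda>a. \<integral>\<^sup>+y. (\<integral>\<^sup>+v. F a (y + v) \<partial>kernel_star K \<omega> y) \<partial>\<Phi> \<omega>) \<in> borel_measurable borel"
      by (rule S.borel_measurable_nn_integral) measurable
    have "(\<integral>\<^sup>+a. (\<integral>\<^sup>+b. F a b \<partial>transport K \<Phi> \<omega>) \<partial>transport K \<Phi> \<omega>) =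
        (\<integral>\<^sup>+a. (\<integral>\<^sup>+y. (\<integral>\<^sup>+v. F a (y + v) \<partial>kernel_star K \<omega> y) \<partial>\<Phi> \<omega>) \<partial>transport K \<Phi> \<omega>)"
      using \<omega> by (intro nn_integral_cong) (simp add: nn_integral_transport)
    also have "\<dots> = (\<integral>\<^sup>+x. (\<integral>\<^sup>+u. (\<integral>\<^sup>+y. (\<integral>\<^sup>+v. F (x + u) (y + v) \<partial>kernel_star K \<omega> y) \<partial>\<Phi> \<omega>) \<partial>kernel_star K \<omega> x) \<partial>\<Phi> \<omega>)"
      using \<omega> by (rule nn_integral_transport) measurable
    also have "\<dots> = (\<integral>\<^sup>+x. (\<integral>\<^sup>+y. (\<integral>\<^sup>+u. (\<integral>\<^sup>+v. F (x + u) (y + v) \<partial>kernel_star K \<omega> y) \<partial>kernel_star K \<omega> x) \<partial>\<Phi> \<omega>) \<partial>\<Phi> \<omega>)"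
    proof (rule nn_integral_cong)
      fix x :: "real^'d"
      interpret P: pair_sigma_finite "kernel_star K \<omega> x" "\<Phi> \<omega>"
        by (simp add: pair_sigma_finite_def S.sigma_finite_measure_axioms kernel_star_space[OF \<omega>] prob_space_imp_sigma_finite)
      have "(\<lambda>(u, y). \<integral>\<^sup>+v. F (x + u) (y + v) \<partial>kernel_star K \<omega> y) \<in> borel_measurable (borel \<Otimes>\<^sub>M borel)"
        unfolding case_prod_beta
        by (intro nn_integral_measurable_subprob_algebra2[where N=borel]) measurable
      then show "(\<integral>\<^sup>+u. (\<integral>\<^sup>+y. (\<integral>\<^sup>+v. F (x + u) (y + v) \<partial>kernel_star K \<omega> y) \<partial>\<Phi> \<omega>) \<partial>kernel_star K \<omega> x) =
          (\<integral>\<^sup>+y. (\<integral>\<^sup>+u. (\<integral>\<^sup>+v. F (x + u) (y + v) \<partial>kernel_star K \<omega> y) \<partial>kernel_star K \<omega> x) \<partial>\<Phi> \<omega>)"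
        by (intro P.Fubini'[symmetric]) measurable
    qed
    \<comment> \<open>Seen from x, the kernel at y is the kernel of
      \<open>\<theta> x \<omega>\<close> at y - x. This is the form required by the two-point Palm
      formula.\<close>
    also have "\<dots> = (\<integral>\<^sup>+x. (\<integral>\<^sup>+y. ?f x (y - x) (\<theta> x \<omega>) \<partial>\<Phi> \<omega>) \<partial>\<Phi> \<omega>)"
      by (simp add: kernel_star_\<theta>[OF \<omega>])
    finally show "(\<integral>\<^sup>+a. (\<integral>\<^sup>+b. F a b \<partial>transport K \<Phi> \<omega>) \<partial>transport K \<Phi> \<omega>) =
      (\<integral>\<^sup>+x. (\<integral>\<^sup>+y. ?f x (y - x) (\<theta> x \<omega>) \<partial>\<Phi> \<omega>) \<partial>\<Phi> \<omega>)" .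
  qed
  also have "\<dots> = (\<integral>\<^sup>+x. (\<integral>\<^sup>+y. (\<integral>\<^sup>+\<omega>. ?f x y \<omega> \<partial>P2 y) \<partial>\<alpha>) \<partial>lborel)"
    by (rule two_point_palm_iterated[OF f])
  also have "\<dots> = (\<integral>\<^sup>+x. (\<integral>\<^sup>+p. (case p of (y, v, u) \<Rightarrow> F (x + u) (x + y + v)) \<partial>joint_palm) \<partial>lborel)"
  proof (rule nn_integral_cong)
    fix x :: "real^'d"
    have m: "(\<lambda>(y, v, u). F (x + u) (x + y + v)) \<in> borel_measurable (borel \<Otimes>\<^sub>M borel \<Otimes>\<^sub>M borel)"
      by measurable
    have "(\<integral>\<^sup>+p. (case p of (y, v, u) \<Rightarrow> F (x + u) (x + y + v)) \<partial>joint_palm) =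
        (\<integral>\<^sup>+y. (\<integral>\<^sup>+p. (case p of (v, u) \<Rightarrow> F (x + u) (x + y + v)) \<partial>pair_palm y) \<partial>\<alpha>)"
      using nn_integral_joint_palm[OF m] by simp
    also have "\<dots> = (\<integral>\<^sup>+y. (\<integral>\<^sup>+\<omega>. ?f x y \<omega> \<partial>P2 y) \<partial>\<alpha>)"
    proof (rule nn_integral_cong)
      fix y :: "real^'d"
      have "(\<lambda>(v, u). F (x + u) (x + y + v)) \<in> borel_measurable (borel \<Otimes>\<^sub>M borel)" by measurable
      from nn_integral_pair_palm[OF this]
      show "(\<integral>\<^sup>+p. (case p of (v, u) \<Rightarrow> F (x + u) (x + y + v)) \<partial>pair_palm y) = (\<integral>\<^sup>+\<omega>. ?f x y \<omega> \<partial>P2 y)"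
        by simp
    qed
    finally show "(\<integral>\<^sup>+y. (\<integral>\<^sup>+\<omega>. ?f x y \<omega> \<partial>P2 y) \<partial>\<alpha>) =
        (\<integral>\<^sup>+p. (case p of (y, v, u) \<Rightarrow> F (x + u) (x + y + v)) \<partial>joint_palm)" ..
  qed
  also have "\<dots> = (\<integral>\<^sup>+p. (\<integral>\<^sup>+x. (case p of (y, v, u) \<Rightarrow> F (x + u) (x + y + v)) \<partial>lborel) \<partial>joint_palm)"
    by (rule Fubini') measurable
  \<comment> \<open>Lebesgue measure absorbs the displacement u of the first point; only the
    relative position y + v - u remains.\<close>
  also have "\<dots> = (\<integral>\<^sup>+p. (\<integral>\<^sup>+x. F x (x + (case p of (y, v, u) \<Rightarrow> y + v - u)) \<partial>lborel) \<partial>joint_palm)"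
  proof (rule nn_integral_cong)
    fix p :: "(real^'d) \<times> (real^'d) \<times> (real^'d)"
    obtain y v u where p: "p = (y, v, u)" by (cases p) auto
    have "(\<integral>\<^sup>+x. F (x + u) ((x + u) + (y + v - u)) \<partial>lborel) = (\<integral>\<^sup>+x. F x (x + (y + v - u)) \<partial>lborel)"
      by (rule nn_integral_lborel_translate[where f="\<lambda>x. F x (x + (y + v - u))"]) measurable
    then show "(\<integral>\<^sup>+x. (case p of (y, v, u) \<Rightarrow> F (x + u) (x + y + v)) \<partial>lborel) =
        (\<integral>\<^sup>+x. F x (x + (case p of (y, v, u) \<Rightarrow> y + v - u)) \<partial>lborel)"
      by (simp add: p algebra_simps)
  qed
  also have "\<dots> = (\<integral>\<^sup>+z. (\<integral>\<^sup>+x. F x (x + z) \<partial>lborel) \<partial>transported_moment)"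
    unfolding transported_moment_def by (subst nn_integral_distr) (auto intro!: lborel.borel_measurable_nn_integral)
  finally show ?thesis .
qed

lemma transport_emeasure_measurable:
  assumes B[measurable]: "B \<in> sets borel"
  shows "(\<lambda>\<omega>. emeasure (transport K \<Phi> \<omega>) B) \<in> borel_measurable M"
proof -
  have "emeasure (transport K \<Phi> \<omega>) B = (\<integral>\<^sup>+x. (\<integral>\<^sup>+u. indicator B (x + u) \<partial>kernel_star K \<omega> x) \<partial>\<Phi> \<omega>)"
    if "\<omega> \<in> space M" for \<omega>
    using nn_integral_transport[OF that, of "indicator B"] sets_transport[OF that] B by simp
  moreover have "(\<lambda>\<omega>. \<integral>\<^sup>+x. (\<integral>\<^sup>+u. indicator B (x + u) \<partial>kernel_star K \<omega> x) \<partial>\<Phi> \<omega>) \<in> borel_measurable M"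
  proof (rule measurable_nn_integral_\<Phi>)
    show "(\<lambda>(\<omega>, x). \<integral>\<^sup>+u. indicator B (x + u) \<partial>kernel_star K \<omega> x) \<in> borel_measurable (M \<Otimes>\<^sub>M borel)"
      unfolding case_prod_beta
      by (rule nn_integral_kernel_star_measurable) measurable
  qed simp
  ultimately show ?thesis by (simp cong: measurable_cong)
qed

text \<open>The second moment of the mass of B is the integral over
  \<open>transported_moment\<close> of the volume of those x for which x and x + z are both in B.
  This volume is at most that of B, and it vanishes when |z| exceeds twice the radius of a ball
  around 0 containing B.\<close>

lemma locally_square_integrable_transport:
  assumes lf: "locally_finite transported_moment"
  shows "locally_square_integrable M (transport K \<Phi>)"
  unfolding locally_square_integrable_def
proof (intro ballI impI)
  fix B :: "(real^'d) set" assume B[measurable]: "B \<in> sets borel" and bd: "bounded B"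
  obtain r where r: "B \<subseteq> ball 0 r" using bounded_subset_ballD[OF bd] by blast
  have "(\<integral>\<^sup>+\<omega>. (emeasure (transport K \<Phi> \<omega>) B)\<^sup>2 \<partial>M) =
      (\<integral>\<^sup>+\<omega>. (\<integral>\<^sup>+a. (\<integral>\<^sup>+b. indicator B a * indicator B b \<partial>transport K \<Phi> \<omega>) \<partial>transport K \<Phi> \<omega>) \<partial>M)"
  proof (rule nn_integral_cong)
    fix \<omega> assume "\<omega> \<in> space M"
    note [measurable_cong] = sets_transport[OF this]
    have "(\<integral>\<^sup>+b. indicator B a * indicator B b \<partial>transport K \<Phi> \<omega>) = indicator B a * emeasure (transport K \<Phi> \<omega>) B" for a
      by (rule nn_integral_cmult_indicator) measurable
    then show "(emeasure (transport K \<Phi> \<omega>) B)\<^sup>2 = (\<integral>\<^sup>+a. (\<integral>\<^sup>+b. indicator B a * indicator B b \<partial>transport K \<Phi> \<omega>) \<partial>transport K \<Phi> \<omega>)"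
      by (simp add: nn_integral_multc power2_eq_square)
  qed
  also have "\<dots> = (\<integral>\<^sup>+z. (\<integral>\<^sup>+x. indicator B x * indicator B (x + z) \<partial>lborel) \<partial>transported_moment)"
    by (rule transport_second_moment[where F="\<lambda>a b. indicator B a * indicator B b"]) measurable
  also have "\<dots> \<le> (\<integral>\<^sup>+z. emeasure lborel B * indicator (cball 0 (2 * r)) z \<partial>transported_moment)"
  proof (rule nn_integral_mono)
    fix z :: "real^'d"
    have "(\<integral>\<^sup>+x. indicator B x * indicator B (x + z) \<partial>lborel) \<le> (\<integral>\<^sup>+x. indicator (cball 0 (2 * r)) z * indicator B x \<partial>lborel)"
    proof (rule nn_integral_mono)
      fix x :: "real^'d"
      have "norm z \<le> 2 * r" if "x \<in> B" "x + z \<in> B"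
      proof -
        have "norm x < r" "norm (x + z) < r" using that r by (auto simp: subset_iff)
        then show ?thesis using norm_triangle_ineq4[of "x + z" x] by simp
      qed
      then show "(indicator B x * indicator B (x + z) :: ennreal) \<le> indicator (cball 0 (2 * r)) z * indicator B x"
        by (auto split: split_indicator)
    qed
    then show "(\<integral>\<^sup>+x. indicator B x * indicator B (x + z) \<partial>lborel) \<le> emeasure lborel B * indicator (cball 0 (2 * r)) z"
      by (subst (asm) nn_integral_cmult_indicator) (simp_all add: mult.commute)
  qed
  also have "\<dots> = emeasure lborel B * emeasure transported_moment (cball 0 (2 * r))"
    by (rule nn_integral_cmult_indicator) simp
  also have "\<dots> < \<infinity>"
    using lf emeasure_bounded_finite[OF bd] by (simp add: locally_finite_def ennreal_mult_less_top)
  finally show "(\<integral>\<^sup>+\<omega>. (emeasure (transport K \<Phi> \<omega>) B)\<^sup>2 \<partial>M) < \<infinity>" .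
qed

text \<open>A finite second moment makes the mass of a ball finite almost surely, and countably many
  balls suffice.\<close>

lemma AE_locally_finite_transport:
  assumes lf: "locally_finite transported_moment"
  shows "AE \<omega> in M. locally_finite (transport K \<Phi> \<omega>)"
proof -
  have "AE \<omega> in M. \<forall>n::nat. emeasure (transport K \<Phi> \<omega>) (cball 0 (real n)) \<noteq> \<infinity>"
    unfolding AE_all_countable
  proof
    fix n :: nat
    have [measurable]: "(\<lambda>\<omega>. emeasure (transport K \<Phi> \<omega>) (cball 0 (real n))) \<in> borel_measurable M"
      by (rule transport_emeasure_measurable) simp
    have "AE \<omega> in M. (emeasure (transport K \<Phi> \<omega>) (cball 0 (real n)))\<^sup>2 \<noteq> \<infinity>"
      using locally_square_integrable_transport[OF lf]
      by (intro nn_integral_PInf_AE) (auto simp: locally_square_integrable_def less_top[symmetric])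
    then show "AE \<omega> in M. emeasure (transport K \<Phi> \<omega>) (cball 0 (real n)) \<noteq> \<infinity>"
      by eventually_elim (auto simp: power2_eq_square)
  qed
  then show ?thesis
    using AE_space
  proof eventually_elim
    case (elim \<omega>)
    show ?case
    proof (rule locally_finite_of_cball[OF sets_transport[OF elim(2)]])
      fix r
      obtain n :: nat where "r \<le> real n" using real_arch_simple by blast
      then have "emeasure (transport K \<Phi> \<omega>) (cball 0 r) \<le> emeasure (transport K \<Phi> \<omega>) (cball 0 (real n))"
        using sets_transport[OF elim(2)] by (intro emeasure_mono) auto
      then show "emeasure (transport K \<Phi> \<omega>) (cball 0 r) < \<infinity>"
        using elim(1) by (auto simp: less_top[symmetric] top_unique)
    qed
  qed
qed

text \<open>Almost surely the transported measure is locally finite, so that its product with itself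
  is given by iterated integrals and \<open>transport_second_moment\<close> applies. There the
  difference of the two points is z for every x, and the cube contributes volume 1.\<close>

lemma second_moment_transport:
  assumes lf: "locally_finite transported_moment"
  shows "second_moment M (transport K \<Phi>) = transported_moment"
proof -
  have "(\<integral>\<^sup>+\<omega>. (\<integral>\<^sup>+(x, y). indicator (cbox 0 1) x * indicator B (y - x) \<partial>(transport K \<Phi> \<omega> \<Otimes>\<^sub>M transport K \<Phi> \<omega>)) \<partial>M) =
      emeasure transported_moment B" if B[measurable]: "B \<in> sets borel" for B
  proof -
    have "(\<integral>\<^sup>+\<omega>. (\<integral>\<^sup>+(x, y). indicator (cbox 0 1) x * indicator B (y - x) \<partial>(transport K \<Phi> \<omega> \<Otimes>\<^sub>M transport K \<Phi> \<omega>)) \<partial>M) =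
        (\<integral>\<^sup>+\<omega>. (\<integral>\<^sup>+a. (\<integral>\<^sup>+b. indicator (cbox 0 1) a * indicator B (b - a) \<partial>transport K \<Phi> \<omega>) \<partial>transport K \<Phi> \<omega>) \<partial>M)"
    proof (rule nn_integral_cong_AE)
      show "AE \<omega> in M. (\<integral>\<^sup>+(x, y). indicator (cbox 0 1) x * indicator B (y - x) \<partial>(transport K \<Phi> \<omega> \<Otimes>\<^sub>M transport K \<Phi> \<omega>)) =
        (\<integral>\<^sup>+a. (\<integral>\<^sup>+b. indicator (cbox 0 1) a * indicator B (b - a) \<partial>transport K \<Phi> \<omega>) \<partial>transport K \<Phi> \<omega>)"
        using AE_locally_finite_transport[OF lf] AE_space
      proof eventually_elim
        case (elim \<omega>)
        note [measurable_cong] = sets_transport[OF elim(2)]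
        interpret S: sigma_finite_measure "transport K \<Phi> \<omega>" by (rule sigma_finite_locally_finite[OF elim(1)])
        have "(\<lambda>p. indicator (cbox 0 1) (fst p) * indicator B (snd p - fst p) :: ennreal) \<in> borel_measurable (transport K \<Phi> \<omega> \<Otimes>\<^sub>M transport K \<Phi> \<omega>)"
          by measurable
        from S.nn_integral_fst[OF this] show ?case by (simp add: case_prod_unfold)
      qed
    qed
    also have "\<dots> = (\<integral>\<^sup>+z. (\<integral>\<^sup>+x. indicator (cbox 0 1) x * indicator B (x + z - x) \<partial>lborel) \<partial>transported_moment)"
      by (rule transport_second_moment[where F="\<lambda>a b. indicator (cbox 0 1) a * indicator B (b - a)"]) measurable
    also have "\<dots> = (\<integral>\<^sup>+z. indicator B z \<partial>transported_moment)"
      by (intro nn_integral_cong) (simp add: nn_integral_multc emeasure_lborel_unit_cbox)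
    finally show ?thesis by simp
  qed
  then have "second_moment M (transport K \<Phi>) = measure_of UNIV (sets borel) (emeasure transported_moment)"
    unfolding second_moment_def by (intro measure_of_eq) (auto simp: sets.sigma_sets_eq[of borel, simplified])
  also have "\<dots> = transported_moment"
    using measure_of_of_measure[of transported_moment] sets_eq_imp_space_eq[OF sets_transported_moment] by simp
  finally show ?thesis .
qed

text \<open>Campbell's formula for the mass that the kernel puts into the cube: integrating over the
  location gives 1 for each displacement u, and \<open>K \<omega> 0\<close> has total mass 1. This
  is why the \<gamma>^2 terms of \<Phi> and K\<Phi> coincide.\<close>

lemma intensity_transport: "intensity M (transport K \<Phi>) = \<gamma>"
proof -
  have m: "(\<lambda>(x, \<omega>). \<integral>\<^sup>+u. indicator (cbox 0 1) (x + u) \<partial>K \<omega> 0) \<in> borel_measurable (borel \<Otimes>\<^sub>M M)"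
    unfolding case_prod_beta
    by (intro nn_integral_measurable_subprob_algebra2[where N=borel] measurable_prob_algebraD) measurable
  have "intensity M (transport K \<Phi>) = (\<integral>\<^sup>+\<omega>. (\<integral>\<^sup>+x. (\<integral>\<^sup>+u. indicator (cbox 0 1) (x + u) \<partial>K (\<theta> x \<omega>) 0) \<partial>\<Phi> \<omega>) \<partial>M)"
    unfolding intensity_def
  proof (rule nn_integral_cong)
    fix \<omega> assume \<omega>: "\<omega> \<in> space M"
    show "emeasure (transport K \<Phi> \<omega>) (cbox 0 1) = (\<integral>\<^sup>+x. (\<integral>\<^sup>+u. indicator (cbox 0 1) (x + u) \<partial>K (\<theta> x \<omega>) 0) \<partial>\<Phi> \<omega>)"
      using nn_integral_transport[OF \<omega>, of "indicator (cbox 0 1)"] sets_transport[OF \<omega>] by (simp add: kernel_star_eq[OF \<omega>])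
  qed
  also have "\<dots> = \<gamma> * (\<integral>\<^sup>+\<omega>. (\<integral>\<^sup>+x. (\<integral>\<^sup>+u. indicator (cbox 0 1) (x + u) \<partial>K \<omega> 0) \<partial>lborel) \<partial>palm M \<theta> \<Phi>)"
    by (rule campbell[OF m])
  also have "(\<integral>\<^sup>+\<omega>. (\<integral>\<^sup>+x. (\<integral>\<^sup>+u. indicator (cbox 0 1) (x + u) \<partial>K \<omega> 0) \<partial>lborel) \<partial>palm M \<theta> \<Phi>) = (\<integral>\<^sup>+\<omega>. 1 \<partial>palm M \<theta> \<Phi>)"
  proof (rule nn_integral_cong)
    fix \<omega> assume "\<omega> \<in> space (palm M \<theta> \<Phi>)"
    then have \<omega>: "\<omega> \<in> space M" by simp
    note [measurable_cong] = K_space(2)[OF \<omega>]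
    interpret P: pair_sigma_finite "K \<omega> 0" "lborel :: (real^'d) measure"
      by (simp add: pair_sigma_finite_def K_space[OF \<omega>] prob_space_imp_sigma_finite lborel.sigma_finite_measure_axioms)
    have "(\<integral>\<^sup>+x. (\<integral>\<^sup>+u. indicator (cbox 0 1) (x + u) \<partial>K \<omega> 0) \<partial>lborel) = (\<integral>\<^sup>+u. (\<integral>\<^sup>+x. indicator (cbox 0 1) (x + u) \<partial>lborel) \<partial>K \<omega> 0)"
      by (rule P.Fubini') measurable
    also have "\<dots> = (\<integral>\<^sup>+u. 1 \<partial>K \<omega> 0)"
    proof (rule nn_integral_cong)
      fix u :: "real^'d"
      have "(\<integral>\<^sup>+x. indicator (cbox 0 1) (x + u) \<partial>lborel) = (\<integral>\<^sup>+x. indicator (cbox 0 (1 :: real^'d)) x \<partial>lborel)"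
        by (rule nn_integral_lborel_translate) measurable
      then show "(\<integral>\<^sup>+x. indicator (cbox 0 1) (x + u) \<partial>lborel) = (1 :: ennreal)"
        by (simp add: emeasure_lborel_unit_cbox)
    qed
    finally show "(\<integral>\<^sup>+x. (\<integral>\<^sup>+u. indicator (cbox 0 1) (x + u) \<partial>K \<omega> 0) \<partial>lborel) = 1"
      using K_space(1)[OF \<omega>] by (simp add: prob_space.emeasure_space_1)
  qed
  finally show ?thesis using prob_space_palm by (simp add: prob_space.emeasure_space_1[where M="palm M \<theta> \<Phi>", simplified])
qed

end

section \<open>Comparison with the mean kernel\<close>

lemma norm_integral_prob_le:
  fixes f :: "'a \<Rightarrow> 'b::{banach, second_countable_topology}"
  assumes "prob_space N" "f \<in> borel_measurable N" "\<And>x. norm (f x) \<le> B"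
  shows "norm (\<integral>x. f x \<partial>N) \<le> B"
proof -
  interpret prob_space N by fact
  have "norm (\<integral>x. f x \<partial>N) \<le> (\<integral>x. norm (f x) \<partial>N)" by (rule integral_norm_bound)
  also have "\<dots> \<le> (\<integral>x. B \<partial>N)"
    using assms by (intro integral_mono integrable_bounded[where B=B] integrable_const) auto
  finally show ?thesis by (simp add: prob_space)
qed

lemma integral_bind_complex:
  fixes f :: "'a \<Rightarrow> complex"
  assumes [measurable]: "f \<in> borel_measurable L" and b: "\<And>x. cmod (f x) \<le> B"
    and N[measurable]: "N \<in> M \<rightarrow>\<^sub>M prob_algebra L" and M: "prob_space M"
  shows "(\<integral>x. f x \<partial>bind M N) = (\<integral>y. (\<integral>x. f x \<partial>N y) \<partial>M)"
proof -
  interpret M: prob_space M by fact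
  have N': "N \<in> M \<rightarrow>\<^sub>M subprob_algebra L" by (rule measurable_prob_algebraD[OF N])
  have Ny: "prob_space (N y)" "sets (N y) = sets L" if "y \<in> space M" for y
    using measurable_space[OF N that] by (simp_all add: space_prob_algebra)
  have fN: "f \<in> borel_measurable (N y)" "integrable (N y) f" if "y \<in> space M" for y
  proof -
    interpret prob_space "N y" using Ny[OF that] by simp
    show m: "f \<in> borel_measurable (N y)" using Ny[OF that] by (simp cong: measurable_cong_sets)
    show "integrable (N y) f" by (rule integrable_bounded[OF m b])
  qed
  have bd: "AE y in M. emeasure (N y) (space (N y)) \<le> ennreal 1"
    using Ny by (intro AE_I2) (simp add: prob_space.emeasure_space_1)
  have sb: "sets (bind M N) = sets L" using N' M.not_empty by (intro sets_bind) (auto dest: sets_kernel)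
  have "prob_space (bind M N)"
    using N' Ny by (intro M.prob_space_bind[where S=L]) auto
  then interpret B: prob_space "bind M N" .
  have i1: "integrable (bind M N) f"
    by (rule B.integrable_bounded[OF _ b]) (simp add: sb cong: measurable_cong_sets)
  have [measurable]: "(\<lambda>y. \<integral>x. f x \<partial>N y) \<in> borel_measurable M"
    by (rule measurable_compose[OF N' integral_measurable_subprob_algebra]) measurable
  have i2: "integrable M (\<lambda>y. \<integral>x. f x \<partial>N y)"
    using norm_integral_prob_le[OF Ny(1) fN(1) b] by (intro M.integrable_bounded[where B=B]) auto
  have re: "\<bar>Re (f x)\<bar> \<le> B" and im: "\<bar>Im (f x)\<bar> \<le> B" for x
    using abs_Re_le_cmod[of "f x"] abs_Im_le_cmod[of "f x"] b[of x] by linarith+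
  have R: "(\<integral>x. Re (f x) \<partial>bind M N) = (\<integral>y. (\<integral>x. Re (f x) \<partial>N y) \<partial>M)"
    by (rule integral_bind[where B=B and B'=1, OF _ _ N' M.finite_measure_axioms bd]) (use re in auto)
  have I: "(\<integral>x. Im (f x) \<partial>bind M N) = (\<integral>y. (\<integral>x. Im (f x) \<partial>N y) \<partial>M)"
    by (rule integral_bind[where B=B and B'=1, OF _ _ N' M.finite_measure_axioms bd]) (use im in auto)
  show ?thesis
  proof (rule complex_eqI)
    show "Re (\<integral>x. f x \<partial>bind M N) = Re (\<integral>y. (\<integral>x. f x \<partial>N y) \<partial>M)"
      unfolding integral_Re[OF i1, symmetric] integral_Re[OF i2, symmetric] R
      by (rule Bochner_Integration.integral_cong[OF refl]) (rule integral_Re[OF fN(2)])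
    show "Im (\<integral>x. f x \<partial>bind M N) = Im (\<integral>y. (\<integral>x. f x \<partial>N y) \<partial>M)"
      unfolding integral_Im[OF i1, symmetric] integral_Im[OF i2, symmetric] I
      by (rule Bochner_Integration.integral_cong[OF refl]) (rule integral_Im[OF fN(2)])
  qed
qed

lemma integral_pair_exp:
  fixes \<mu> \<nu> :: "(real^'d) measure"
  assumes fin: "finite_measure \<mu>" "finite_measure \<nu>" and s[measurable_cong]: "sets \<mu> = sets borel" "sets \<nu> = sets borel"
  shows "(\<integral>p. exp (- (\<i> * complex_of_real (k \<bullet> (fst p - snd p)))) \<partial>(\<mu> \<Otimes>\<^sub>M \<nu>)) = fourier_measure \<mu> k * cnj (fourier_measure \<nu> k)"
proof -
  interpret \<mu>: finite_measure \<mu> by fact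
  interpret \<nu>: finite_measure \<nu> by fact
  interpret pair_sigma_finite \<mu> \<nu> ..
  interpret P: finite_measure "\<mu> \<Otimes>\<^sub>M \<nu>" by (rule finite_measure_pair_measure) unfold_locales
  have "(\<integral>p. exp (- (\<i> * complex_of_real (k \<bullet> (fst p - snd p)))) \<partial>(\<mu> \<Otimes>\<^sub>M \<nu>)) =
      (\<integral>v. (\<integral>u. exp (- (\<i> * complex_of_real (k \<bullet> (v - u)))) \<partial>\<nu>) \<partial>\<mu>)"
    by (subst integral_fst'[symmetric]) (auto intro!: P.integrable_bounded[where B=1])
  also have "\<dots> = (\<integral>v. (\<integral>u. exp (- (\<i> * complex_of_real (k \<bullet> v))) * cnj (exp (- (\<i> * complex_of_real (k \<bullet> u)))) \<partial>\<nu>) \<partial>\<mu>)"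
    by (intro Bochner_Integration.integral_cong refl) (simp add: exp_cnj exp_add[symmetric] inner_diff_right algebra_simps exp_diff exp_minus divide_inverse)
  also have "\<dots> = fourier_measure \<mu> k * cnj (fourier_measure \<nu> k)"
    by (simp add: fourier_measure_def del: exp_cnj flip: Bochner_Integration.integral_cnj)
  finally show ?thesis .
qed

context transported_random_measure
begin

definition mean_measure :: "(real^'d) measure" where
  "mean_measure = bind (palm M \<theta> \<Phi>) (\<lambda>\<omega>. kernel_star K \<omega> 0)"

lemma kernel_star_0: "\<omega> \<in> space M \<Longrightarrow> kernel_star K \<omega> 0 = K \<omega> 0"
  by (simp add: kernel_star_eq \<theta>_0)

lemma kernel_star_0_measurable: "(\<lambda>\<omega>. kernel_star K \<omega> 0) \<in> palm M \<theta> \<Phi> \<rightarrow>\<^sub>M prob_algebra borel"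
  by (rule kernel_star_measurable) simp_all

lemma prob_space_mean_measure: "prob_space mean_measure"
  and sets_mean_measure [simp, measurable_cong]: "sets mean_measure = sets borel"
proof -
  have "palm M \<theta> \<Phi> \<in> space (prob_algebra (palm M \<theta> \<Phi>))" by (simp add: space_prob_algebra prob_space_palm)
  then have "mean_measure \<in> space (prob_algebra borel)"
    unfolding mean_measure_def
    using measurable_space[OF measurable_bind_prob_space[OF measurable_ident kernel_star_0_measurable]] by simp
  then show "prob_space mean_measure" "sets mean_measure = sets borel" by (simp_all add: space_prob_algebra)
qed

lemma space_mean_measure [simp]: "space mean_measure = UNIV"
  using sets_eq_imp_space_eq[OF sets_mean_measure] by simp

lemma mean_kernel_eq: "mean_kernel M \<theta> \<Phi> K x = distr mean_measure borel (\<lambda>y. y + x)"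
proof -
  have "bind (palm M \<theta> \<Phi>) (\<lambda>\<omega>. K \<omega> 0) = mean_measure"
    unfolding mean_measure_def by (rule bind_cong) (simp_all add: kernel_star_0)
  then show ?thesis by (simp add: mean_kernel_def)
qed

lemma kernel_star_mean_kernel: "kernel_star (\<lambda>_. mean_kernel M \<theta> \<Phi> K) \<omega> x = mean_measure"
proof -
  have "distr (distr mean_measure borel (\<lambda>y. y + x)) borel (\<lambda>y. y - x) = mean_measure"
    by (subst distr_distr) (simp_all add: comp_def distr_id2)
  then show ?thesis by (simp add: kernel_star_def mean_kernel_eq)
qed

text \<open>Although deterministic, L is an invariant probability kernel. All results on the
  transport by K thereby become available for L.\<close>

lemma transported_mean_kernel: "transported_random_measure M \<theta> \<Phi> P2 (\<lambda>_. mean_kernel M \<theta> \<Phi> K)"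
proof (unfold_locales, unfold invariant_prob_kernel_def, intro conjI ballI allI)
  have "(\<lambda>p. distr mean_measure borel (\<lambda>y. y + snd p)) \<in> (M \<Otimes>\<^sub>M (borel :: (real^'d) measure)) \<rightarrow>\<^sub>M prob_algebra borel"
  proof (rule measurable_distr_prob_space2[where N=borel])
    show "(\<lambda>p. mean_measure) \<in> (M \<Otimes>\<^sub>M (borel :: (real^'d) measure)) \<rightarrow>\<^sub>M prob_algebra borel"
      by (rule measurable_const) (simp add: space_prob_algebra prob_space_mean_measure)
  qed measurable
  then show "(\<lambda>(\<omega>, x). mean_kernel M \<theta> \<Phi> K x) \<in> M \<Otimes>\<^sub>M borel \<rightarrow>\<^sub>M prob_algebra borel"
    by (simp add: mean_kernel_eq case_prod_beta')
  fix \<omega> x and B :: "(real^'d) set" assume B: "B \<in> sets borel"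
  have "(\<lambda>y. y + x) -` (\<lambda>y. y + x) ` B = B" by auto
  moreover have "(\<lambda>y. y + x) ` B \<in> sets borel"
  proof -
    have "(\<lambda>y. y + x) ` B = (\<lambda>y. y - x) -` B \<inter> space borel" by (auto intro: image_eqI[of _ _ "_ - x"])
    then show ?thesis using measurable_sets[of "\<lambda>y. y - x" borel borel B] B by simp
  qed
  ultimately show "emeasure (mean_kernel M \<theta> \<Phi> K x) ((\<lambda>y. y + x) ` B) = emeasure (mean_kernel M \<theta> \<Phi> K 0) B"
    using B by (simp add: mean_kernel_eq emeasure_distr)
qed

text \<open>The starred mean kernel depends neither on \<omega> nor on the location, so the
  two-point Palm average is that of a constant.\<close>

lemma pair_palm_mean_kernel:
  "transported_random_measure.pair_palm P2 (\<lambda>_. mean_kernel M \<theta> \<Phi> K) y = mean_measure \<Otimes>\<^sub>M mean_measure"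
proof -
  interpret L: transported_random_measure M \<theta> \<Phi> P2 "\<lambda>_. mean_kernel M \<theta> \<Phi> K" by (rule transported_mean_kernel)
  interpret mm: pair_prob_space mean_measure mean_measure
    by (simp add: pair_prob_space_def pair_sigma_finite_def prob_space_mean_measure prob_space_imp_sigma_finite)
  have "L.pair_palm y = bind (P2 y) (\<lambda>\<omega>. mean_measure \<Otimes>\<^sub>M mean_measure)"
    unfolding L.pair_palm_def kernel_star_mean_kernel ..
  also have "\<dots> = mean_measure \<Otimes>\<^sub>M mean_measure"
  proof (rule measure_eqI)
    have "space (P2 y) \<noteq> {}" using prob_space.not_empty[OF prob_space_P2] .
    then show "sets (P2 y \<bind> (\<lambda>\<omega>. mean_measure \<Otimes>\<^sub>M mean_measure)) = sets (mean_measure \<Otimes>\<^sub>M mean_measure)"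
      by (intro sets_bind) auto
    fix X
    show "emeasure (P2 y \<bind> (\<lambda>\<omega>. mean_measure \<Otimes>\<^sub>M mean_measure)) X = emeasure (mean_measure \<Otimes>\<^sub>M mean_measure) X"
      by (rule emeasure_bind_const_prob_space[OF prob_space_P2]) (rule mm.subprob_space_axioms[unfolded])
  qed
  finally show ?thesis .
qed

lemma kappa_eq: "kappa M \<theta> \<Phi> P2 K y = tv_norm (borel \<Otimes>\<^sub>M borel)
    (\<lambda>C. measure (pair_palm y) C - measure (mean_measure \<Otimes>\<^sub>M mean_measure) C)"
  by (simp add: kappa_def Let_def pair_palm_def mean_measure_def)

lemma sets_mean_pair: "sets (mean_measure \<Otimes>\<^sub>M mean_measure) = sets (borel \<Otimes>\<^sub>M borel)"
  by (rule sets_pair_measure_cong) simp_all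

lemma prob_space_mean_pair: "prob_space (mean_measure \<Otimes>\<^sub>M mean_measure)"
proof -
  interpret mm: pair_prob_space mean_measure mean_measure
    by (simp add: pair_prob_space_def pair_sigma_finite_def prob_space_mean_measure prob_space_imp_sigma_finite)
  show ?thesis by unfold_locales
qed

text \<open>\<open>signed_integral_diff\<close> turns the abstract integral into a difference of
  expectations, and \<open>f\<close> competes in the supremum defining
  \<open>tv_norm\<close>.\<close>

lemma kappa_bound:
  assumes f: "f \<in> borel_measurable (borel \<Otimes>\<^sub>M borel)" and b: "\<And>p. \<bar>f p\<bar> \<le> 1"
  shows "ennreal \<bar>(\<integral>p. f p \<partial>pair_palm y) - (\<integral>p. f p \<partial>(mean_measure \<Otimes>\<^sub>M mean_measure))\<bar> \<le> kappa M \<theta> \<Phi> P2 K y"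
proof -
  have "signed_integral (borel \<Otimes>\<^sub>M borel) (\<lambda>C. measure (pair_palm y) C - measure (mean_measure \<Otimes>\<^sub>M mean_measure) C) f =
      (\<integral>p. f p \<partial>pair_palm y) - (\<integral>p. f p \<partial>(mean_measure \<Otimes>\<^sub>M mean_measure))"
    by (rule signed_integral_diff[where C=1])
       (use f b prob_space_pair_palm prob_space_mean_pair sets_mean_pair in \<open>auto intro: prob_space.finite_measure\<close>)
  then show ?thesis
    unfolding kappa_eq using signed_integral_le_tv_norm[OF f, of "\<lambda>C. measure (pair_palm y) C - measure (mean_measure \<Otimes>\<^sub>M mean_measure) C"] b
    by simp
qed

text \<open>The indicator of X serves as test function. Unlike a bound on the absolute difference,
  the one-sided form in \<open>ennreal\<close> can be integrated over y against the infinite measure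
  \<alpha>.\<close>

lemma kappa_bound_emeasure:
  assumes X: "X \<in> sets (borel \<Otimes>\<^sub>M borel)"
  shows "emeasure (pair_palm y) X \<le> emeasure (mean_measure \<Otimes>\<^sub>M mean_measure) X + kappa M \<theta> \<Phi> P2 K y"
    and "emeasure (mean_measure \<Otimes>\<^sub>M mean_measure) X \<le> emeasure (pair_palm y) X + kappa M \<theta> \<Phi> P2 K y"
proof -
  interpret A: prob_space "pair_palm y" by (rule prob_space_pair_palm)
  interpret B: prob_space "mean_measure \<Otimes>\<^sub>M mean_measure" by (rule prob_space_mean_pair)
  have k: "ennreal \<bar>measure (pair_palm y) X - measure (mean_measure \<Otimes>\<^sub>M mean_measure) X\<bar> \<le> kappa M \<theta> \<Phi> P2 K y"
  proof -
    have "indicator X \<in> borel_measurable (borel \<Otimes>\<^sub>M borel)" "\<And>p. \<bar>indicator X p :: real\<bar> \<le> 1"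
      using X by (auto split: split_indicator)
    from kappa_bound[OF this, of y] show ?thesis
      using X sets_mean_pair by (simp add: sets.Int_space_eq2)
  qed
  have gen: "ennreal a \<le> ennreal b + c" if "ennreal \<bar>a - b\<bar> \<le> c" "0 \<le> b" "0 \<le> a" for a b c
  proof -
    have "ennreal a \<le> ennreal (b + \<bar>a - b\<bar>)" by (rule ennreal_leI) simp
    also have "\<dots> = ennreal b + ennreal \<bar>a - b\<bar>" using that by (simp add: ennreal_plus)
    also have "\<dots> \<le> ennreal b + c" by (rule add_left_mono[OF that(1)])
    finally show ?thesis .
  qed
  show "emeasure (pair_palm y) X \<le> emeasure (mean_measure \<Otimes>\<^sub>M mean_measure) X + kappa M \<theta> \<Phi> P2 K y"
    unfolding A.emeasure_eq_measure B.emeasure_eq_measure by (rule gen[OF k]) simp_all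
  show "emeasure (mean_measure \<Otimes>\<^sub>M mean_measure) X \<le> emeasure (pair_palm y) X + kappa M \<theta> \<Phi> P2 K y"
    unfolding A.emeasure_eq_measure B.emeasure_eq_measure by (rule gen[OF k[unfolded abs_minus_commute[of "measure (pair_palm y) X"]]]) simp_all
qed

end

section \<open>The joint measure of the mean kernel and the finite signed difference\<close>

context transported_random_measure
begin

text \<open>\<open>joint_palm\<close> of the kernel L written out, so that it can stand next to that
  of K within one interpretation.\<close>

definition mean_joint :: "((real^'d) \<times> (real^'d) \<times> (real^'d)) measure" where
  "mean_joint = bind \<alpha> (\<lambda>y. distr (mean_measure \<Otimes>\<^sub>M mean_measure) (borel \<Otimes>\<^sub>M borel \<Otimes>\<^sub>M borel) (Pair y))"

definition mean_moment :: "(real^'d) measure" where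
  "mean_moment = distr mean_joint borel (\<lambda>(y, v, u). y + v - u)"

lemma sets_mean_joint [simp, measurable_cong]: "sets mean_joint = sets (borel \<Otimes>\<^sub>M borel \<Otimes>\<^sub>M borel)"
  and nn_integral_mean_joint: "f \<in> borel_measurable (borel \<Otimes>\<^sub>M borel \<Otimes>\<^sub>M borel) \<Longrightarrow>
    (\<integral>\<^sup>+p. f p \<partial>mean_joint) = (\<integral>\<^sup>+y. (\<integral>\<^sup>+p. f (y, p) \<partial>(mean_measure \<Otimes>\<^sub>M mean_measure)) \<partial>\<alpha>)"
  and mean_moment_eq: "transported_random_measure.transported_moment M \<Phi> P2 (\<lambda>_. mean_kernel M \<theta> \<Phi> K) = mean_moment"
proof -
  interpret L: transported_random_measure M \<theta> \<Phi> P2 "\<lambda>_. mean_kernel M \<theta> \<Phi> K" by (rule transported_mean_kernel)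
  have eq: "L.joint_palm = mean_joint"
    unfolding L.joint_palm_def mean_joint_def pair_palm_mean_kernel ..
  show "sets mean_joint = sets (borel \<Otimes>\<^sub>M borel \<Otimes>\<^sub>M borel)"
    using L.sets_joint_palm unfolding eq .
  show "(\<integral>\<^sup>+p. f p \<partial>mean_joint) = (\<integral>\<^sup>+y. (\<integral>\<^sup>+p. f (y, p) \<partial>(mean_measure \<Otimes>\<^sub>M mean_measure)) \<partial>\<alpha>)"
    if "f \<in> borel_measurable (borel \<Otimes>\<^sub>M borel \<Otimes>\<^sub>M borel)"
    using L.nn_integral_joint_palm[OF that] unfolding eq pair_palm_mean_kernel .
  show "L.transported_moment = mean_moment"
    unfolding L.transported_moment_def mean_moment_def eq ..
qed

lemma sets_mean_moment [simp, measurable_cong]: "sets mean_moment = sets borel"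
  by (simp add: mean_moment_def)

lemma nn_integral_mean_moment:
  assumes [measurable]: "f \<in> borel_measurable borel"
  shows "(\<integral>\<^sup>+z. f z \<partial>mean_moment) =
    (\<integral>\<^sup>+p. (\<integral>\<^sup>+y. f (y + fst p - snd p) \<partial>\<alpha>) \<partial>(mean_measure \<Otimes>\<^sub>M mean_measure))"
proof -
  note [measurable_cong] = sets_mean_pair
  interpret mm: prob_space "mean_measure \<Otimes>\<^sub>M mean_measure" by (rule prob_space_mean_pair)
  interpret pair_sigma_finite \<alpha> "mean_measure \<Otimes>\<^sub>M mean_measure" ..
  have "(\<integral>\<^sup>+z. f z \<partial>mean_moment) = (\<integral>\<^sup>+p. f (case p of (y, v, u) \<Rightarrow> y + v - u) \<partial>mean_joint)"
    unfolding mean_moment_def by (rule nn_integral_distr) measurable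
  also have "\<dots> = (\<integral>\<^sup>+y. (\<integral>\<^sup>+p. f (y + fst p - snd p) \<partial>(mean_measure \<Otimes>\<^sub>M mean_measure)) \<partial>\<alpha>)"
    by (subst nn_integral_mean_joint) (simp_all add: case_prod_beta)
  also have "\<dots> = (\<integral>\<^sup>+p. (\<integral>\<^sup>+y. f (y + fst p - snd p) \<partial>\<alpha>) \<partial>(mean_measure \<Otimes>\<^sub>M mean_measure))"
    by (rule Fubini'[symmetric]) measurable
  finally show ?thesis .
qed

text \<open>A ball around 0 receives the average of the \<alpha>-masses of its translates by u - v,
  and these are uniformly bounded.\<close>

lemma locally_finite_mean_moment: "locally_finite mean_moment"
proof (rule locally_finite_of_cball)
  fix r
  interpret mm: prob_space "mean_measure \<Otimes>\<^sub>M mean_measure" by (rule prob_space_mean_pair)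
  obtain C where C: "C < \<infinity>" "\<And>z. emeasure \<alpha> (cball z r) \<le> C" using second_moment_translation_bounded by blast
  have "emeasure mean_moment (cball 0 r) = (\<integral>\<^sup>+z. indicator (cball 0 r) z \<partial>mean_moment)" by simp
  also have "\<dots> = (\<integral>\<^sup>+p. (\<integral>\<^sup>+y. indicator (cball 0 r) (y + fst p - snd p) \<partial>\<alpha>) \<partial>(mean_measure \<Otimes>\<^sub>M mean_measure))"
    by (intro nn_integral_mean_moment borel_measurable_indicator) simp
  also have "\<dots> = (\<integral>\<^sup>+p. emeasure \<alpha> (cball (snd p - fst p) r) \<partial>(mean_measure \<Otimes>\<^sub>M mean_measure))"
  proof (rule nn_integral_cong)
    fix p :: "(real^'d) \<times> (real^'d)"
    have "(\<integral>\<^sup>+y. indicator (cball 0 r) (y + fst p - snd p) \<partial>\<alpha>) = (\<integral>\<^sup>+y. indicator (cball (snd p - fst p) r) y \<partial>\<alpha>)"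
      by (intro nn_integral_cong) (auto split: split_indicator simp: dist_norm norm_minus_commute algebra_simps)
    then show "(\<integral>\<^sup>+y. indicator (cball 0 r) (y + fst p - snd p) \<partial>\<alpha>) = emeasure \<alpha> (cball (snd p - fst p) r)" by simp
  qed
  also have "\<dots> \<le> (\<integral>\<^sup>+p. C \<partial>(mean_measure \<Otimes>\<^sub>M mean_measure))" by (intro nn_integral_mono C)
  also have "\<dots> = C" by (simp add: mm.emeasure_space_1)
  finally show "emeasure mean_moment (cball 0 r) < \<infinity>" using C(1) by (rule le_less_trans)
qed simp

text \<open>Only the variable y is cut off: the kernels have mass 1, so this already gives finite
  mass.\<close>

definition strip :: "nat \<Rightarrow> ((real^'d) \<times> (real^'d) \<times> (real^'d)) set" where
  "strip n = {p. fst p \<in> cball 0 (real n)}"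

lemma strip_measurable [measurable]: "strip n \<in> sets (borel \<Otimes>\<^sub>M borel \<Otimes>\<^sub>M borel)"
proof -
  have "fst -` cball (0 :: real^'d) (real n) \<inter> space (borel \<Otimes>\<^sub>M (borel \<Otimes>\<^sub>M borel :: ((real^'d) \<times> (real^'d)) measure)) \<in>
      sets (borel \<Otimes>\<^sub>M borel \<Otimes>\<^sub>M borel)"
    by (rule measurable_sets[OF measurable_fst]) simp
  then show ?thesis by (simp add: strip_def space_pair_measure vimage_def)
qed

lemma emeasure_cball_\<alpha>: "emeasure \<alpha> (cball 0 r) < \<infinity>"
  using locally_finite_second_moment by (simp add: locally_finite_def)

text \<open>Slice a set D by its first coordinate. On each slice the two kernels differ by at most
  \<open>kappa\<close>, so the two joint measures differ on D by at most its integral, which is the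
  constant \<open>C\<close> of \<open>finite_difference_decomposition\<close>.\<close>

lemma signed_decomposition:
  assumes kfin: "(\<integral>\<^sup>+y. kappa M \<theta> \<Phi> P2 K y \<partial>\<alpha>) < \<infinity>"
  obtains N1 N2 where "finite_measure N1" "finite_measure N2" "sets N1 = sets (borel \<Otimes>\<^sub>M borel \<Otimes>\<^sub>M borel)"
    "sets N2 = sets (borel \<Otimes>\<^sub>M borel \<Otimes>\<^sub>M borel)"
    "\<And>D. D \<in> sets (borel \<Otimes>\<^sub>M borel \<Otimes>\<^sub>M borel) \<Longrightarrow>
      emeasure joint_palm D + emeasure N2 D = emeasure mean_joint D + emeasure N1 D"
proof -
  let ?B = "borel \<Otimes>\<^sub>M borel \<Otimes>\<^sub>M borel :: ((real^'d) \<times> (real^'d) \<times> (real^'d)) measure"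
  let ?S = "\<lambda>D y. Pair y -` D :: ((real^'d) \<times> (real^'d)) set"
  have S: "?S D y \<in> sets (borel \<Otimes>\<^sub>M borel)" if "D \<in> sets ?B" for D y using that by (rule sets_Pair1)
  have ind: "(indicator D (y, p) :: ennreal) = indicator (?S D y) p" for D y p by (simp split: split_indicator)
  have J: "emeasure joint_palm D = (\<integral>\<^sup>+y. emeasure (pair_palm y) (?S D y) \<partial>\<alpha>)" if D: "D \<in> sets ?B" for D
  proof -
    have "emeasure joint_palm D = (\<integral>\<^sup>+p. indicator D p \<partial>joint_palm)" using D by simp
    also have "\<dots> = (\<integral>\<^sup>+y. (\<integral>\<^sup>+p. indicator D (y, p) \<partial>pair_palm y) \<partial>\<alpha>)"
      using D by (intro nn_integral_joint_palm) simp
    finally show ?thesis unfolding ind using S[OF D] by simp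
  qed
  have Q: "emeasure mean_joint D = (\<integral>\<^sup>+y. emeasure (mean_measure \<Otimes>\<^sub>M mean_measure) (?S D y) \<partial>\<alpha>)" if D: "D \<in> sets ?B" for D
  proof -
    have "emeasure mean_joint D = (\<integral>\<^sup>+p. indicator D p \<partial>mean_joint)" using D by simp
    also have "\<dots> = (\<integral>\<^sup>+y. (\<integral>\<^sup>+p. indicator D (y, p) \<partial>(mean_measure \<Otimes>\<^sub>M mean_measure)) \<partial>\<alpha>)"
      using D by (intro nn_integral_mean_joint) simp
    finally show ?thesis unfolding ind using S[OF D] sets_mean_pair by simp
  qed
  have mJ: "(\<lambda>y. emeasure (pair_palm y) (?S D y)) \<in> borel_measurable borel" if D[measurable]: "D \<in> sets ?B" for D
  proof -
    have "(\<lambda>y. \<integral>\<^sup>+p. indicator D (y, p) \<partial>pair_palm y) \<in> borel_measurable borel"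
      by (rule nn_integral_measurable_subprob_algebra2[where N="borel \<Otimes>\<^sub>M borel"]) (simp_all add: measurable_prob_algebraD case_prod_beta')
    then show ?thesis unfolding ind using S[OF D] by simp
  qed
  have mQ: "(\<lambda>y. emeasure (mean_measure \<Otimes>\<^sub>M mean_measure) (?S D y)) \<in> borel_measurable borel" if D[measurable]: "D \<in> sets ?B" for D
  proof -
    note [measurable_cong] = sets_mean_pair
    interpret mm: prob_space "mean_measure \<Otimes>\<^sub>M mean_measure" by (rule prob_space_mean_pair)
    have "(\<lambda>y. \<integral>\<^sup>+p. indicator D (y, p) \<partial>(mean_measure \<Otimes>\<^sub>M mean_measure)) \<in> borel_measurable borel"
      by (rule mm.borel_measurable_nn_integral) (simp add: case_prod_beta')
    then show ?thesis unfolding ind using S[OF D] sets_mean_pair by simp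
  qed
  \<comment> \<open>\<open>kappa\<close> is a supremum over all test functions and enters through
    monotonicity alone. The integral is split with the truncated difference \<open>f - g\<close>,
    which is measurable.\<close>
  have gen: "(\<integral>\<^sup>+y. f y \<partial>\<alpha>) \<le> (\<integral>\<^sup>+y. g y \<partial>\<alpha>) + (\<integral>\<^sup>+y. kappa M \<theta> \<Phi> P2 K y \<partial>\<alpha>)"
    if [measurable]: "f \<in> borel_measurable borel" "g \<in> borel_measurable borel"
      and le: "\<And>y. f y \<le> g y + kappa M \<theta> \<Phi> P2 K y" and gf: "\<And>y. g y < top" for f g
  proof -
    have "(\<integral>\<^sup>+y. f y \<partial>\<alpha>) \<le> (\<integral>\<^sup>+y. g y + (f y - g y) \<partial>\<alpha>)"
      by (intro nn_integral_mono) (auto simp: add_diff_self_ennreal)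
    also have "\<dots> = (\<integral>\<^sup>+y. g y \<partial>\<alpha>) + (\<integral>\<^sup>+y. f y - g y \<partial>\<alpha>)" by (rule nn_integral_add) measurable
    also have "\<dots> \<le> (\<integral>\<^sup>+y. g y \<partial>\<alpha>) + (\<integral>\<^sup>+y. kappa M \<theta> \<Phi> P2 K y \<partial>\<alpha>)"
      using le by (intro add_left_mono nn_integral_mono) (simp add: ennreal_minus_le_iff less_imp_neq[OF gf])
    finally show ?thesis .
  qed
  have p1: "emeasure (pair_palm y) X < top" and p2: "emeasure (mean_measure \<Otimes>\<^sub>M mean_measure) X < top" for y X
    using prob_space_pair_palm[of y] prob_space_mean_pair
    by (simp_all add: less_top[symmetric] finite_measure.emeasure_finite prob_space.finite_measure)
  show ?thesis
  proof (rule finite_difference_decomposition[of mean_joint joint_palm strip "\<integral>\<^sup>+y. kappa M \<theta> \<Phi> P2 K y \<partial>\<alpha>"])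
    show "sets mean_joint = sets joint_palm" by simp
    show "range strip \<subseteq> sets joint_palm" by auto
    show "incseq strip" by (auto simp: incseq_def strip_def)
    have "\<exists>n::nat. norm x \<le> real n" for x :: "real^'d" by (rule real_arch_simple)
    then show "(\<Union>n. strip n) = space joint_palm"
      using sets_eq_imp_space_eq[OF sets_joint_palm] by (auto simp: strip_def space_pair_measure)
    have ss: "?S (strip n) y = (if y \<in> cball 0 (real n) then UNIV else {})" for n y by (auto simp: strip_def)
    have u: "emeasure (pair_palm y) UNIV = 1" "emeasure (mean_measure \<Otimes>\<^sub>M mean_measure) UNIV = 1" for y
      using prob_space.emeasure_space_1[OF prob_space_pair_palm[of y]] prob_space.emeasure_space_1[OF prob_space_mean_pair]
        sets_eq_imp_space_eq[OF sets_pair_palm[of y]] by (simp_all add: space_pair_measure)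
    have st: "(\<integral>\<^sup>+y. (if y \<in> cball 0 (real n) then 1 else 0) \<partial>\<alpha>) < \<infinity>" for n :: nat
    proof -
      have "(\<integral>\<^sup>+y. (if y \<in> cball 0 (real n) then 1 else 0) \<partial>\<alpha>) = (\<integral>\<^sup>+y. indicator (cball 0 (real n)) y \<partial>\<alpha>)"
        by (intro nn_integral_cong) (simp split: split_indicator)
      then show ?thesis using emeasure_cball_\<alpha>[of "real n"] by simp
    qed
    show "emeasure joint_palm (strip n) < \<infinity>" for n
      using st[of n] by (simp only: J[OF strip_measurable] ss if_distrib[of "emeasure _"] u emeasure_empty)
    show "emeasure mean_joint (strip n) < \<infinity>" for n
      using st[of n] by (simp only: Q[OF strip_measurable] ss if_distrib[of "emeasure _"] u emeasure_empty)
    show "emeasure joint_palm D \<le> emeasure mean_joint D + (\<integral>\<^sup>+y. kappa M \<theta> \<Phi> P2 K y \<partial>\<alpha>)"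
      if "D \<in> sets joint_palm" for D
      using that S p2 by (simp only: sets_joint_palm J Q) (intro gen mJ mQ kappa_bound_emeasure; simp)
    show "emeasure mean_joint D \<le> emeasure joint_palm D + (\<integral>\<^sup>+y. kappa M \<theta> \<Phi> P2 K y \<partial>\<alpha>)"
      if "D \<in> sets joint_palm" for D
      using that S p1 by (simp only: sets_joint_palm J Q) (intro gen mJ mQ kappa_bound_emeasure; simp)
  qed (use kfin that in auto)
qed

end

text \<open>\<open>N1 - N2\<close> represents the difference of the infinite measures \<open>joint_palm\<close> and \<open>mean_joint\<close>.\<close>

locale decomposed_transport = transported_random_measure M \<theta> \<Phi> P2 K
  for M :: "'w measure" and \<theta> :: "real^'d \<Rightarrow> 'w \<Rightarrow> 'w" and \<Phi> :: "'w \<Rightarrow> (real^'d) measure"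
    and P2 :: "real^'d \<Rightarrow> 'w measure" and K :: "'w \<Rightarrow> real^'d \<Rightarrow> (real^'d) measure" +
  fixes N1 N2 :: "((real^'d) \<times> (real^'d) \<times> (real^'d)) measure"
  assumes kfin: "(\<integral>\<^sup>+y. kappa M \<theta> \<Phi> P2 K y \<partial>\<alpha>) < \<infinity>"
    and fN: "finite_measure N1" "finite_measure N2"
    and sN: "sets N1 = sets (borel \<Otimes>\<^sub>M borel \<Otimes>\<^sub>M borel)" "sets N2 = sets (borel \<Otimes>\<^sub>M borel \<Otimes>\<^sub>M borel)"
    and dec: "\<And>D. D \<in> sets (borel \<Otimes>\<^sub>M borel \<Otimes>\<^sub>M borel) \<Longrightarrow>
      emeasure joint_palm D + emeasure N2 D = emeasure mean_joint D + emeasure N1 D"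
begin

section \<open>Integrals against the signed difference\<close>

lemmas sN_cong [measurable_cong] = sN

text \<open>\<open>J\<close> and \<open>\<mu>\<close> are abstract in order to cover
  \<open>joint_palm\<close> and \<open>mean_joint\<close> alike. Both may have infinite mass, so
  their integrals can be subtracted only after the cut-off to a strip.\<close>

lemma nn_integral_strip_finite:
  assumes [measurable]: "h \<in> borel_measurable (borel \<Otimes>\<^sub>M borel \<Otimes>\<^sub>M borel)" and h: "\<And>p. 0 \<le> h p" "\<And>p. h p \<le> (1 :: real)"
    and nn: "\<forall>f\<in>borel_measurable (borel \<Otimes>\<^sub>M borel \<Otimes>\<^sub>M borel). (\<integral>\<^sup>+p. f p \<partial>J) = (\<integral>\<^sup>+y. (\<integral>\<^sup>+p. f (y, p) \<partial>\<mu> y) \<partial>\<alpha>)"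
    and sJ: "sets J = sets (borel \<Otimes>\<^sub>M borel \<Otimes>\<^sub>M borel)"
    and \<mu>: "\<And>y. prob_space (\<mu> y)" "\<mu> \<in> borel \<rightarrow>\<^sub>M prob_algebra (borel \<Otimes>\<^sub>M borel)"
  shows "integrable J (\<lambda>p. indicator (strip n) p * h p)"
    and "(\<integral>p. indicator (strip n) p * h p \<partial>J) = (\<integral>y. indicator (cball 0 (real n)) y * (\<integral>p. h (y, p) \<partial>\<mu> y) \<partial>\<alpha>)"
    and "integrable \<alpha> (\<lambda>y. indicator (cball 0 (real n)) y * (\<integral>p. h (y, p) \<partial>\<mu> y))"
    and "(\<lambda>y. \<integral>p. h (y, p) \<partial>\<mu> y) \<in> borel_measurable borel"
proof -
  note [measurable_cong] = sJ
  have s\<mu>: "sets (\<mu> y) = sets (borel \<Otimes>\<^sub>M borel)" for y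
    using measurable_space[OF \<mu>(2), of y] by (simp add: space_prob_algebra)
  have ih: "integrable (\<mu> y) (\<lambda>p. h (y, p))" for y
  proof -
    interpret P: prob_space "\<mu> y" by (rule \<mu>(1))
    note [measurable_cong] = s\<mu>
    show ?thesis by (rule P.integrable_bounded[where B=1]) (simp_all add: h)
  qed
  define a where "a y = (\<integral>p. h (y, p) \<partial>\<mu> y)" for y
  have a0: "0 \<le> a y" for y unfolding a_def using h by simp
  have ea: "(\<integral>\<^sup>+p. ennreal (h (y, p)) \<partial>\<mu> y) = ennreal (a y)" for y
    unfolding a_def using ih h by (intro nn_integral_eq_integral) auto
  have "(\<lambda>y. \<integral>\<^sup>+p. ennreal (h (y, p)) \<partial>\<mu> y) \<in> borel_measurable borel"
    by (rule nn_integral_measurable_subprob_algebra2[where N="borel \<Otimes>\<^sub>M borel"])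
       (auto simp: case_prod_beta' intro: measurable_prob_algebraD \<mu>(2))
  then have "(\<lambda>y. enn2real (\<integral>\<^sup>+p. ennreal (h (y, p)) \<partial>\<mu> y)) \<in> borel_measurable borel" by measurable
  then show am: "(\<lambda>y. \<integral>p. h (y, p) \<partial>\<mu> y) \<in> borel_measurable borel"
    unfolding ea using a0 by (simp add: a_def)
  then have [measurable]: "a \<in> borel_measurable borel" by (simp add: a_def[abs_def])
  have a1: "a y \<le> 1" for y
  proof -
    interpret P: prob_space "\<mu> y" by (rule \<mu>(1))
    have "a y \<le> (\<integral>p. 1 \<partial>\<mu> y)" unfolding a_def using ih h by (intro integral_mono) auto
    then show ?thesis by (simp add: P.prob_space)
  qed
  have si: "indicator (strip n) (y, p) = (indicator (cball 0 (real n)) y :: real)" for y p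
    by (simp add: strip_def split: split_indicator)
  have eq: "(\<integral>\<^sup>+p. ennreal (indicator (strip n) p * h p) \<partial>J) = (\<integral>\<^sup>+y. ennreal (indicator (cball 0 (real n)) y * a y) \<partial>\<alpha>)"
  proof -
    have "(\<integral>\<^sup>+p. ennreal (indicator (strip n) p * h p) \<partial>J) =
        (\<integral>\<^sup>+y. (\<integral>\<^sup>+p. ennreal (indicator (cball 0 (real n)) y * h (y, p)) \<partial>\<mu> y) \<partial>\<alpha>)"
      by (subst nn[rule_format]) (simp_all add: si)
    also have "\<dots> = (\<integral>\<^sup>+y. ennreal (indicator (cball 0 (real n)) y * a y) \<partial>\<alpha>)"
      by (intro nn_integral_cong) (simp add: ea split: split_indicator)
    finally show ?thesis .
  qed
  have fin: "(\<integral>\<^sup>+y. ennreal (indicator (cball 0 (real n)) y * a y) \<partial>\<alpha>) < \<infinity>"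
  proof -
    have "(\<integral>\<^sup>+y. ennreal (indicator (cball 0 (real n)) y * a y) \<partial>\<alpha>) \<le> (\<integral>\<^sup>+y. indicator (cball 0 (real n)) y \<partial>\<alpha>)"
      using a1 by (intro nn_integral_mono) (auto split: split_indicator)
    then show ?thesis using emeasure_cball_\<alpha>[of "real n"] by (simp add: le_less_trans)
  qed
  show "integrable J (\<lambda>p. indicator (strip n) p * h p)"
    using h fin by (intro integrableI_nonneg) (auto simp: eq)
  have ma: "(\<lambda>y. indicator (cball 0 (real n)) y * a y) \<in> borel_measurable \<alpha>"
    using \<open>a \<in> borel_measurable borel\<close>
    by (intro borel_measurable_times borel_measurable_indicator) (simp_all cong: measurable_cong_sets)
  then show "integrable \<alpha> (\<lambda>y. indicator (cball 0 (real n)) y * (\<integral>p. h (y, p) \<partial>\<mu> y))"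
    unfolding a_def[symmetric] using a0 fin by (intro integrableI_nonneg) auto
  show "(\<integral>p. indicator (strip n) p * h p \<partial>J) = (\<integral>y. indicator (cball 0 (real n)) y * (\<integral>p. h (y, p) \<partial>\<mu> y) \<partial>\<alpha>)"
    unfolding a_def[symmetric] using a0 h eq ma by (subst (1 2) integral_eq_nn_integral) auto
qed

abbreviation "mean_pair \<equiv> mean_measure \<Otimes>\<^sub>M mean_measure"

text \<open>On a strip the two joint measures may be integrated and subtracted, with the same result
  as for \<open>N1\<close> and \<open>N2\<close>. To remove the cut-off, the \<alpha>-integral is
  dominated by |G|, integrable because \<open>kappa\<close> bounds it, while the constant 1 serves
  for the finite measures.\<close>

lemma has_integral_unit:
  assumes h[measurable]: "h \<in> borel_measurable (borel \<Otimes>\<^sub>M borel \<Otimes>\<^sub>M borel)" and b: "\<And>p. 0 \<le> h p" "\<And>p. h p \<le> (1 :: real)"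
  shows "has_bochner_integral \<alpha> (\<lambda>y. (\<integral>p. h (y, p) \<partial>pair_palm y) - (\<integral>p. h (y, p) \<partial>mean_pair))
    ((\<integral>p. h p \<partial>N1) - (\<integral>p. h p \<partial>N2))"
proof -
  interpret f1: finite_measure N1 by (rule fN)
  interpret f2: finite_measure N2 by (rule fN)
  have mp: "(\<lambda>y::real^'d. mean_pair) \<in> borel \<rightarrow>\<^sub>M prob_algebra (borel \<Otimes>\<^sub>M borel)"
    by (rule measurable_const) (simp add: space_prob_algebra prob_space_mean_pair sets_mean_pair)
  note J = nn_integral_strip_finite[OF h b ballI[OF nn_integral_joint_palm] sets_joint_palm prob_space_pair_palm pair_palm_measurable]
  note Q = nn_integral_strip_finite[OF h b ballI[OF nn_integral_mean_joint] sets_mean_joint prob_space_mean_pair mp]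
  define G where "G y = (\<integral>p. h (y, p) \<partial>pair_palm y) - (\<integral>p. h (y, p) \<partial>mean_pair)" for y
  have Gm[measurable]: "G \<in> borel_measurable borel" unfolding G_def[abs_def] by (rule borel_measurable_diff[OF J(4) Q(4)])
  have Gb: "ennreal \<bar>G y\<bar> \<le> kappa M \<theta> \<Phi> P2 K y" for y
    unfolding G_def by (rule kappa_bound) (use b in \<open>auto simp: abs_le_iff intro: order_trans[OF _ b(1)]\<close>)
  have iG: "integrable \<alpha> G"
  proof (rule integrableI_bounded)
    have "(\<integral>\<^sup>+y. ennreal (norm (G y)) \<partial>\<alpha>) \<le> (\<integral>\<^sup>+y. kappa M \<theta> \<Phi> P2 K y \<partial>\<alpha>)"
      using Gb by (intro nn_integral_mono) simp
    then show "(\<integral>\<^sup>+y. ennreal (norm (G y)) \<partial>\<alpha>) < \<infinity>" using kfin by (rule le_less_trans)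
  qed simp
  have b1: "\<bar>indicator (strip n) p * h p\<bar> \<le> 1" for n p using b[of p] by (simp split: split_indicator)
  have iN: "integrable N1 (\<lambda>p. indicator (strip n) p * h p)" "integrable N2 (\<lambda>p. indicator (strip n) p * h p)" for n
    using b1 by (auto intro!: f1.integrable_bounded[where B=1] f2.integrable_bounded[where B=1])
  have step: "(\<integral>y. indicator (cball 0 (real n)) y * G y \<partial>\<alpha>) =
      (\<integral>p. indicator (strip n) p * h p \<partial>N1) - (\<integral>p. indicator (strip n) p * h p \<partial>N2)" for n
  proof -
    have "(\<integral>y. indicator (cball 0 (real n)) y * G y \<partial>\<alpha>) =
        (\<integral>y. indicator (cball 0 (real n)) y * (\<integral>p. h (y, p) \<partial>pair_palm y) \<partial>\<alpha>) -
        (\<integral>y. indicator (cball 0 (real n)) y * (\<integral>p. h (y, p) \<partial>mean_pair) \<partial>\<alpha>)"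
      unfolding G_def right_diff_distrib by (rule Bochner_Integration.integral_diff[OF J(3) Q(3)])
    also have "\<dots> = (\<integral>p. indicator (strip n) p * h p \<partial>joint_palm) - (\<integral>p. indicator (strip n) p * h p \<partial>mean_joint)"
      by (simp only: J(2)[of n] Q(2)[of n])
    also have "\<dots> = (\<integral>p. indicator (strip n) p * h p \<partial>N1) - (\<integral>p. indicator (strip n) p * h p \<partial>N2)"
      by (rule integral_diff_eq_of_add_eq) (use dec sN J(1) Q(1) iN in auto)
    finally show ?thesis .
  qed
  have lim: "(\<lambda>n. indicator (cball 0 (real n)) x :: real) \<longlonglongrightarrow> 1" for x :: "real^'d"
  proof -
    obtain m :: nat where "norm x \<le> real m" using real_arch_simple by blast
    then have "\<forall>\<^sub>F n in sequentially. indicator (cball 0 (real n)) x = (1 :: real)"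
      by (intro eventually_sequentiallyI[of m]) simp
    then show ?thesis by (rule tendsto_eventually)
  qed
  have "(\<lambda>n. \<integral>y. indicator (cball 0 (real n)) y * G y \<partial>\<alpha>) \<longlonglongrightarrow> (\<integral>y. G y \<partial>\<alpha>)"
  proof (rule integral_dominated_convergence[where w="\<lambda>y. \<bar>G y\<bar>"])
    show "AE y in \<alpha>. (\<lambda>n. indicator (cball 0 (real n)) y * G y) \<longlonglongrightarrow> G y"
      using tendsto_mult[OF lim tendsto_const] by (intro AE_I2) force
    show "AE y in \<alpha>. norm (indicator (cball 0 (real n)) y * G y) \<le> \<bar>G y\<bar>" for n
      by (intro AE_I2) (simp add: abs_mult split: split_indicator)
  qed (use iG in \<open>auto intro!: borel_measurable_times borel_measurable_indicator\<close>)
  then have limG: "(\<lambda>n. (\<integral>p. indicator (strip n) p * h p \<partial>N1) - (\<integral>p. indicator (strip n) p * h p \<partial>N2)) \<longlonglongrightarrow> (\<integral>y. G y \<partial>\<alpha>)"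
    unfolding step .
  have limN: "(\<lambda>n. \<integral>p. indicator (strip n) p * h p \<partial>N) \<longlonglongrightarrow> (\<integral>p. h p \<partial>N)"
    if "finite_measure N" and [measurable_cong]: "sets N = sets (borel \<Otimes>\<^sub>M borel \<Otimes>\<^sub>M borel)" for N
  proof (rule integral_dominated_convergence[where w="\<lambda>_. 1"])
    interpret finite_measure N by fact
    have "(\<lambda>n. indicator (strip n) p * h p) \<longlonglongrightarrow> h p" for p
    proof -
      have "(\<lambda>n. indicator (cball 0 (real n)) (fst p) * h p) \<longlonglongrightarrow> 1 * h p" by (intro tendsto_mult lim tendsto_const)
      moreover have "indicator (strip n) p = (indicator (cball 0 (real n)) (fst p) :: real)" for n
        by (simp add: strip_def split: split_indicator)
      ultimately show ?thesis by simp
    qed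
    then show "AE p in N. (\<lambda>n. indicator (strip n) p * h p) \<longlonglongrightarrow> h p" by simp
    show "integrable N (\<lambda>_. 1 :: real)" by simp
    show "AE p in N. norm (indicator (strip n) p * h p) \<le> 1" for n using b1 by simp
  qed measurable
  have "(\<integral>y. G y \<partial>\<alpha>) = (\<integral>p. h p \<partial>N1) - (\<integral>p. h p \<partial>N2)"
    by (rule LIMSEQ_unique[OF limG tendsto_diff[OF limN[OF fN(1) sN(1)] limN[OF fN(2) sN(2)]]])
  then show ?thesis using iG unfolding G_def by (simp add: has_bochner_integral_iff)
qed

text \<open>Positive and negative part of \<open>h\<close> have values in [0,1], and the claim is
  linear in \<open>h\<close>.\<close>

lemma has_integral_real:
  assumes h[measurable]: "h \<in> borel_measurable (borel \<Otimes>\<^sub>M borel \<Otimes>\<^sub>M borel)" and b: "\<And>p. \<bar>h p\<bar> \<le> (1 :: real)"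
  shows "has_bochner_integral \<alpha> (\<lambda>y. (\<integral>p. h (y, p) \<partial>pair_palm y) - (\<integral>p. h (y, p) \<partial>mean_pair))
    ((\<integral>p. h p \<partial>N1) - (\<integral>p. h p \<partial>N2))"
proof -
  let ?u = "\<lambda>p. max 0 (h p)" and ?v = "\<lambda>p. max 0 (- h p)"
  have h1: "h p \<le> 1" "- h p \<le> 1" "- 1 \<le> h p" for p using b[of p] by (auto simp: abs_le_iff)
  then have hb: "?u p \<le> 1" "?v p \<le> 1" for p by simp_all
  have d: "(\<integral>p. h (g p) \<partial>N) = (\<integral>p. ?u (g p) \<partial>N) - (\<integral>p. ?v (g p) \<partial>N)"
    if "finite_measure N" "g \<in> N \<rightarrow>\<^sub>M (borel \<Otimes>\<^sub>M borel \<Otimes>\<^sub>M borel)" for N and g :: "'z \<Rightarrow> _"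
  proof -
    interpret finite_measure N by fact
    note [measurable] = that(2)
    have "integrable N (\<lambda>p. ?u (g p))" "integrable N (\<lambda>p. ?v (g p))"
      by (rule integrable_bounded[where B=1]; simp add: h1)+
    then have "(\<integral>p. ?u (g p) \<partial>N) - (\<integral>p. ?v (g p) \<partial>N) = (\<integral>p. ?u (g p) - ?v (g p) \<partial>N)" by simp
    also have "\<dots> = (\<integral>p. h (g p) \<partial>N)" by (intro Bochner_Integration.integral_cong) auto
    finally show ?thesis ..
  qed
  have m1: "Pair y \<in> pair_palm y \<rightarrow>\<^sub>M (borel \<Otimes>\<^sub>M borel \<Otimes>\<^sub>M borel)" "Pair y \<in> mean_pair \<rightarrow>\<^sub>M (borel \<Otimes>\<^sub>M borel \<Otimes>\<^sub>M borel)" for y :: "real^'d"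
    using sets_mean_pair by (simp_all cong: measurable_cong_sets)
  have m2: "(\<lambda>p. p) \<in> N1 \<rightarrow>\<^sub>M (borel \<Otimes>\<^sub>M borel \<Otimes>\<^sub>M borel)" "(\<lambda>p. p) \<in> N2 \<rightarrow>\<^sub>M (borel \<Otimes>\<^sub>M borel \<Otimes>\<^sub>M borel)"
    by simp_all
  have "has_bochner_integral \<alpha> (\<lambda>y. ((\<integral>p. ?u (y, p) \<partial>pair_palm y) - (\<integral>p. ?u (y, p) \<partial>mean_pair)) -
      ((\<integral>p. ?v (y, p) \<partial>pair_palm y) - (\<integral>p. ?v (y, p) \<partial>mean_pair)))
      (((\<integral>p. ?u p \<partial>N1) - (\<integral>p. ?u p \<partial>N2)) - ((\<integral>p. ?v p \<partial>N1) - (\<integral>p. ?v p \<partial>N2)))"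
    using hb by (intro has_bochner_integral_diff has_integral_unit) auto
  then show ?thesis
    unfolding d[OF prob_space.finite_measure[OF prob_space_pair_palm] m1(1)] d[OF prob_space.finite_measure[OF prob_space_mean_pair] m1(2)]
      d[OF fN(1) m2(1)] d[OF fN(2) m2(2)] by (simp add: algebra_simps)
qed

lemma has_integral_complex:
  assumes h[measurable]: "h \<in> borel_measurable (borel \<Otimes>\<^sub>M borel \<Otimes>\<^sub>M borel)" and b: "\<And>p. cmod (h p) \<le> 1"
  shows "has_bochner_integral \<alpha> (\<lambda>y. (\<integral>p. h (y, p) \<partial>pair_palm y) - (\<integral>p. h (y, p) \<partial>mean_pair))
    ((\<integral>p. h p \<partial>N1) - (\<integral>p. h p \<partial>N2))"
proof -
  have rb: "\<bar>Re (h p)\<bar> \<le> 1" and ib: "\<bar>Im (h p)\<bar> \<le> 1" for p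
    using abs_Re_le_cmod[of "h p"] abs_Im_le_cmod[of "h p"] b[of p] by linarith+
  have d: "(\<integral>p. h (g p) \<partial>N) = complex_of_real (\<integral>p. Re (h (g p)) \<partial>N) + \<i> * complex_of_real (\<integral>p. Im (h (g p)) \<partial>N)"
    if "finite_measure N" "g \<in> N \<rightarrow>\<^sub>M (borel \<Otimes>\<^sub>M borel \<Otimes>\<^sub>M borel)" for N and g :: "'z \<Rightarrow> _"
  proof -
    interpret finite_measure N by fact
    note [measurable] = that(2)
    have "integrable N (\<lambda>p. h (g p))" by (rule integrable_bounded[where B=1]) (simp_all add: b)
    then show ?thesis by (simp add: complex_eq_iff)
  qed
  have m1: "Pair y \<in> pair_palm y \<rightarrow>\<^sub>M (borel \<Otimes>\<^sub>M borel \<Otimes>\<^sub>M borel)" "Pair y \<in> mean_pair \<rightarrow>\<^sub>M (borel \<Otimes>\<^sub>M borel \<Otimes>\<^sub>M borel)" for y :: "real^'d"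
    using sets_mean_pair by (simp_all cong: measurable_cong_sets)
  have m2: "(\<lambda>p. p) \<in> N1 \<rightarrow>\<^sub>M (borel \<Otimes>\<^sub>M borel \<Otimes>\<^sub>M borel)" "(\<lambda>p. p) \<in> N2 \<rightarrow>\<^sub>M (borel \<Otimes>\<^sub>M borel \<Otimes>\<^sub>M borel)"
    by simp_all
  have "has_bochner_integral \<alpha> (\<lambda>y. complex_of_real ((\<integral>p. Re (h (y, p)) \<partial>pair_palm y) - (\<integral>p. Re (h (y, p)) \<partial>mean_pair)) +
      \<i> * complex_of_real ((\<integral>p. Im (h (y, p)) \<partial>pair_palm y) - (\<integral>p. Im (h (y, p)) \<partial>mean_pair)))
      (complex_of_real ((\<integral>p. Re (h p) \<partial>N1) - (\<integral>p. Re (h p) \<partial>N2)) + \<i> * complex_of_real ((\<integral>p. Im (h p) \<partial>N1) - (\<integral>p. Im (h p) \<partial>N2)))"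
    using rb ib
    by (intro has_bochner_integral_add has_bochner_integral_mult_right has_bochner_integral_of_real has_integral_real) auto
  then show ?thesis
    unfolding d[OF prob_space.finite_measure[OF prob_space_pair_palm] m1(1)] d[OF prob_space.finite_measure[OF prob_space_mean_pair] m1(2)]
      d[OF fN(1) m2(1)] d[OF fN(2) m2(2)] by (simp add: algebra_simps)
qed

section \<open>The finite measures representing \<eta>\<close>

text \<open>Images of \<open>N1\<close> and \<open>N2\<close> under the same map that sends
  \<open>joint_palm\<close> to \<open>transported_moment\<close> and \<open>mean_joint\<close> to
  \<open>mean_moment\<close>; hence \<eta> is their difference.\<close>

definition E1 :: "(real^'d) measure" where "E1 = distr N1 borel (\<lambda>(y, v, u). y + v - u)"
definition E2 :: "(real^'d) measure" where "E2 = distr N2 borel (\<lambda>(y, v, u). y + v - u)"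

lemma sets_E [simp, measurable_cong]: "sets E1 = sets borel" "sets E2 = sets borel"
  by (simp_all add: E1_def E2_def)

lemma finite_E: "finite_measure E1" "finite_measure E2"
  unfolding E1_def E2_def by (intro finite_measure.finite_measure_distr fN; measurable)+

lemma moment_decomposition:
  assumes B[measurable]: "B \<in> sets borel"
  shows "emeasure transported_moment B + emeasure E2 B = emeasure mean_moment B + emeasure E1 B"
proof -
  let ?s = "\<lambda>(y, v, u). y + v - u :: real^'d"
  have sp: "space N = UNIV" if "sets N = sets (borel \<Otimes>\<^sub>M borel \<Otimes>\<^sub>M borel :: ((real^'d) \<times> (real^'d) \<times> (real^'d)) measure)" for N
    using sets_eq_imp_space_eq[OF that] by (simp add: space_pair_measure)
  have "?s -` B \<inter> space (borel \<Otimes>\<^sub>M borel \<Otimes>\<^sub>M borel) \<in> sets (borel \<Otimes>\<^sub>M borel \<Otimes>\<^sub>M borel)"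
    by (rule measurable_sets[OF _ B]) measurable
  then have "?s -` B \<in> sets (borel \<Otimes>\<^sub>M borel \<Otimes>\<^sub>M borel)" by (simp add: space_pair_measure)
  from dec[OF this] show ?thesis
    by (simp add: transported_moment_def mean_moment_def E1_def E2_def emeasure_distr sp sN)
qed

text \<open>Dropping \<open>E2\<close> from the decomposition leaves an upper bound by a locally
  finite and a finite measure.\<close>

lemma locally_finite_transported_moment: "locally_finite transported_moment"
proof (rule locally_finite_of_cball)
  fix r
  have "emeasure transported_moment (cball 0 r) \<le> emeasure mean_moment (cball 0 r) + emeasure E1 (cball 0 r)"
    using moment_decomposition[of "cball 0 r"] by (metis borel_closed closed_cball le_iff_add)
  also have "\<dots> < \<infinity>"
    using locally_finite_mean_moment finite_measure.emeasure_finite[OF finite_E(1)]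
    by (simp add: locally_finite_def less_top)
  finally show "emeasure transported_moment (cball 0 r) < \<infinity>" .
qed simp

lemma mean_fourier: "(\<integral>\<omega>. fourier_measure (kernel_star K \<omega> 0) k \<partial>palm M \<theta> \<Phi>) = fourier_measure mean_measure k"
  unfolding fourier_measure_def mean_measure_def
  by (rule integral_bind_complex[where B=1, symmetric, OF _ _ kernel_star_0_measurable prob_space_palm]) auto

text \<open>The signed difference is tested with the exponential of y + v - u. The factor in y comes
  out of the inner integrals, v yields the transform of the starred kernel at y, and -u the
  conjugate transform of the one at 0.\<close>

lemma fourier_E:
  "has_bochner_integral \<alpha>
    (\<lambda>y. exp (- (\<i> * complex_of_real (k \<bullet> y))) *
      ((\<integral>\<omega>. fourier_measure (kernel_star K \<omega> y) k * cnj (fourier_measure (kernel_star K \<omega> 0) k) \<partial>P2 y) -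
        complex_of_real ((cmod (fourier_measure mean_measure k))\<^sup>2)))
    (fourier_measure E1 k - fourier_measure E2 k)"
proof -
  let ?h = "\<lambda>p. exp (- (\<i> * complex_of_real (k \<bullet> (case p of (y, v, u) \<Rightarrow> y + v - u))))"
  let ?e = "\<lambda>p :: (real^'d) \<times> (real^'d). exp (- (\<i> * complex_of_real (k \<bullet> (fst p - snd p))))"
  have hm[measurable]: "?h \<in> borel_measurable (borel \<Otimes>\<^sub>M borel \<Otimes>\<^sub>M borel)" by measurable
  have H: "has_bochner_integral \<alpha> (\<lambda>y. (\<integral>p. ?h (y, p) \<partial>pair_palm y) - (\<integral>p. ?h (y, p) \<partial>mean_pair))
    ((\<integral>p. ?h p \<partial>N1) - (\<integral>p. ?h p \<partial>N2))"
    by (rule has_integral_complex[OF hm]) simp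
  have E: "fourier_measure E1 k = (\<integral>p. ?h p \<partial>N1)" "fourier_measure E2 k = (\<integral>p. ?h p \<partial>N2)"
    unfolding fourier_measure_def E1_def E2_def by (rule integral_distr; measurable)+
  have hy: "?h (y, p) = exp (- (\<i> * complex_of_real (k \<bullet> y))) * ?e p" for y p
    by (cases p) (simp add: exp_add[symmetric] inner_add_right inner_diff_right algebra_simps)
  have P: "(\<integral>p. ?e p \<partial>pair_palm y) = (\<integral>\<omega>. fourier_measure (kernel_star K \<omega> y) k * cnj (fourier_measure (kernel_star K \<omega> 0) k) \<partial>P2 y)" for y
  proof -
    have "(\<integral>p. ?e p \<partial>pair_palm y) = (\<integral>\<omega>. (\<integral>p. ?e p \<partial>(kernel_star K \<omega> y \<Otimes>\<^sub>M kernel_star K \<omega> 0)) \<partial>P2 y)"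
      unfolding pair_palm_def
      by (rule integral_bind_complex[where B=1 and L="borel \<Otimes>\<^sub>M borel", OF _ _ pair_kernel_measurable prob_space_P2]) auto
    also have "\<dots> = (\<integral>\<omega>. fourier_measure (kernel_star K \<omega> y) k * cnj (fourier_measure (kernel_star K \<omega> 0) k) \<partial>P2 y)"
      by (intro Bochner_Integration.integral_cong refl integral_pair_exp)
         (auto simp: kernel_star_space intro: prob_space.finite_measure)
    finally show ?thesis .
  qed
  have Q: "(\<integral>p. ?e p \<partial>mean_pair) = complex_of_real ((cmod (fourier_measure mean_measure k))\<^sup>2)"
    unfolding complex_norm_square
    by (rule integral_pair_exp) (simp_all add: prob_space.finite_measure prob_space_mean_measure)
  show ?thesis
    using H unfolding hy integral_mult_right_zero P Q E by (simp add: right_diff_distrib)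
qed

end

lemma continuous_on_fourier_measure:
  fixes \<mu> :: "(real^'d) measure"
  assumes fin: "finite_measure \<mu>" and [measurable_cong]: "sets \<mu> = sets borel"
  shows "continuous_on UNIV (fourier_measure \<mu>)"
  unfolding continuous_on_sequentially
proof (intro allI ballI impI, elim conjE)
  interpret finite_measure \<mu> by fact
  fix x :: "nat \<Rightarrow> real^'d" and a assume x: "x \<longlonglongrightarrow> a"
  have "(\<lambda>n. \<integral>y. exp (- (\<i> * complex_of_real (x n \<bullet> y))) \<partial>\<mu>) \<longlonglongrightarrow> (\<integral>y. exp (- (\<i> * complex_of_real (a \<bullet> y))) \<partial>\<mu>)"
    by (rule integral_dominated_convergence[where w="\<lambda>_. 1"]) (use x in \<open>auto intro!: tendsto_intros\<close>)
  then show "(fourier_measure \<mu> \<circ> x) \<longlonglongrightarrow> fourier_measure \<mu> a" by (simp add: fourier_measure_def comp_def)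
qed

lemma fourier_measure_0: "prob_space \<mu> \<Longrightarrow> fourier_measure \<mu> 0 = 1"
  by (simp add: fourier_measure_def prob_space.prob_space)

text \<open>For a test function with values in [-1,1] each of the two integrals is bounded by a
  total mass.\<close>

lemma tv_norm_diff_finite:
  assumes fin: "finite_measure \<mu>1" "finite_measure \<mu>2" and s: "sets \<mu>1 = sets N" "sets \<mu>2 = sets N"
  shows "tv_norm N (\<lambda>B. measure \<mu>1 B - measure \<mu>2 B) < \<infinity>"
proof -
  let ?C = "measure \<mu>1 (space \<mu>1) + measure \<mu>2 (space \<mu>2)"
  have "tv_norm N (\<lambda>B. measure \<mu>1 B - measure \<mu>2 B) \<le> ennreal ?C"
    unfolding tv_norm_def
  proof (rule SUP_least)
    fix f :: "'a \<Rightarrow> real"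
    assume "f \<in> {f. f \<in> borel_measurable N \<and> (\<forall>x\<in>space N. f x \<in> {-1..1})}"
    then have f: "f \<in> borel_measurable N" "\<And>x. x \<in> space N \<Longrightarrow> \<bar>f x\<bar> \<le> 1" by (auto simp: abs_le_iff minus_le_iff)
    have b: "\<bar>\<integral>x. f x \<partial>\<mu>\<bar> \<le> measure \<mu> (space \<mu>)" if "finite_measure \<mu>" "sets \<mu> = sets N" for \<mu>
    proof -
      interpret finite_measure \<mu> by fact
      have "\<bar>\<integral>x. f x \<partial>\<mu>\<bar> \<le> (\<integral>x. \<bar>f x\<bar> \<partial>\<mu>)" using integral_norm_bound[of \<mu> f] by simp
      also have "\<dots> \<le> (\<integral>x. 1 \<partial>\<mu>)"
        using f that sets_eq_imp_space_eq[OF that(2)]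
        by (intro integral_mono integrable_bounded[where B=1]) (auto cong: measurable_cong_sets)
      finally show ?thesis by simp
    qed
    have "\<bar>signed_integral N (\<lambda>B. measure \<mu>1 B - measure \<mu>2 B) f\<bar> \<le> ?C"
      using b[OF fin(1) s(1)] b[OF fin(2) s(2)] f by (subst signed_integral_diff[OF fin s, where C=1]) auto
    then show "ennreal \<bar>signed_integral N (\<lambda>B. measure \<mu>1 B - measure \<mu>2 B) f\<bar> \<le> ennreal ?C" by (rule ennreal_leI)
  qed
  also have "\<dots> < \<infinity>" by simp
  finally show ?thesis .
qed

lemma signed_measure_diff:
  assumes "finite_measure \<mu>1" "finite_measure \<mu>2" "sets \<mu>1 = sets N" "sets \<mu>2 = sets N"
  shows "signed_measure N (\<lambda>B. measure \<mu>1 B - measure \<mu>2 B)"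
  unfolding signed_measure_def
  using assms by (auto intro!: sums_diff finite_measure.finite_measure_UNION)

lemma integrable_tent_corr_locally_finite:
  fixes \<mu> :: "(real^'d) measure"
  assumes R: "0 < R" and lf: "locally_finite \<mu>"
  shows "integrable \<mu> (\<lambda>z. tent_corr R (z - t))"
proof (rule Bochner_Integration.integrable_bound)
  have s[measurable_cong]: "sets \<mu> = sets borel" using lf by (simp add: locally_finite_def)
  let ?B = "\<integral>x. tent R x \<partial>(lborel :: (real^'d) measure)"
  have "emeasure \<mu> (cball t (2 / R)) < \<infinity>" using lf by (simp add: locally_finite_def)
  then show "integrable \<mu> (\<lambda>z. ?B * indicator (cball t (2 / R)) z)" using s by (simp add: integrable_indicator_iff)
  show "(\<lambda>z. tent_corr R (z - t)) \<in> borel_measurable \<mu>"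
    using borel_measurable_tent_corr[OF R] by measurable
  show "AE z in \<mu>. norm (tent_corr R (z - t)) \<le> norm (?B * indicator (cball t (2 / R)) z)"
  proof (rule AE_I2)
    fix z
    show "norm (tent_corr R (z - t)) \<le> norm (?B * indicator (cball t (2 / R)) z)"
      using tent_corr_support[OF R, of "z - t"] tent_corr_le[OF R, of "z - t"] tent_corr_nonneg[OF R, of "z - t"]
      by (cases "tent_corr R (z - t) = 0") (auto simp: dist_norm norm_minus_commute)
  qed
qed

section \<open>The Bartlett spectral measure of the transport\<close>

text \<open>The Bartlett property with the translated tent as f and the tent at the origin as g. The
  intensity term does not depend on x by translation invariance of Lebesgue measure, and
  integrability of the weight is the case x = 0.\<close>

lemma bartlett_tent:
  fixes S :: "(real^'d) measure"
  assumes S: "bartlett_measure M \<Psi> S" and R: "0 < R"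
  shows "integrable S (tent_spec R)"
    and "(\<integral>k. exp (- (\<i> * complex_of_real (x \<bullet> k))) * complex_of_real (tent_spec R k) \<partial>S) =
      complex_of_real ((2 * pi) ^ CARD('d) * ((\<integral>y. tent_corr R (y - x) \<partial>second_moment M \<Psi>) -
        (enn2real (intensity M \<Psi>))\<^sup>2 * (\<integral>y. tent_corr R y \<partial>(lborel :: (real^'d) measure))))"
proof -
  have P: "fourier_fun (\<lambda>y. tent R (y - x)) k * cnj (fourier_fun (tent R) k) =
      exp (- (\<i> * complex_of_real (x \<bullet> k))) * complex_of_real (tent_spec R k)" for x k :: "real^'d"
    unfolding fourier_tent_translate[OF R] tent_spec_def complex_norm_square by (simp add: inner_commute)
  have T: "bounded_test_fun (tent R :: real^'d \<Rightarrow> real)" using bounded_test_fun_tent[OF R, of 0] by simp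
  have H: "has_bochner_integral S (\<lambda>k. exp (- (\<i> * complex_of_real (x \<bullet> k))) * complex_of_real (tent_spec R k))
      ((2 * pi) ^ CARD('d) * covariance_integral M \<Psi> (star_conv (\<lambda>y. tent R (y - x)) (tent R)))" for x
    using S bounded_test_fun_tent[OF R, of x] T unfolding bartlett_measure_def P[symmetric] by blast
  have "integrable S (\<lambda>k. complex_of_real (tent_spec R k))"
    using integrable.intros[OF H[of 0]] by simp
  from integrable_Re[OF this] show "integrable S (tent_spec R)" by simp
  have sc: "star_conv (\<lambda>y. tent R (y - x)) (tent R) = (\<lambda>y. tent_corr R (y - x))"
    by (rule ext) (rule star_conv_tent_translate[OF R])
  have "(\<integral>y. tent_corr R (y - x) \<partial>lborel) = (\<integral>y. tent_corr R y \<partial>(lborel :: (real^'d) measure))"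
    using integral_lborel_translate[OF borel_measurable_tent_corr[OF R], of "- x"] by simp
  then show "(\<integral>k. exp (- (\<i> * complex_of_real (x \<bullet> k))) * complex_of_real (tent_spec R k) \<partial>S) =
      complex_of_real ((2 * pi) ^ CARD('d) * ((\<integral>y. tent_corr R (y - x) \<partial>second_moment M \<Psi>) -
        (enn2real (intensity M \<Psi>))\<^sup>2 * (\<integral>y. tent_corr R y \<partial>(lborel :: (real^'d) measure))))"
    using has_bochner_integral_integral_eq[OF H[of x]] by (simp add: covariance_integral_def sc)
qed

section \<open>Spectral decomposition of the transport\<close>

context decomposed_transport
begin

lemma second_moment_K: "second_moment M (transport K \<Phi>) = transported_moment"
  by (rule second_moment_transport[OF locally_finite_transported_moment])

lemma square_integrable_K: "locally_square_integrable M (transport K \<Phi>)"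
  by (rule locally_square_integrable_transport[OF locally_finite_transported_moment])

lemma second_moment_L: "second_moment M (transport (\<lambda>_. mean_kernel M \<theta> \<Phi> K) \<Phi>) = mean_moment"
  and square_integrable_L: "locally_square_integrable M (transport (\<lambda>_. mean_kernel M \<theta> \<Phi> K) \<Phi>)"
proof -
  interpret L: transported_random_measure M \<theta> \<Phi> P2 "\<lambda>_. mean_kernel M \<theta> \<Phi> K" by (rule transported_mean_kernel)
  have lf: "locally_finite L.transported_moment" unfolding mean_moment_eq by (rule locally_finite_mean_moment)
  show "second_moment M (transport (\<lambda>_. mean_kernel M \<theta> \<Phi> K) \<Phi>) = mean_moment"
    using L.second_moment_transport[OF lf] unfolding mean_moment_eq .
  show "locally_square_integrable M (transport (\<lambda>_. mean_kernel M \<theta> \<Phi> K) \<Phi>)"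
    by (rule L.locally_square_integrable_transport[OF lf])
qed

text \<open>The moment measure of L\<Phi> is \<alpha> displaced by v - u and averaged over m
  \<otimes> m. Averaging the Bartlett equation of \<Phi> over the translates x + u - v and
  exchanging with the spectral measure produces the squared modulus; passing from L\<Phi> to K\<Phi>
  adds the difference of \<open>E1\<close> and \<open>E2\<close>.\<close>

lemma spectral_equation:
  assumes S: "bartlett_measure M \<Phi> S" and SK: "bartlett_measure M (transport K \<Phi>) SK" and R: "0 < R"
  shows "(\<integral>k. exp (- (\<i> * complex_of_real (x \<bullet> k))) * complex_of_real (tent_spec R k) \<partial>SK) =
      (\<integral>k. exp (- (\<i> * complex_of_real (x \<bullet> k))) * complex_of_real (tent_spec R k * (cmod (fourier_measure mean_measure k))\<^sup>2) \<partial>S) +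
      complex_of_real ((2 * pi) ^ CARD('d) * ((\<integral>z. tent_corr R (z - x) \<partial>E1) - (\<integral>z. tent_corr R (z - x) \<partial>E2)))"
proof -
  note [measurable_cong] = sets_mean_pair
  note [measurable] = borel_measurable_tent_corr[OF R] borel_measurable_tent_spec[OF R, where 'd='d]
  interpret mm: prob_space mean_pair by (rule prob_space_mean_pair)
  define c where "c = (2 * pi) ^ CARD('d)"
  have c0: "0 < c" by (simp add: c_def)
  \<comment> \<open>The same constant serves for \<Phi> and K\<Phi>, by
    \<open>intensity_transport\<close>.\<close>
  define q where "q = (enn2real \<gamma>)\<^sup>2 * (\<integral>y. tent_corr R y \<partial>(lborel :: (real^'d) measure))"
  define A where "A t = (\<integral>y. tent_corr R (y - t) \<partial>\<alpha>)" for t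
  let ?J = "\<lambda>t. \<integral>k. exp (- (\<i> * complex_of_real (t \<bullet> k))) * complex_of_real (tent_spec R k) \<partial>S"
  have J: "?J t = complex_of_real (c * (A t - q))" for t
    unfolding bartlett_tent(2)[OF S R] A_def c_def q_def ..
  have iw: "integrable S (tent_spec R)" by (rule bartlett_tent(1)[OF S R])
  have sS[measurable_cong]: "sets S = sets borel" using S by (simp add: bartlett_measure_def locally_finite_def)
  define P where "P = density S (\<lambda>k. ennreal (tent_spec R k))"
  have sP[measurable_cong, simp]: "sets P = sets borel" by (simp add: P_def sS)
  have fP: "finite_measure P"
    by (rule finite_measureI) (use iw in \<open>simp add: P_def emeasure_density nn_integral_eq_integral tent_spec_nonneg[OF R]\<close>)
  have intP: "(\<integral>k. g k \<partial>P) = (\<integral>k. g k * complex_of_real (tent_spec R k) \<partial>S)" if [measurable]: "g \<in> borel_measurable borel" for g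
    unfolding P_def by (subst integral_density) (auto simp: tent_spec_nonneg[OF R] scaleR_conv_of_real mult.commute)
  have JP: "?J t = fourier_measure P t" for t unfolding fourier_measure_def by (rule intP[symmetric]) measurable
  have Am[measurable]: "A \<in> borel_measurable borel"
    unfolding A_def[abs_def] by (rule \<alpha>.borel_measurable_lebesgue_integral) measurable
  have A0: "0 \<le> A t" for t unfolding A_def by (intro integral_nonneg_AE) (simp add: tent_corr_nonneg[OF R])
  \<comment> \<open>Up to the constants c and q, A is the Fourier transform of the finite measure P
    and hence bounded. So the spectral side supplies the integrability needed for the average over
    \<open>mean_pair\<close>.\<close>
  have Ab: "\<bar>A t\<bar> \<le> measure P (space P) / c + \<bar>q\<bar>" for t
  proof -
    have "\<bar>c * (A t - q)\<bar> \<le> measure P (space P)"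
      using norm_fourier_measure_le[OF fP, of t] unfolding JP[symmetric] J norm_of_real .
    then have "\<bar>A t - q\<bar> \<le> measure P (space P) / c"
      unfolding abs_mult abs_of_pos[OF c0] by (simp add: pos_le_divide_eq[OF c0] mult.commute)
    then show ?thesis by linarith
  qed
  have iA: "integrable mean_pair (\<lambda>p. A (x + snd p - fst p))"
    by (rule mm.integrable_bounded[where B="measure P (space P) / c + \<bar>q\<bar>"]) (use Ab in auto)
  have L: "(\<integral>z. tent_corr R (z - x) \<partial>mean_moment) = (\<integral>p. A (x + snd p - fst p) \<partial>mean_pair)"
  proof -
    have "(\<integral>\<^sup>+z. ennreal (tent_corr R (z - x)) \<partial>mean_moment) =
        (\<integral>\<^sup>+p. (\<integral>\<^sup>+y. ennreal (tent_corr R (y + fst p - snd p - x)) \<partial>\<alpha>) \<partial>mean_pair)"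
      by (rule nn_integral_mean_moment) measurable
    also have "\<dots> = (\<integral>\<^sup>+p. ennreal (A (x + snd p - fst p)) \<partial>mean_pair)"
    proof (rule nn_integral_cong)
      fix p :: "(real^'d) \<times> (real^'d)"
      have "(\<integral>\<^sup>+y. ennreal (tent_corr R (y - (x + snd p - fst p))) \<partial>\<alpha>) = ennreal (A (x + snd p - fst p))"
        unfolding A_def
        by (rule nn_integral_eq_integral[OF integrable_tent_corr_locally_finite[OF R locally_finite_second_moment]])
           (simp add: tent_corr_nonneg[OF R])
      then show "(\<integral>\<^sup>+y. ennreal (tent_corr R (y + fst p - snd p - x)) \<partial>\<alpha>) = ennreal (A (x + snd p - fst p))"
        by (simp add: algebra_simps)
    qed
    finally show ?thesis
      using A0 tent_corr_nonneg[OF R] by (subst (1 2) integral_eq_nn_integral) auto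
  qed
  have "complex_of_real (c * ((\<integral>z. tent_corr R (z - x) \<partial>mean_moment) - q)) =
      (\<integral>p. complex_of_real (c * (A (x + snd p - fst p) - q)) \<partial>mean_pair)"
    unfolding L using iA by (subst integral_complex_of_real) (simp add: mm.prob_space)
  also have "\<dots> = (\<integral>p. (\<integral>k. exp (- (\<i> * complex_of_real ((x + snd p - fst p) \<bullet> k))) \<partial>P) \<partial>mean_pair)"
    unfolding J[symmetric] JP fourier_measure_def ..
  also have "\<dots> = (\<integral>k. (\<integral>p. exp (- (\<i> * complex_of_real ((x + snd p - fst p) \<bullet> k))) \<partial>mean_pair) \<partial>P)"
    by (rule Fubini_integral_bounded[where B=1]) (use fP mm.finite_measure_axioms in auto)
  also have "\<dots> = (\<integral>k. exp (- (\<i> * complex_of_real (x \<bullet> k))) * complex_of_real ((cmod (fourier_measure mean_measure k))\<^sup>2) \<partial>P)"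
  proof (rule Bochner_Integration.integral_cong[OF refl])
    fix k :: "real^'d"
    \<comment> \<open>The shift enters as u - v, which gives the transform of the mean measure at
      -k, a conjugate; the squared modulus does not see this.\<close>
    have "(\<integral>p. exp (- (\<i> * complex_of_real ((x + snd p - fst p) \<bullet> k))) \<partial>mean_pair) =
        (\<integral>p. exp (- (\<i> * complex_of_real (x \<bullet> k))) * exp (- (\<i> * complex_of_real ((- k) \<bullet> (fst p - snd p)))) \<partial>mean_pair)"
      by (intro Bochner_Integration.integral_cong refl)
         (simp add: exp_add[symmetric] inner_add_left inner_diff_left inner_diff_right inner_commute algebra_simps)
    also have "\<dots> = exp (- (\<i> * complex_of_real (x \<bullet> k))) * (fourier_measure mean_measure (- k) * cnj (fourier_measure mean_measure (- k)))"
      by (subst integral_pair_exp[symmetric]) (simp_all add: prob_space.finite_measure prob_space_mean_measure)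
    also have "\<dots> = exp (- (\<i> * complex_of_real (x \<bullet> k))) * complex_of_real ((cmod (fourier_measure mean_measure k))\<^sup>2)"
      unfolding complex_norm_square by (simp add: cnj_fourier_measure mult.commute)
    finally show "(\<integral>p. exp (- (\<i> * complex_of_real ((x + snd p - fst p) \<bullet> k))) \<partial>mean_pair) =
        exp (- (\<i> * complex_of_real (x \<bullet> k))) * complex_of_real ((cmod (fourier_measure mean_measure k))\<^sup>2)" .
  qed
  also have "\<dots> = (\<integral>k. exp (- (\<i> * complex_of_real (x \<bullet> k))) * complex_of_real (tent_spec R k * (cmod (fourier_measure mean_measure k))\<^sup>2) \<partial>S)"
  proof -
    have [measurable]: "fourier_measure mean_measure \<in> borel_measurable borel"
      by (rule borel_measurable_fourier_measure) (simp_all add: prob_space.finite_measure prob_space_mean_measure)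
    show ?thesis by (subst intP) (simp_all add: mult_ac)
  qed
  finally have main: "complex_of_real (c * ((\<integral>z. tent_corr R (z - x) \<partial>mean_moment) - q)) =
      (\<integral>k. exp (- (\<i> * complex_of_real (x \<bullet> k))) * complex_of_real (tent_spec R k * (cmod (fourier_measure mean_measure k))\<^sup>2) \<partial>S)" .
  have lfE: "locally_finite E1" "locally_finite E2"
    using finite_measure.emeasure_finite[OF finite_E(1)] finite_measure.emeasure_finite[OF finite_E(2)]
    by (simp_all add: locally_finite_def less_top)
  have diff: "(\<integral>z. tent_corr R (z - x) \<partial>transported_moment) - (\<integral>z. tent_corr R (z - x) \<partial>mean_moment) =
      (\<integral>z. tent_corr R (z - x) \<partial>E1) - (\<integral>z. tent_corr R (z - x) \<partial>E2)"
    by (rule integral_diff_eq_of_add_eq)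
       (simp_all add: moment_decomposition integrable_tent_corr_locally_finite[OF R] lfE locally_finite_transported_moment locally_finite_mean_moment)
  have "(\<integral>k. exp (- (\<i> * complex_of_real (x \<bullet> k))) * complex_of_real (tent_spec R k) \<partial>SK) =
      complex_of_real (c * ((\<integral>z. tent_corr R (z - x) \<partial>transported_moment) - q))"
    unfolding bartlett_tent(2)[OF SK R] second_moment_K intensity_transport c_def q_def ..
  also have "\<dots> = complex_of_real (c * ((\<integral>z. tent_corr R (z - x) \<partial>mean_moment) - q)) +
      complex_of_real (c * ((\<integral>z. tent_corr R (z - x) \<partial>E1) - (\<integral>z. tent_corr R (z - x) \<partial>E2)))"
    unfolding of_real_add[symmetric] distrib_left[symmetric] diff[symmetric] by simp
  finally show ?thesis unfolding main unfolding c_def .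
qed

lemma bartlett_decomposition:
  assumes S: "bartlett_measure M \<Phi> S" and SK: "bartlett_measure M (transport K \<Phi>) SK"
    and B: "B \<in> sets borel" "bounded B"
  shows "complex_of_real (measure SK B) =
    complex_of_real (measure (density S (\<lambda>k. ennreal ((cmod (fourier_measure mean_measure k))\<^sup>2))) B) +
    (LINT k:B|lborel. fourier_measure E1 k - fourier_measure E2 k)"
proof -
  obtain R where R: "0 < R" "B \<subseteq> cball 0 R"
    using bounded_subset_ballD[OF B(2), of 0] ball_subset_cball by (metis subset_trans)
  have "cmod (fourier_measure mean_measure k) \<le> 1" for k
    using norm_fourier_measure_le[OF prob_space.finite_measure[OF prob_space_mean_measure], of k]
    by (simp add: prob_space.prob_space[OF prob_space_mean_measure, simplified])
  then show ?thesis
    using S SK R B spectral_equation[OF S SK R(1)] bartlett_tent(1)[OF S R(1)] bartlett_tent(1)[OF SK R(1)]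
    by (intro spectral_decomposition[of R])
       (auto simp: bartlett_measure_def finite_E
         intro!: borel_measurable_fourier_measure prob_space.finite_measure prob_space_mean_measure)
qed

text \<open>This is \<eta>. It is built from \<open>E1\<close> and \<open>E2\<close> because on
  unbounded sets the second moment measures may be infinite, and \<open>measure\<close> would return
  0 there.\<close>

definition covariance_difference :: "(real^'d) set \<Rightarrow> real" where
  "covariance_difference B = measure E1 B - measure E2 B"

lemma fourier_covariance_difference:
  "fourier_signed covariance_difference k = fourier_measure E1 k - fourier_measure E2 k"
  unfolding fourier_signed_def fourier_measure_def
  by (rule signed_integral_diff[where C=1]) (simp_all add: finite_E covariance_difference_def)

lemma covariance_difference_eq:
  assumes B: "B \<in> sets borel" "bounded B"
  shows "covariance_difference B = measure transported_moment B - measure mean_moment B"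
proof -
  have "measure transported_moment B = measure mean_moment B + (measure E1 B - measure E2 B)"
    unfolding measure_def
    by (rule enn2real_add_eq[OF moment_decomposition[OF B(1)]])
       (use locally_finite_transported_moment locally_finite_mean_moment B finite_E in
         \<open>auto simp: locally_finite_def finite_measure.emeasure_finite less_top[symmetric]\<close>)
  then show ?thesis by (simp add: covariance_difference_def)
qed

text \<open>At k = 0 every transform is the total mass of a probability measure, so the integrand in
  \<open>fourier_E\<close> is 1 - 1 = 0 for each y.\<close>

lemma fourier_covariance_difference_0: "fourier_signed covariance_difference 0 = 0"
proof -
  have "(\<integral>\<omega>. fourier_measure (kernel_star K \<omega> y) 0 * cnj (fourier_measure (kernel_star K \<omega> 0) 0) \<partial>P2 y) = 1" for y
  proof -
    have "(\<integral>\<omega>. fourier_measure (kernel_star K \<omega> y) 0 * cnj (fourier_measure (kernel_star K \<omega> 0) 0) \<partial>P2 y) = (\<integral>\<omega>. 1 \<partial>P2 y)"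
      by (intro Bochner_Integration.integral_cong refl) (simp add: fourier_measure_0 kernel_star_space)
    then show ?thesis using prob_space.prob_space[OF prob_space_P2[of y]] by simp
  qed
  then have "has_bochner_integral \<alpha> (\<lambda>y. 0) (fourier_measure E1 0 - fourier_measure E2 0)"
    using fourier_E[of 0] by (simp add: fourier_measure_0 prob_space_mean_measure)
  then show ?thesis
    unfolding fourier_covariance_difference using has_bochner_integral_zero has_bochner_integral_eq by blast
qed

end

theorem theorem3p6:
  fixes M :: "'w measure"
    and \<theta> :: "real^'d \<Rightarrow> 'w \<Rightarrow> 'w"
    and \<Phi> :: "'w \<Rightarrow> (real^'d) measure"
    and P2 :: "real^'d \<Rightarrow> 'w measure"
    and K :: "'w \<Rightarrow> real^'d \<Rightarrow> (real^'d) measure"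
  assumes "prob_space M"
    and "borel_space M"
    and "measurable_flow M \<theta>"
    and "flow_stationary M \<theta>"
    and "random_measure M \<Phi>"
    and "invariant_measure M \<theta> \<Phi>"
    and "locally_square_integrable M \<Phi>"
    and "0 < intensity M \<Phi>" and "intensity M \<Phi> < \<infinity>"
    and "two_point_palm M \<theta> \<Phi> P2"
    and "invariant_prob_kernel M \<theta> K"
    and "(\<integral>\<^sup>+y. kappa M \<theta> \<Phi> P2 K y \<partial>second_moment M \<Phi>) < \<infinity>"
  shows "let L = mean_kernel M \<theta> \<Phi> K;
             K\<Phi> = transport K \<Phi>;
             L\<Phi> = transport (\<lambda>_. L) \<Phi>;
             a = (\<lambda>k. (\<integral>\<omega>. fourier_measure (kernel_star K \<omega> 0) k \<partial>palm M \<theta> \<Phi>))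
         in locally_square_integrable M K\<Phi> \<and>
            locally_square_integrable M L\<Phi> \<and>
            (\<exists>\<eta> :: (real^'d) set \<Rightarrow> real.
               signed_measure borel \<eta> \<and> tv_norm borel \<eta> < \<infinity> \<and>
               (\<forall>B\<in>sets borel. bounded B \<longrightarrow>
                  \<eta> B = measure (second_moment M K\<Phi>) B - measure (second_moment M L\<Phi>) B) \<and>
               (\<forall>S\<Phi> SK\<Phi>. bartlett_measure M \<Phi> S\<Phi> \<longrightarrow> bartlett_measure M K\<Phi> SK\<Phi> \<longrightarrow>
                  (\<forall>B\<in>sets borel. bounded B \<longrightarrow>
                     complex_of_real (measure SK\<Phi> B) =
                       complex_of_real (measure (density S\<Phi> (\<lambda>k. ennreal ((cmod (a k))\<^sup>2))) B) +
                       (LINT k:B|lborel. fourier_signed \<eta> k))) \<and>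
               (\<forall>k. has_bochner_integral (second_moment M \<Phi>)
                  (\<lambda>y. exp (- (\<i> * complex_of_real (k \<bullet> y))) *
                       ((\<integral>\<omega>. fourier_measure (kernel_star K \<omega> y) k *
                              cnj (fourier_measure (kernel_star K \<omega> 0) k) \<partial>P2 y) -
                        complex_of_real ((cmod (a k))\<^sup>2)))
                  (fourier_signed \<eta> k)) \<and>
               continuous_on UNIV (fourier_signed \<eta>) \<and>
               fourier_signed \<eta> 0 = 0)"
proof -
  interpret transported_random_measure M \<theta> \<Phi> P2 K
    by (intro transported_random_measure.intro stationary_random_measure.intro transported_random_measure_axioms.intro assms)
  obtain N1 N2 where N: "finite_measure N1" "finite_measure N2" "sets N1 = sets (borel \<Otimes>\<^sub>M borel \<Otimes>\<^sub>M borel)"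
    "sets N2 = sets (borel \<Otimes>\<^sub>M borel \<Otimes>\<^sub>M borel)"
    "\<And>D. D \<in> sets (borel \<Otimes>\<^sub>M borel \<Otimes>\<^sub>M borel) \<Longrightarrow>
      emeasure joint_palm D + emeasure N2 D = emeasure mean_joint D + emeasure N1 D"
    using signed_decomposition[OF assms(12)] by blast
  interpret decomposed_transport M \<theta> \<Phi> P2 K N1 N2
    by (intro decomposed_transport.intro decomposed_transport_axioms.intro transported_random_measure_axioms N assms(12))
  have "signed_measure borel covariance_difference" "tv_norm borel covariance_difference < \<infinity>"
    unfolding covariance_difference_def[abs_def]
    by (rule signed_measure_diff tv_norm_diff_finite; simp add: finite_E)+
  moreover have "continuous_on UNIV (fourier_signed covariance_difference)"
    unfolding fourier_covariance_difference
    by (intro continuous_on_diff continuous_on_fourier_measure finite_E sets_E)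
  moreover note bartlett_decomposition[folded fourier_covariance_difference]
    and fourier_E[folded fourier_covariance_difference]
  ultimately show ?thesis
    \<comment> \<open>\<open>mean_fourier\<close> rewrites the Palm expectation of the kernel
      transforms as the transform of the mean measure, the form used in the preceding
      results.\<close>
    unfolding Let_def mean_fourier second_moment_K second_moment_L
    by (intro conjI exI[of _ covariance_difference] ballI allI impI square_integrable_K square_integrable_L
        covariance_difference_eq fourier_covariance_difference_0)
qed

end
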